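(* Let $\chi$ be a character of $\Gamma \subseteq \mathrm{Mp}_1(\mathbb{Z})$, and view it as a character of $\Gamma \ltimes \mathrm{H}(\mathbb{Z})$. Assume that $T \in \Gamma$ and let $\beta \in \mathbb{Q}$ be such that $\chi(T) = e(\beta)$. Further, let $\phi$ be a weakly holomorphic Jacobi form for $\chi$ with possible singularities at $\mathbb{Z} + \tau \mathbb{Z}$. If $\phi$ explains a Ramanujan-type congruence modulo $\ell$ on $M \mathbb{Z} + \beta$, then it explains such congruences on $M \mathbb{Z} + a^2 \beta$ for all $a \in \mathbb{Z}$ such that there is $\begin{psmatrix} a & b \\ c & d \end{psmatrix} \in \Gamma^{\Delta}_M(\chi) \cap \widetilde{\Gamma}_0(\ell)$.
   Context: $\mathrm{Mp}_1(\mathbb{R})$ is the metaplectic group of pairs $(\gamma,\omega)$ with $\gamma=\begin{psmatrix} a & b \\ c & d \end{psmatrix}\in\mathrm{SL}_2(\mathbb{R})$ and $\omega$ a holomorphic square root of $c\tau+d$ on the upper half plane, with multiplication $(\gamma_1,\omega_1)(\gamma_2,\omega_2)=(\gamma_1\gamma_2,\ \omega_1\circ\gamma_2\cdot\omega_2)$; $\mathrm{Mp}_1(\mathbb{Z})$ is the preimage of $\mathrm{SL}_2(\mathbb{Z})$, and $\widetilde{\Gamma}_0(N)$, $\widetilde{\Gamma}^0(N)$ are the preimages of $\Gamma_0(N)$, $\Gamma^0(N)$. $T=\big(\begin{psmatrix} 1 & 1 \\ 0 & 1 \end{psmatrix},1\big)$, $e(z)=\exp(2\pi i z)$, $\delta_M=\big(\begin{psmatrix}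 1 & 0 \\ 0 & M \end{psmatrix},\sqrt{M}\big)$. $\mathrm{H}(\mathbb{Z})$ is the integral Heisenberg group of Eichler–Zagier, and $\chi$ is viewed as a character of $\Gamma\ltimes\mathrm{H}(\mathbb{Z})$ trivial on $\mathrm{H}(\mathbb{Z})$. Let $\iota_M:\widetilde{\Gamma}^0(M)\to\mathrm{Mp}_1(\mathbb{Z})$, $\big(\begin{psmatrix} a & b \\ c & d \end{psmatrix},\omega\big)\mapsto\big(\begin{psmatrix} a & b/M \\ Mc & d \end{psmatrix},\tau\mapsto\omega(M\tau)\big)$, and $\widetilde\chi=\iota_M^\ast\chi$. Define $\Gamma^\Delta_M=\{\gamma=\begin{psmatrix} a & b \\ c & d \end{psmatrix}\in\Gamma : T^{a^2h}\gamma T^{-h}\in\delta_M^{-1}\Gamma\delta_M \text{ for all } h\in\mathbb{Z},\ \gamma \text{ diagonal modulo } M\}$ and $\Gamma^\Delta_M(\chi)=\{\gamma\in\Gamma^\Delta_M : \widetilde\chi(T^{a^2h}\gamma T^{-h})=\widetilde\chi(\gamma)\text{ for all } h\in\mathbb{Z}\}$. A weakly holomorphic Jacobi form $\phi$ with possible singularities at $\mathbb{Z}+\tau\mathbb{Z}$ has Fourier expansion $\phi(\tau,z)=\sum_{n,r}c(\phi;n,r)e(n\tau+rz)$; set $c(\phi;n;z)=\sum_r c(\phi;n,r)e(rz)$ and, with $-\nu$ the order of $\phi$ at $z=0$, $\tilde c(\phi;n;z)=(e(z/2)-e(-z/2))^{\nu}c(\phi;n;z)$. $\phi$ specializes to $f$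 if the leading Laurent coefficient at $z=0$ is $f$. $\phi$ explains a Ramanujan-type congruence modulo a prime $\ell$ on $M\mathbb{Z}+\beta$ if its Fourier coefficients are $\ell$-integral and the $\ell$-th cyclotomic polynomial in $e(z)$ divides $\tilde c(\phi;n;z)$ for all $n\in M\mathbb{Z}+\beta$. *)

theory Defs
  imports "HOL-Complex_Analysis.Complex_Analysis" "HOL-Algebra.Group"
begin

definition ee :: "complex \<Rightarrow> complex" where
  "ee z = exp (2 * of_real pi * \<i> * z)"

definition upper_half :: "complex set" where
  "upper_half = {\<tau>. Im \<tau> > 0}"


subsection \<open>The metaplectic group\<close>

definition mat2 :: "real \<Rightarrow> real \<Rightarrow> real \<Rightarrow> real \<Rightarrow> real ^ 2 ^ 2" where
  "mat2 a b c d = vector [vector [a, b], vector [c, d]]"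

definition autfac :: "real ^ 2 ^ 2 \<Rightarrow> complex \<Rightarrow> complex" where
  "autfac A \<tau> = of_real (A $ 2 $ 1) * \<tau> + of_real (A $ 2 $ 2)"

definition mob :: "real ^ 2 ^ 2 \<Rightarrow> complex \<Rightarrow> complex" where
  "mob A \<tau> = (of_real (A $ 1 $ 1) * \<tau> + of_real (A $ 1 $ 2)) / autfac A \<tau>"

type_synonym mp = "(real ^ 2 ^ 2) \<times> (complex \<Rightarrow> complex)"

text \<open>The ambient group consists of pairs over matrices of positive determinant, so that it
  also contains \<open>\<delta>\<^sub>M\<close>. The square roots live on the upper half plane only and are therefore
  taken to be extensional.\<close>

definition GMp :: "mp monoid" where
  "GMp = \<lparr>
     carrier = {(A, \<omega>). det A > 0 \<and> \<omega> \<in> extensional upper_half \<and> \<omega> holomorphic_on upper_half \<and>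
                        (\<forall>\<tau>\<in>upper_half. (\<omega> \<tau>)\<^sup>2 = autfac A \<tau>)},
     mult = (\<lambda>(A1, \<omega>1) (A2, \<omega>2).
               (A1 ** A2, restrict (\<lambda>\<tau>. \<omega>1 (mob A2 \<tau>) * \<omega>2 \<tau>) upper_half)),
     one = (mat 1, restrict (\<lambda>_. 1) upper_half) \<rparr>"

definition Mp1R :: "mp set" where
  "Mp1R = {g \<in> carrier GMp. det (fst g) = 1}"

definition has_entries :: "mp \<Rightarrow> int \<Rightarrow> int \<Rightarrow> int \<Rightarrow> int \<Rightarrow> bool" where
  "has_entries g a b c d \<longleftrightarrow> fst g = mat2 (of_int a) (of_int b) (of_int c) (of_int d)"

definition Mp1Z :: "mp set" where
  "Mp1Z = {g \<in> Mp1R. \<exists>a b c d. has_entries g a b c d}"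

definition Gamma0_tilde :: "nat \<Rightarrow> mp set" where
  "Gamma0_tilde N = {g \<in> Mp1Z. \<exists>a b c d. has_entries g a b c d \<and> int N dvd c}"

definition mpT :: mp where
  "mpT = (mat2 1 1 0 1, restrict (\<lambda>_. 1) upper_half)"

definition mp_delta :: "nat \<Rightarrow> mp" where
  "mp_delta M = (mat2 1 0 0 (real M), restrict (\<lambda>_. of_real (sqrt (real M))) upper_half)"

definition mp_iota :: "nat \<Rightarrow> mp \<Rightarrow> mp" where
  "mp_iota M = (\<lambda>(A, \<omega>).
     (mat2 (A $ 1 $ 1) (A $ 1 $ 2 / real M) (real M * A $ 2 $ 1) (A $ 2 $ 2),
      restrict (\<lambda>\<tau>. \<omega> (of_nat M * \<tau>)) upper_half))"

definition is_character :: "mp set \<Rightarrow> (mp \<Rightarrow> complex) \<Rightarrow> bool" where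
  "is_character \<Gamma> chi \<longleftrightarrow>
     (\<forall>g\<in>\<Gamma>. chi g \<noteq> 0) \<and> (\<forall>g\<in>\<Gamma>. \<forall>h\<in>\<Gamma>. chi (g \<otimes>\<^bsub>GMp\<^esub> h) = chi g * chi h)"

definition chi_tilde :: "nat \<Rightarrow> (mp \<Rightarrow> complex) \<Rightarrow> mp \<Rightarrow> complex" where
  "chi_tilde M chi g = chi (mp_iota M g)"

definition delta_conj :: "mp set \<Rightarrow> nat \<Rightarrow> mp set" where
  "delta_conj \<Gamma> M =
     (\<lambda>g. inv\<^bsub>GMp\<^esub> (mp_delta M) \<otimes>\<^bsub>GMp\<^esub> g \<otimes>\<^bsub>GMp\<^esub> mp_delta M) ` \<Gamma>"

definition T_twist :: "int \<Rightarrow> int \<Rightarrow> mp \<Rightarrow> mp" where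
  "T_twist a h g = (mpT [^]\<^bsub>GMp\<^esub> (a\<^sup>2 * h)) \<otimes>\<^bsub>GMp\<^esub> g \<otimes>\<^bsub>GMp\<^esub> (mpT [^]\<^bsub>GMp\<^esub> (- h))"

definition Gamma_Delta :: "mp set \<Rightarrow> nat \<Rightarrow> mp set" where
  "Gamma_Delta \<Gamma> M = {g \<in> \<Gamma>. \<exists>a b c d. has_entries g a b c d \<and>
     (\<forall>h. T_twist a h g \<in> delta_conj \<Gamma> M) \<and> int M dvd b \<and> int M dvd c}"

definition Gamma_Delta_chi :: "mp set \<Rightarrow> nat \<Rightarrow> (mp \<Rightarrow> complex) \<Rightarrow> mp set" where
  "Gamma_Delta_chi \<Gamma> M chi = {g \<in> Gamma_Delta \<Gamma> M. \<exists>a b c d. has_entries g a b c d \<and>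
     (\<forall>h. chi_tilde M chi (T_twist a h g) = chi_tilde M chi g)}"


subsection \<open>Jacobi forms\<close>

definition period_lattice :: "complex \<Rightarrow> complex set" where
  "period_lattice \<tau> = {of_int u * \<tau> + of_int v | u v. True}"

definition jacobi_dom :: "(complex \<times> complex) set" where
  "jacobi_dom = {(\<tau>, z). \<tau> \<in> upper_half \<and> z \<notin> period_lattice \<tau>}"

definition holomorphic2_on :: "(complex \<Rightarrow> complex \<Rightarrow> complex) \<Rightarrow> (complex \<times> complex) set \<Rightarrow> bool" where
  "holomorphic2_on f S \<longleftrightarrow>
     (\<forall>p\<in>S. \<exists>A B. ((\<lambda>(\<tau>, z). f \<tau> z) has_derivative (\<lambda>(s, t). A * s + B * t)) (at p))"

text \<open>Meromorphic on the product of the upper half plane with the complex plane, with poles at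
  most along the divisors \<open>z = u \<tau> + v\<close> for integers \<open>u\<close>, \<open>v\<close>. The values of \<open>\<phi>\<close> on these
  divisors are irrelevant.\<close>

definition lattice_meromorphic :: "(complex \<Rightarrow> complex \<Rightarrow> complex) \<Rightarrow> bool" where
  "lattice_meromorphic \<phi> \<longleftrightarrow> holomorphic2_on \<phi> jacobi_dom \<and>
     (\<forall>\<tau>0\<in>upper_half. \<forall>u v :: int. \<exists>(N :: nat) U g.
        open U \<and> (\<tau>0, of_int u * \<tau>0 + of_int v) \<in> U \<and> holomorphic2_on g U \<and>
        (\<forall>(\<tau>, z) \<in> U \<inter> jacobi_dom. (z - of_int u * \<tau> - of_int v) ^ N * \<phi> \<tau> z = g \<tau> z))"

text \<open>Slash actions of weight \<open>w / 2\<close> and index \<open>m\<close>; the integer \<open>w\<close> is twice the weight.\<close>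

definition mp_slash ::
  "int \<Rightarrow> real \<Rightarrow> (complex \<Rightarrow> complex \<Rightarrow> complex) \<Rightarrow> mp \<Rightarrow> complex \<Rightarrow> complex \<Rightarrow> complex" where
  "mp_slash w m \<phi> = (\<lambda>(A, \<omega>) \<tau> z.
     \<omega> \<tau> powi (- w) * ee (- of_real m * of_real (A $ 2 $ 1) * z\<^sup>2 / autfac A \<tau>) *
     \<phi> (mob A \<tau>) (z / autfac A \<tau>))"

definition heis_slash ::
  "real \<Rightarrow> (complex \<Rightarrow> complex \<Rightarrow> complex) \<Rightarrow> int \<times> int \<times> int \<Rightarrow> complex \<Rightarrow> complex \<Rightarrow> complex" where
  "heis_slash m \<phi> = (\<lambda>(u, v, \<kappa>) \<tau> z.
     ee (of_real m * (of_int u ^ 2 * \<tau> + 2 * of_int u * z + of_int (u * v + \<kappa>))) *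
     \<phi> \<tau> (z + of_int u * \<tau> + of_int v))"

text \<open>In the presence of a pole at \<open>z = 0\<close> the expansion depends on the chamber for \<open>z\<close>; it is
  taken for \<open>0 < Im z < Im \<tau>\<close>. Invariance under \<open>z \<mapsto> z + 1\<close> makes \<open>r\<close> integral, while
  \<open>n\<close> is only restricted by the behaviour under translations of \<open>\<tau>\<close>.\<close>

definition jacobi_fourier ::
  "(complex \<Rightarrow> complex \<Rightarrow> complex) \<Rightarrow> (real \<Rightarrow> int \<Rightarrow> complex) \<Rightarrow> bool" where
  "jacobi_fourier \<phi> c \<longleftrightarrow> (\<forall>\<tau> z. 0 < Im z \<and> Im z < Im \<tau> \<longrightarrow>
     ((\<lambda>(n, r). c n r * ee (of_real n * \<tau> + of_int r * z)) has_sum \<phi> \<tau> z) UNIV)"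

text \<open>In the transformation law, the pair of \<open>g\<close> and \<open>X\<close> is an element of the semidirect product
  of \<open>\<Gamma>\<close> with the integral Heisenberg group, on which the character takes the value \<open>chi g\<close>.
  Weak holomorphicity is the condition that at every cusp the exponents of \<open>e(\<tau>)\<close> are bounded
  from below.\<close>

definition weakly_holomorphic_jacobi_form ::
  "mp set \<Rightarrow> (mp \<Rightarrow> complex) \<Rightarrow> int \<Rightarrow> real \<Rightarrow> (complex \<Rightarrow> complex \<Rightarrow> complex) \<Rightarrow> bool" where
  "weakly_holomorphic_jacobi_form \<Gamma> chi w m \<phi> \<longleftrightarrow>
     lattice_meromorphic \<phi> \<and>
     (\<forall>g\<in>\<Gamma>. \<forall>X. \<forall>(\<tau>, z) \<in> jacobi_dom.
        heis_slash m (mp_slash w m \<phi> g) X \<tau> z = chi g * \<phi> \<tau> z) \<and>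
     (\<forall>g\<in>Mp1Z. \<exists>c n0. jacobi_fourier (mp_slash w m \<phi> g) c \<and>
        (\<forall>n r. c n r \<noteq> 0 \<longrightarrow> n \<ge> n0))"


subsection \<open>Ramanujan-type congruences\<close>

definition fourier_coeff :: "(complex \<Rightarrow> complex \<Rightarrow> complex) \<Rightarrow> real \<Rightarrow> int \<Rightarrow> complex" where
  "fourier_coeff \<phi> = (THE c. jacobi_fourier \<phi> c)"

text \<open>The series converges for \<open>Im z > 0\<close>.\<close>

definition fourier_coeff_z :: "(complex \<Rightarrow> complex \<Rightarrow> complex) \<Rightarrow> real \<Rightarrow> complex \<Rightarrow> complex" where
  "fourier_coeff_z \<phi> n z = (\<Sum>\<^sub>\<infinity>r. fourier_coeff \<phi> n r * ee (of_int r * z))"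

text \<open>The order is the one along the divisor \<open>z = 0\<close>: the leading Laurent coefficient \<open>f\<close>, to which
  \<open>\<phi>\<close> specializes, is not identically zero, but may vanish at individual \<open>\<tau>\<close>.\<close>

definition leading_laurent_coeff ::
  "(complex \<Rightarrow> complex \<Rightarrow> complex) \<Rightarrow> int \<Rightarrow> (complex \<Rightarrow> complex) \<Rightarrow> bool" where
  "leading_laurent_coeff \<phi> \<nu> f \<longleftrightarrow>
     (\<forall>\<tau>\<in>upper_half. ((\<lambda>z. z powi \<nu> * \<phi> \<tau> z) \<longlongrightarrow> f \<tau>) (at 0)) \<and> (\<exists>\<tau>\<in>upper_half. f \<tau> \<noteq> 0)"

definition pole_order :: "(complex \<Rightarrow> complex \<Rightarrow> complex) \<Rightarrow> int" where
  "pole_order \<phi> = (THE \<nu>. \<exists>f. leading_laurent_coeff \<phi> \<nu> f)"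

definition fourier_coeff_tilde :: "(complex \<Rightarrow> complex \<Rightarrow> complex) \<Rightarrow> real \<Rightarrow> complex \<Rightarrow> complex" where
  "fourier_coeff_tilde \<phi> n z =
     (ee (z / 2) - ee (- z / 2)) powi pole_order \<phi> * fourier_coeff_z \<phi> n z"

definition cyclotomic_poly :: "nat \<Rightarrow> complex poly" where
  "cyclotomic_poly n = (\<Prod>k | k < n \<and> coprime k n. [:- ee (of_nat k / of_nat n), 1:])"

text \<open>Divisibility in the ring of Laurent polynomials in \<open>e(z/2)\<close>, the quotient being
  \<open>e(s z/2) p(e(z/2))\<close>. As cyclotomic polynomials are monic, allowing complex coefficients in the
  quotient makes no difference.\<close>

definition cyclotomic_divides :: "nat \<Rightarrow> (complex \<Rightarrow> complex) \<Rightarrow> bool" where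
  "cyclotomic_divides l F \<longleftrightarrow> (\<exists>(p :: complex poly) (s :: int). \<forall>z. Im z > 0 \<longrightarrow>
     F z = poly (cyclotomic_poly l) (ee z) * (ee (of_int s * z / 2) * poly p (ee (z / 2))))"

definition l_integral :: "nat \<Rightarrow> complex \<Rightarrow> bool" where
  "l_integral l x \<longleftrightarrow> (\<exists>s :: int. \<not> int l dvd s \<and> algebraic_int (of_int s * x))"

definition explains_congruence ::
  "(complex \<Rightarrow> complex \<Rightarrow> complex) \<Rightarrow> nat \<Rightarrow> nat \<Rightarrow> rat \<Rightarrow> bool" where
  "explains_congruence \<phi> l M \<beta> \<longleftrightarrow>
     (\<forall>n r. l_integral l (fourier_coeff \<phi> n r)) \<and>
     (\<forall>j :: int. cyclotomic_divides l (fourier_coeff_tilde \<phi> (of_int (int M * j) + of_rat \<beta>)))"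

end

theory Submission
  imports Defs
begin

text \<open>
  Let \<open>\<nu>\<close> be the order of the pole of \<open>\<phi>\<close> along \<open>z = 0\<close>. The function
  \<open>(e(z/2) - e(-z/2))\<^sup>\<nu> \<phi>(\<tau>, z)\<close> is holomorphic and periodic in \<open>z\<close> on the strip
  \<open>\<bar>Im z\<bar> < Im \<tau>\<close>, and the elliptic transformation law turns the Fourier expansion above the real
  line into one below it. The maximum principle on strips glues both: the series
  \<open>c~(\<phi>; n; z)\<close> extend to entire functions of \<open>z\<close>, which have exponential growth because the
  exponents \<open>n\<close> are bounded from below in both expansions, and hence are Laurent polynomials in
  \<open>e(z/2)\<close>; moreover the expansion in \<open>\<tau>\<close> remains valid for real \<open>z\<close>. Thus \<open>\<phi>\<close> explains a congruence
  on \<open>M \<int> + \<gamma>\<close> if and only if the part of \<open>\<phi>(\<tau>, k/l)\<close> supported on \<open>M \<int> + \<gamma>\<close>, that is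
  \<open>\<Sum>\<^sub>h e(- h \<gamma> / M) \<phi>((\<tau> + h)/M, k/l)\<close> up to scaling, vanishes for all \<open>k\<close> prime to \<open>l\<close>. Conjugating
  \<open>T\<^bsup>a\<^sup>2h\<^esup> g T\<^bsup>-h\<^esup>\<close> by \<open>\<delta>\<^sub>M\<close> gives elements of \<open>\<Gamma>\<close> with the same value of \<open>\<chi>\<close> for all \<open>h\<close>; they
  permute the summands and the torsion points, and relate the sums for \<open>\<beta>\<close> at \<open>g\<tau>\<close> and
  for \<open>a\<^sup>2\<beta>\<close> at \<open>\<tau>\<close>.
\<close>

text \<open>The torsion points \<open>k/l\<close> are real, so they lie on the wall between the
  chambers \<open>0 < Im z < Im \<tau>\<close> and \<open>- Im \<tau> < Im z < 0\<close>; neither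
  Fourier series is available there, while divisibility is tested in the upper chamber only. The
  entire function \<open>E n\<close> connects the two. Each expansion supplies what the other lacks:
  the lower bound on \<open>n\<close> in one chamber bounds \<open>r\<close> in the other, and this
  forces exponential growth. Coefficients in \<tau> are extracted by means over arithmetic
  progressions and not by integrals, because the exponents are arbitrary reals a priori and because
  a finite combination of slices of \<open>\<psi>\<close> is holomorphic in z without any joint
  regularity near the poles. Powers of e(z/2) enter because e(z/2) - e(-z/2) changes sign under z ->
  z + 1, so that the natural period is 2. In the transfer, the factor relating the h-th summands
  must not depend on h; this holds because the exponents of the modular and the elliptic law cancel
  up to a term in which h does not occur.\<close>

no_notation fps_nth (infixl "$" 75)

subsection \<open>The exponential function and infinite sums\<close>

lemma ee_add: "ee (x + y) = ee x * ee y"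
  by (simp add: ee_def exp_add ring_distribs)

lemma ee_diff: "ee (x - y) = ee x / ee y"
  by (simp add: ee_def exp_diff ring_distribs)

lemma ee_0 [simp]: "ee 0 = 1"
  by (simp add: ee_def)

lemma ee_nonzero [simp]: "ee z \<noteq> 0"
  by (simp add: ee_def)

lemma norm_ee: "norm (ee z) = exp (- 2 * pi * Im z)"
  by (simp add: ee_def)

lemma norm_ee_of_real [simp]: "norm (ee (of_real x)) = 1"
  by (simp add: norm_ee)

lemma ee_of_nat_mult: "ee (of_nat n * z) = ee z ^ n"
  by (simp add: ee_def exp_of_nat_mult [symmetric] mult_ac)

lemma ee_eq_1_iff: "ee z = 1 \<longleftrightarrow> z \<in> \<int>"
proof -
  have "ee z = 1 \<longleftrightarrow> Im z = 0 \<and> (\<exists>n::int. 2 * pi * Re z = of_int (2 * n) * pi)"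
    by (simp add: ee_def exp_eq_1)
  also have "\<dots> \<longleftrightarrow> (\<exists>n::int. z = of_int n)"
    by (auto simp: complex_eq_iff)
  finally show ?thesis by (auto simp: Ints_def)
qed

lemma of_real_complex_Ints_iff: "(of_real x :: complex) \<in> \<int> \<longleftrightarrow> x \<in> \<int>"
  by (auto simp: Ints_def complex_eq_iff)

lemma ee_of_real_eq_1_iff: "ee (of_real x) = 1 \<longleftrightarrow> x \<in> \<int>"
  by (simp add: ee_eq_1_iff of_real_complex_Ints_iff)

lemma ee_of_int [simp]: "ee (of_int k) = 1"
  by (simp add: ee_eq_1_iff)

lemma ee_holomorphic [holomorphic_intros]:
  "f holomorphic_on A \<Longrightarrow> (\<lambda>z. ee (f z)) holomorphic_on A"
  unfolding ee_def by (intro holomorphic_intros)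

lemma complex_summable_imp_norm_summable:
  fixes f :: "'a \<Rightarrow> complex"
  shows "f summable_on A \<Longrightarrow> (\<lambda>x. norm (f x)) summable_on A"
  using summable_on_iff_abs_summable_on_complex by blast

lemma has_sum_sum:
  fixes f :: "'i \<Rightarrow> 'a \<Rightarrow> 'b :: topological_comm_monoid_add"
  assumes "\<And>j. j \<in> J \<Longrightarrow> (f j has_sum S j) A"
  shows "((\<lambda>x. \<Sum>j\<in>J. f j x) has_sum (\<Sum>j\<in>J. S j)) A"
  using assms by (induction J rule: infinite_finite_induct) (auto intro!: has_sum_add)

lemma has_sum_diff:
  fixes f g :: "'a \<Rightarrow> 'b :: topological_ab_group_add"
  assumes "(f has_sum S) A" "(g has_sum T) A"
  shows "((\<lambda>x. f x - g x) has_sum (S - T)) A"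
  using has_sum_add[of f A S "\<lambda>x. - g x" "- T"] assms by (simp add: has_sum_uminus)

subsection \<open>Means of almost periodic series\<close>

text \<open>As K grows, these Cesaro means tend to 1 for \<theta> = 1 and to 0 for every other
  \<theta> of modulus 1, so they single out one frequency.\<close>

definition unit_avg :: "nat \<Rightarrow> complex \<Rightarrow> complex" where
  "unit_avg K \<theta> = (\<Sum>j<K. \<theta> ^ j) / of_nat K"

lemma norm_unit_avg_le_1:
  assumes "norm \<theta> = 1"
  shows "norm (unit_avg K \<theta>) \<le> 1"
proof -
  have "norm (\<Sum>j<K. \<theta> ^ j) \<le> (\<Sum>j<K. norm (\<theta> ^ j))"
    by (rule norm_sum)
  also have "\<dots> = real K"
    using assms by (simp add: norm_power)
  finally show ?thesis
    by (cases "K = 0") (auto simp: unit_avg_def norm_divide field_simps)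
qed

lemma unit_avg_1: "K > 0 \<Longrightarrow> unit_avg K 1 = 1"
  by (simp add: unit_avg_def)

lemma unit_avg_tendsto_0:
  assumes "norm \<theta> = 1" "\<theta> \<noteq> 1"
  shows "(\<lambda>K. unit_avg K \<theta>) \<longlonglongrightarrow> 0"
proof (rule Lim_null_comparison)
  show "\<forall>\<^sub>F K in sequentially. norm (unit_avg K \<theta>) \<le> (2 / norm (1 - \<theta>)) / real K"
  proof (rule always_eventually, intro allI)
    fix K
    have "(\<Sum>j<K. \<theta> ^ j) = (1 - \<theta> ^ K) / (1 - \<theta>)"
      using assms(2) by (simp add: sum_gp_strict)
    moreover have "norm (1 - \<theta> ^ K) \<le> 2"
      using norm_triangle_ineq4[of 1 "\<theta> ^ K"] assms(1) by (simp add: norm_power)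
    ultimately show "norm (unit_avg K \<theta>) \<le> (2 / norm (1 - \<theta>)) / real K"
      by (simp add: unit_avg_def norm_divide norm_mult divide_right_mono)
  qed
  show "(\<lambda>K. (2 / norm (1 - \<theta>)) / real K) \<longlonglongrightarrow> 0"
    by (rule lim_const_over_n)
qed

text \<open>Dominated convergence for sums: outside a finite set the total mass of \<open>a\<close>
  is small, and on the finite set pointwise convergence suffices.\<close>

lemma infsum_dominated_tendsto_0:
  fixes a :: "'a \<Rightarrow> real" and v :: "nat \<Rightarrow> 'a \<Rightarrow> real"
  assumes a: "a summable_on I" "\<And>i. i \<in> I \<Longrightarrow> a i \<ge> 0"
    and v: "\<And>K i. i \<in> I \<Longrightarrow> 0 \<le> v K i" "\<And>K i. i \<in> I \<Longrightarrow> v K i \<le> C"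
    and lim: "\<And>i. i \<in> I \<Longrightarrow> a i \<noteq> 0 \<Longrightarrow> (\<lambda>K. v K i) \<longlonglongrightarrow> 0"
  shows "(\<lambda>K. infsum (\<lambda>i. a i * v K i) I) \<longlonglongrightarrow> 0"
proof (rule LIMSEQ_I)
  fix \<epsilon> :: real assume "\<epsilon> > 0"
  \<comment> \<open>The tail contributes at most \<delta> (|C| + 1) = \<epsilon> / 2; the summand 1
    avoids a division by zero.\<close>
  define \<delta> where "\<delta> = \<epsilon> / (2 * (\<bar>C\<bar> + 1))"
  have "\<delta> > 0"
    using \<open>\<epsilon> > 0\<close> by (simp add: \<delta>_def)
  obtain F where F: "finite F" "F \<subseteq> I" "dist (sum a F) (infsum a I) \<le> \<delta>"
    using infsum_finite_approximation[OF a(1) \<open>\<delta> > 0\<close>] by blast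
  have summ: "(\<lambda>i. a i * v K i) summable_on I" for K
  proof (rule summable_on_comparison_test)
    show "(\<lambda>i. a i * C) summable_on I"
      using a(1) by (rule summable_on_cmult_left)
  qed (use a v in \<open>auto intro!: mult_left_mono\<close>)
  have tail: "infsum (\<lambda>i. a i * v K i) (I - F) \<le> \<epsilon> / 2" for K
  proof -
    have sF: "a summable_on (I - F)"
      using a(1) by (rule summable_on_subset) auto
    have "infsum (\<lambda>i. a i * v K i) (I - F) \<le> infsum (\<lambda>i. a i * (\<bar>C\<bar> + 1)) (I - F)"
    proof (rule infsum_mono)
      show "(\<lambda>i. a i * v K i) summable_on I - F"
        using summ by (rule summable_on_subset) auto
      show "(\<lambda>i. a i * (\<bar>C\<bar> + 1)) summable_on I - F"
        using sF by (rule summable_on_cmult_left)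
      show "a i * v K i \<le> a i * (\<bar>C\<bar> + 1)" if "i \<in> I - F" for i
        using a(2)[of i] v(2)[of i K] that by (intro mult_left_mono) auto
    qed
    also have "\<dots> = infsum a (I - F) * (\<bar>C\<bar> + 1)"
      using sF by (intro infsum_cmult_left) auto
    also have "infsum a (I - F) = infsum a I - sum a F"
      using F a(1) by (subst infsum_Diff) auto
    also have "\<dots> * (\<bar>C\<bar> + 1) \<le> \<delta> * (\<bar>C\<bar> + 1)"
      using F(3) by (intro mult_right_mono) (auto simp: dist_real_def)
    also have "\<dots> = \<epsilon> / 2"
      by (auto simp: \<delta>_def field_simps)
    finally show ?thesis .
  qed
  have "(\<lambda>K. \<Sum>i\<in>F. a i * v K i) \<longlonglongrightarrow> (\<Sum>i\<in>F. 0)"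
  proof (rule tendsto_sum)
    fix i assume "i \<in> F"
    show "(\<lambda>K. a i * v K i) \<longlonglongrightarrow> 0"
      using lim[of i] F(2) \<open>i \<in> F\<close> by (cases "a i = 0") (auto intro!: tendsto_mult_right_zero)
  qed
  then have "\<forall>\<^sub>F K in sequentially. dist (\<Sum>i\<in>F. a i * v K i) 0 < \<epsilon> / 2"
    using \<open>\<epsilon> > 0\<close> by (intro tendstoD) auto
  then obtain K0 where K0: "\<And>K. K \<ge> K0 \<Longrightarrow> dist (\<Sum>i\<in>F. a i * v K i) 0 < \<epsilon> / 2"
    by (auto simp: eventually_sequentially)
  show "\<exists>no. \<forall>n\<ge>no. norm (infsum (\<lambda>i. a i * v n i) I - 0) < \<epsilon>"
  proof (intro exI allI impI)
    fix K assume "K \<ge> K0"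
    have "infsum (\<lambda>i. a i * v K i) I = infsum (\<lambda>i. a i * v K i) (I - F) + (\<Sum>i\<in>F. a i * v K i)"
      using F summ[of K] by (subst infsum_Diff) auto
    moreover have "infsum (\<lambda>i. a i * v K i) I \<ge> 0"
      using a v by (intro infsum_nonneg) auto
    ultimately show "norm (infsum (\<lambda>i. a i * v K i) I - 0) < \<epsilon>"
      using tail[of K] K0[OF \<open>K \<ge> K0\<close>] by (auto simp: dist_real_def)
  qed
qed

text \<open>Only the moduli of the coefficients enter. When \<open>a\<close> carries the factors e(r
  z), these depend on Im z alone, so one bound serves a whole horizontal line.\<close>

definition avg_error ::
    "('a \<Rightarrow> complex) \<Rightarrow> ('a \<Rightarrow> real) \<Rightarrow> 'a set \<Rightarrow> real \<Rightarrow> real \<Rightarrow> nat \<Rightarrow> real" where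
  "avg_error a lam I \<mu> t K =
     infsum (\<lambda>i. norm (a i) * norm (unit_avg K (ee (of_real ((lam i - \<mu>) * t))) - of_bool (lam i = \<mu>))) I"

lemma avg_error_tendsto_0:
  assumes "(\<lambda>i. norm (a i)) summable_on I"
    and t: "\<And>i. i \<in> I \<Longrightarrow> a i \<noteq> 0 \<Longrightarrow> lam i \<noteq> \<mu> \<Longrightarrow> ee (of_real ((lam i - \<mu>) * t)) \<noteq> 1"
  shows "avg_error a lam I \<mu> t \<longlonglongrightarrow> 0"
  unfolding avg_error_def [abs_def]
proof (rule infsum_dominated_tendsto_0[where C = 2])
  fix K i
  show "norm (unit_avg K (ee (of_real ((lam i - \<mu>) * t))) - of_bool (lam i = \<mu>)) \<le> 2"
    using norm_triangle_ineq4[of "unit_avg K (ee (of_real ((lam i - \<mu>) * t)))" "of_bool (lam i = \<mu>)"]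
      norm_unit_avg_le_1[of "ee (of_real ((lam i - \<mu>) * t))" K]
    by (auto simp del: of_real_mult of_real_diff split: if_splits)
next
  fix i assume "i \<in> I" "norm (a i) \<noteq> 0"
  show "(\<lambda>K. norm (unit_avg K (ee (of_real ((lam i - \<mu>) * t))) - of_bool (lam i = \<mu>))) \<longlonglongrightarrow> 0"
  proof (cases "lam i = \<mu>")
    case True
    have "\<forall>\<^sub>F K in sequentially.
        norm (unit_avg K (ee (of_real ((lam i - \<mu>) * t))) - of_bool (lam i = \<mu>)) = 0"
      using eventually_gt_at_top[of 0] by eventually_elim (use True in \<open>auto simp: unit_avg_1\<close>)
    then show ?thesis
      by (rule tendsto_eventually)
  next
    case False
    have "(\<lambda>K. unit_avg K (ee (of_real ((lam i - \<mu>) * t)))) \<longlonglongrightarrow> 0"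
      using t[of i] \<open>i \<in> I\<close> \<open>norm (a i) \<noteq> 0\<close> False
      by (intro unit_avg_tendsto_0 norm_ee_of_real) auto
    then show ?thesis
      using False by (simp add: tendsto_norm_zero)
  qed
qed (use assms in auto)

text \<open>Sampling at x = t j and twisting by e(- \<mu> t j) turns the i-th term into a geometric
  progression, so the mean is the series with weights \<open>unit_avg\<close>. The series for
  \<open>B\<close> has the indicator of \<open>lam i = \<mu>\<close> as weights; the two are
  compared term by term.\<close>

lemma norm_avg_le_avg_error:
  assumes hs: "\<And>x::real. ((\<lambda>i. a i * ee (of_real (lam i * x))) has_sum f x) I"
    and B: "(a has_sum B) {i \<in> I. lam i = \<mu>}"
  shows "norm ((\<Sum>j<K. ee (- of_real (\<mu> * (t * real j))) * f (t * real j)) / of_nat K - B)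
           \<le> avg_error a lam I \<mu> t K"
proof -
  define \<theta> where "\<theta> i = ee (of_real ((lam i - \<mu>) * t))" for i
  have [simp]: "norm (\<theta> i) = 1" for i
    unfolding \<theta>_def by (rule norm_ee_of_real)
  have "((\<lambda>i. \<Sum>j<K. ee (- of_real (\<mu> * (t * real j))) * (a i * ee (of_real (lam i * (t * real j))))) has_sum
          (\<Sum>j<K. ee (- of_real (\<mu> * (t * real j))) * f (t * real j))) I"
    by (intro has_sum_sum has_sum_cmult_right hs)
  also have "(\<lambda>i. \<Sum>j<K. ee (- of_real (\<mu> * (t * real j))) * (a i * ee (of_real (lam i * (t * real j)))))
           = (\<lambda>i. \<Sum>j<K. a i * \<theta> i ^ j)"
  proof (intro ext sum.cong refl)
    fix i j
    have "\<theta> i ^ j = ee (- of_real (\<mu> * (t * real j))) * ee (of_real (lam i * (t * real j)))"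
      unfolding \<theta>_def ee_of_nat_mult [symmetric] ee_add [symmetric]
      by (rule arg_cong[where f = ee]) (simp add: algebra_simps)
    then show "ee (- of_real (\<mu> * (t * real j))) * (a i * ee (of_real (lam i * (t * real j)))) = a i * \<theta> i ^ j"
      by simp
  qed
  finally have "((\<lambda>i. (\<Sum>j<K. a i * \<theta> i ^ j) * inverse (of_nat K)) has_sum
          (\<Sum>j<K. ee (- of_real (\<mu> * (t * real j))) * f (t * real j)) * inverse (of_nat K)) I"
    by (rule has_sum_cmult_left)
  then have 1: "((\<lambda>i. a i * unit_avg K (\<theta> i)) has_sum
          (\<Sum>j<K. ee (- of_real (\<mu> * (t * real j))) * f (t * real j)) / of_nat K) I"
    by (simp add: unit_avg_def sum_distrib_left [symmetric] divide_inverse mult.assoc)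
  have 2: "((\<lambda>i. a i * of_bool (lam i = \<mu>)) has_sum B) I"
    using B by (subst has_sum_cong_neutral[where g = a and T = "{i \<in> I. lam i = \<mu>}"]) auto
  have summ: "(\<lambda>i. norm (a i)) summable_on I"
    using complex_summable_imp_norm_summable[OF has_sum_imp_summable[OF hs[of 0]]] by simp
  have 3: "((\<lambda>i. norm (a i) * norm (unit_avg K (\<theta> i) - of_bool (lam i = \<mu>))) has_sum
           avg_error a lam I \<mu> t K) I"
    unfolding avg_error_def \<theta>_def[symmetric]
  proof (rule has_sum_infsum, rule summable_on_comparison_test)
    show "(\<lambda>i. norm (a i) * 2) summable_on I"
      using summ by (rule summable_on_cmult_left)
    fix i
    have "norm (unit_avg K (\<theta> i) - of_bool (lam i = \<mu>)) \<le> 2"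
      using norm_triangle_ineq4[of "unit_avg K (\<theta> i)" "of_bool (lam i = \<mu>)"]
        norm_unit_avg_le_1[of "\<theta> i" K] by (auto split: if_splits)
    then show "norm (a i) * norm (unit_avg K (\<theta> i) - of_bool (lam i = \<mu>)) \<le> norm (a i) * 2"
      by (intro mult_left_mono) auto
  qed auto
  show ?thesis
    by (rule norm_infsum_le[OF has_sum_diff[OF 1 2] 3])
       (simp add: norm_mult [symmetric] right_diff_distrib)
qed

text \<open>One step t must separate all frequencies at once. For each \<delta> the bad values of t
  are the multiples of 1/\<delta>, so only countably many are excluded in total.\<close>

lemma ex_nonresonant_step:
  fixes D :: "real set"
  assumes "countable D"
  shows "\<exists>t. \<forall>\<delta>\<in>D. \<delta> \<noteq> 0 \<longrightarrow> ee (of_real (\<delta> * t)) \<noteq> 1"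
proof -
  have "countable (\<Union>\<delta>\<in>D. range (\<lambda>k::int. of_int k / \<delta>))"
    using assms by (intro countable_UN countable_image) auto
  then obtain t :: real where t: "t \<notin> (\<Union>\<delta>\<in>D. range (\<lambda>k::int. of_int k / \<delta>))"
    using uncountable_UNIV_real by (metis UNIV_eq_I)
  have "ee (of_real (\<delta> * t)) \<noteq> 1" if "\<delta> \<in> D" "\<delta> \<noteq> 0" for \<delta>
  proof
    assume "ee (of_real (\<delta> * t)) = 1"
    then obtain k :: int where "\<delta> * t = of_int k"
      unfolding ee_of_real_eq_1_iff by (auto elim: Ints_cases)
    then have "t = of_int k / \<delta>"
      using that by (simp add: field_simps)
    then show False
      using t that by auto
  qed
  then show ?thesis by blast
qed

text \<open>The means of the zero function vanish, yet they converge to the part of frequency \<mu>.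
  As \<open>lam\<close> need not be injective, only the sum of the coefficients sharing a frequency
  can be recovered.\<close>

lemma almost_periodic_unique:
  assumes hs: "\<And>x::real. ((\<lambda>i. a i * ee (of_real (lam i * x))) has_sum 0) I"
  shows "(a has_sum 0) {i \<in> I. lam i = \<mu>}"
proof -
  have "a summable_on I"
    using has_sum_imp_summable[OF hs[of 0]] by simp
  then have summ: "(\<lambda>i. norm (a i)) summable_on I"
    by (rule complex_summable_imp_norm_summable)
  have "a summable_on {i \<in> I. lam i = \<mu>}"
    using \<open>a summable_on I\<close> by (rule summable_on_subset) auto
  then obtain B where B: "(a has_sum B) {i \<in> I. lam i = \<mu>}"
    by (auto simp: summable_on_def)
  have "countable ((\<lambda>i. lam i - \<mu>) ` {i \<in> I. a i \<noteq> 0})"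
    by (intro countable_image abs_summable_countable summ)
  then obtain t where "\<forall>\<delta>\<in>(\<lambda>i. lam i - \<mu>) ` {i \<in> I. a i \<noteq> 0}. \<delta> \<noteq> 0 \<longrightarrow> ee (of_real (\<delta> * t)) \<noteq> 1"
    using ex_nonresonant_step by blast
  then have "avg_error a lam I \<mu> t \<longlonglongrightarrow> 0"
    by (intro avg_error_tendsto_0 summ) auto
  moreover have "norm B \<le> avg_error a lam I \<mu> t K" for K
    using norm_avg_le_avg_error[OF hs B, where K = K and t = t] by simp
  ultimately have "norm B \<le> 0"
    by (intro LIMSEQ_le_const) auto
  then show ?thesis
    using B by simp
qed

subsection \<open>Complex analysis\<close>

lemma continuous_on_contour_integral_param:
  assumes g: "valid_path g" "continuous_on {0..1} (\<lambda>t. vector_derivative g (at t))"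
    and F: "continuous_on (U \<times> path_image g) (\<lambda>(w, z). F w z)"
  shows "continuous_on U (\<lambda>w. contour_integral g (F w))"
proof -
  have cg: "continuous_on {0..1} g"
    using valid_path_imp_path[OF g(1)] by (simp add: path_def)
  have "continuous_on (U \<times> cbox 0 1) (\<lambda>p. (\<lambda>(w, z). F w z) (fst p, g (snd p)))"
    by (rule continuous_on_compose2[OF F])
       (auto simp: path_image_def intro!: continuous_intros continuous_on_compose2[OF cg])
  moreover have "continuous_on (U \<times> cbox 0 1) (\<lambda>p. vector_derivative g (at (snd p)))"
    by (rule continuous_on_compose2[OF g(2)]) (auto intro!: continuous_intros)
  ultimately have "continuous_on (U \<times> cbox 0 1) (\<lambda>p. F (fst p) (g (snd p)) * vector_derivative g (at (snd p)))"
    by (auto intro!: continuous_intros)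
  then have "continuous_on (U \<times> cbox 0 1) (\<lambda>(w, t). F w (g t) * vector_derivative g (at t))"
    by (simp add: case_prod_unfold)
  then have "continuous_on U (\<lambda>w. integral (cbox 0 1) (\<lambda>t. F w (g t) * vector_derivative g (at t)))"
    by (rule integral_continuous_on_param)
  then show ?thesis
    by (simp add: contour_integral_integral)
qed

lemma contour_integrable_continuous:
  assumes g: "valid_path g" "continuous_on {0..1} (\<lambda>t. vector_derivative g (at t))"
    and f: "continuous_on (path_image g) f"
  shows "f contour_integrable_on g"
proof -
  have cg: "continuous_on {0..1} g"
    using valid_path_imp_path[OF g(1)] by (simp add: path_def)
  have "continuous_on {0..1} (\<lambda>t. f (g t) * vector_derivative g (at t))"
    using f g cg by (intro continuous_intros continuous_on_compose2[OF f cg]) (auto simp: path_image_def)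
  then show ?thesis
    by (simp add: contour_integrable_on integrable_continuous_real)
qed

text \<open>Morera on triangles: after exchanging the two integrations, the inner integral along the
  triangle vanishes by Cauchy's theorem.\<close>

lemma holomorphic_on_contour_integral_param:
  assumes U: "open U"
    and g: "valid_path g" "continuous_on {0..1} (\<lambda>t. vector_derivative g (at t))"
    and F: "continuous_on (U \<times> path_image g) (\<lambda>(w, z). F w z)"
    and hol: "\<And>z. z \<in> path_image g \<Longrightarrow> (\<lambda>w. F w z) holomorphic_on U"
  shows "(\<lambda>w. contour_integral g (F w)) holomorphic_on U"
proof -
  have "(\<lambda>w. contour_integral g (F w)) analytic_on U"
  proof (rule Morera_triangle, intro continuous_on_contour_integral_param g F, rule U, rule impI)
    fix a b c assume hull: "convex hull {a, b, c} \<subseteq> U"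
    define h where "h p q z = contour_integral (linepath p q) (\<lambda>w. F w z)" for p q z
    have sub: "closed_segment a b \<subseteq> U" "closed_segment b c \<subseteq> U" "closed_segment c a \<subseteq> U"
      using hull segments_subset_convex_hull(1)[of a b c] segments_subset_convex_hull(1)[of b c a]
        segments_subset_convex_hull(1)[of c a b]
      by (auto simp: insert_commute)
    have swap: "contour_integral (linepath p q) (\<lambda>w. contour_integral g (F w)) = contour_integral g (h p q)"
      and int: "h p q contour_integrable_on g" if pq: "closed_segment p q \<subseteq> U" for p q
    proof -
      have F': "continuous_on (path_image (linepath p q) \<times> path_image g) (\<lambda>(w, z). F w z)"
        using F by (rule continuous_on_subset) (use pq in auto)
      have lin: "continuous_on {0..1} (\<lambda>t. vector_derivative (linepath p q) (at t))"
        by simp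
      show "contour_integral (linepath p q) (\<lambda>w. contour_integral g (F w)) = contour_integral g (h p q)"
        unfolding h_def by (rule contour_integral_swap[OF F' _ g(1) lin g(2)]) auto
      have "continuous_on (path_image g \<times> path_image (linepath p q)) (\<lambda>x. (\<lambda>(w, z). F w z) (snd x, fst x))"
        by (rule continuous_on_compose2[OF F']) (auto intro!: continuous_intros)
      then have "continuous_on (path_image g) (h p q)"
        unfolding h_def using lin
        by (intro continuous_on_contour_integral_param) (auto simp: case_prod_unfold)
      then show "h p q contour_integrable_on g"
        by (intro contour_integrable_continuous g)
    qed
    have "h a b z + h b c z + h c a z = 0" if z: "z \<in> path_image g" for z
    proof -
      have "((\<lambda>w. F w z) has_contour_integral 0) (linepath a b +++ linepath b c +++ linepath c a)"
        using hol[OF z] hull by (intro Cauchy_theorem_triangle) (rule holomorphic_on_subset)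
      then show ?thesis
        unfolding h_def by (rule has_chain_integral_chain_integral3)
    qed
    then have "contour_integral g (\<lambda>z. h a b z + h b c z + h c a z) = contour_integral g (\<lambda>z. 0)"
      by (intro contour_integral_eq) auto
    then show "contour_integral (linepath a b) (\<lambda>w. contour_integral g (F w)) +
               contour_integral (linepath b c) (\<lambda>w. contour_integral g (F w)) +
               contour_integral (linepath c a) (\<lambda>w. contour_integral g (F w)) = 0"
      using sub by (simp add: swap int contour_integral_add contour_integrable_add)
  qed
  then show ?thesis
    by (rule analytic_imp_holomorphic)
qed

lemma periodic_int_mult:
  fixes h :: "complex \<Rightarrow> 'a" and p :: complex
  assumes "\<And>z. P z \<Longrightarrow> h (z + p) = h z" "\<And>z k. P z \<Longrightarrow> P (z + of_int k * p)" "P z"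
  shows "h (z + of_int k * p) = h z"
proof (induction k rule: int_induct[where k = 0])
  case (step1 i)
  then show ?case
    using assms(1)[OF assms(2)[OF assms(3), of i]] by (simp add: algebra_simps)
next
  case (step2 i)
  then show ?case
    using assms(1)[OF assms(2)[OF assms(3), of "i - 1"]] by (simp add: algebra_simps)
qed simp

lemma open_strip: "open {z. \<bar>Im z\<bar> < Y}"
  by (intro open_Collect_less continuous_intros)

lemma convex_strip: "convex {z. \<bar>Im z\<bar> < Y}"
proof -
  have "{z. \<bar>Im z\<bar> < Y} = {z. Im z < Y} \<inter> {z. Im z > - Y}"
    by auto
  then show ?thesis
    by (simp add: convex_Int convex_halfspace_Im_lt convex_halfspace_Im_gt)
qed

text \<open>Modulo the period the closed strip is compact, so |h| attains its maximum there, on a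
  rectangle of width 2. An interior maximum forces h to be constant on the open strip, and the
  boundary bound still applies.\<close>

lemma periodic_strip_maximum_principle:
  assumes hol: "h holomorphic_on {z. \<bar>Im z\<bar> < Y}" and \<epsilon>: "0 < \<epsilon>" "\<epsilon> < Y"
    and per: "\<And>z. \<bar>Im z\<bar> < Y \<Longrightarrow> h (z + 2) = h z"
    and B: "\<And>z. \<bar>Im z\<bar> = \<epsilon> \<Longrightarrow> norm (h z) \<le> B"
    and z: "\<bar>Im z\<bar> \<le> \<epsilon>"
  shows "norm (h z) \<le> B"
proof -
  define R where "R = cbox (Complex 0 (-\<epsilon>)) (Complex 2 \<epsilon>)"
  have "Complex 0 0 \<in> R"
    using \<epsilon> by (auto simp: R_def in_cbox_complex_iff)
  have cont: "continuous_on R (\<lambda>z. norm (h z))"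
    using \<epsilon> by (intro continuous_on_norm holomorphic_on_imp_continuous_on holomorphic_on_subset[OF hol])
               (auto simp: R_def in_cbox_complex_iff)
  obtain w where w: "w \<in> R" "\<And>z. z \<in> R \<Longrightarrow> norm (h z) \<le> norm (h w)"
    using continuous_attains_sup[OF _ _ cont] \<open>Complex 0 0 \<in> R\<close> by (auto simp: R_def)
  have max: "norm (h z) \<le> norm (h w)" if z: "\<bar>Im z\<bar> \<le> \<epsilon>" for z
  proof -
    define k where "k = - \<lfloor>Re z / 2\<rfloor>"
    have "h (z + of_int k * 2) = h z"
      by (rule periodic_int_mult[where P = "\<lambda>z. \<bar>Im z\<bar> < Y"]) (use per \<epsilon> z in auto)
    moreover have "z + of_int k * 2 \<in> R"
      using z floor_divide_lower[of 2 "Re z"] floor_divide_upper[of 2 "Re z"]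
      unfolding R_def in_cbox_complex_iff k_def by (simp add: algebra_simps abs_le_iff)
    ultimately show ?thesis
      using w(2)[of "z + of_int k * 2"] by simp
  qed
  have "norm (h w) \<le> B"
  proof (cases "\<bar>Im w\<bar> = \<epsilon>")
    case False
    have "\<bar>Im w\<bar> < \<epsilon>"
      using w(1) False by (auto simp: R_def in_cbox_complex_iff)
    have "h constant_on {z. \<bar>Im z\<bar> < Y}"
      by (rule maximum_modulus_principle[OF hol open_strip convex_connected[OF convex_strip] open_strip[of \<epsilon>], of w])
         (use max \<open>\<bar>Im w\<bar> < \<epsilon>\<close> \<epsilon> in auto)
    then have "h w = h (Complex 0 \<epsilon>)"
      using \<open>\<bar>Im w\<bar> < \<epsilon>\<close> \<epsilon> by (fastforce simp: constant_on_def)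
    then show ?thesis
      using B[of "Complex 0 \<epsilon>"] \<epsilon> by simp
  qed (use B in auto)
  then show ?thesis
    using max[OF z] by linarith
qed

text \<open>In the variable x = e(z/2) the function x^A E(z) is single-valued, since two logarithms
  of x differ in z by multiples of the period 2. The growth assumption makes it bounded at 0 and of
  degree at most 2 A at infinity, so Liouville's theorem yields a polynomial.\<close>

lemma periodic_entire_exponential_growth:
  assumes hol: "E holomorphic_on UNIV" and per: "\<And>z. E (z + 2) = E z"
    and growth: "\<And>z. norm (E z) \<le> C * exp (pi * real A * \<bar>Im z\<bar>)"
  shows "\<exists>p. \<forall>z. E z = ee (- of_nat A * z / 2) * poly p (ee (z / 2))"
proof -
  define Q where "Q x = E (Ln x / (of_real pi * \<i>)) * x ^ A" for x
  have E_eq: "E (Ln x / (of_real pi * \<i>)) = E (y / (of_real pi * \<i>))" if "exp y = x" for x y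
  proof -
    have "x \<noteq> 0"
      using that by auto
    then have "exp y = exp (Ln x)"
      using that by simp
    then obtain n :: int where n: "y = Ln x + of_int (2 * n) * pi * \<i>"
      unfolding exp_eq by auto
    then have "y / (of_real pi * \<i>) = Ln x / (of_real pi * \<i>) + of_int n * 2"
      by (simp add: field_simps)
    moreover have "E (Ln x / (of_real pi * \<i>) + of_int n * 2) = E (Ln x / (of_real pi * \<i>))"
      by (rule periodic_int_mult[where P = "\<lambda>_. True"]) (use per in auto)
    ultimately show ?thesis
      by simp
  qed
  have Q_ee: "Q (ee (z / 2)) = E z * ee (of_nat A * z / 2)" for z
  proof -
    have "E (Ln (ee (z / 2)) / (of_real pi * \<i>)) = E z"
      by (subst E_eq[where y = "of_real pi * \<i> * z"]) (auto simp: ee_def mult_ac)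
    then show ?thesis
      by (simp add: Q_def ee_of_nat_mult [symmetric])
  qed
  have holE: "(\<lambda>x. E (f x)) holomorphic_on S" if "f holomorphic_on S" for f S
    using holomorphic_on_compose_gen[OF that hol] by (simp add: o_def)
  have hol1: "Q holomorphic_on - \<real>\<^sub>\<le>\<^sub>0"
    unfolding Q_def by (intro holomorphic_intros holE) auto
  \<comment> \<open>\<open>Ln\<close> is discontinuous across the negative axis; Ln(-x) + pi i is a
    logarithm of x that is holomorphic there, and by \<open>E_eq\<close> it gives the same
    function.\<close>
  have "(\<lambda>x. E ((Ln (- x) + of_real pi * \<i>) / (of_real pi * \<i>)) * x ^ A) holomorphic_on - \<real>\<^sub>\<ge>\<^sub>0"
    by (intro holomorphic_intros holE) auto
  then have hol2: "Q holomorphic_on - \<real>\<^sub>\<ge>\<^sub>0"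
  proof (rule holomorphic_transform)
    fix x :: complex assume "x \<in> - \<real>\<^sub>\<ge>\<^sub>0"
    then have "x \<noteq> 0" by auto
    then show "E ((Ln (- x) + of_real pi * \<i>) / (of_real pi * \<i>)) * x ^ A = Q x"
      unfolding Q_def by (subst E_eq[where y = "Ln (- x) + of_real pi * \<i>"]) (auto simp: exp_add)
  qed
  have "Q holomorphic_on (- \<real>\<^sub>\<le>\<^sub>0 \<union> - \<real>\<^sub>\<ge>\<^sub>0)"
    by (intro holomorphic_on_Un hol1 hol2 open_Compl
        closed_nonneg_Reals_complex closed_nonpos_Reals_complex)
  moreover have "(- \<real>\<^sub>\<le>\<^sub>0 \<union> - \<real>\<^sub>\<ge>\<^sub>0) = UNIV - {0 :: complex}"
    by (auto simp: complex_nonpos_Reals_iff complex_nonneg_Reals_iff complex_eq_iff)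
  ultimately have holQ: "Q holomorphic_on UNIV - {0}"
    by simp
  have bound: "norm (Q x) \<le> C * max 1 (norm x ^ (2 * A))" if "x \<noteq> 0" for x
  proof -
    define z where "z = Ln x / (of_real pi * \<i>)"
    have x: "x = ee (z / 2)"
      using that by (simp add: z_def ee_def)
    have "C \<ge> 0"
      using order_trans[OF norm_ge_zero growth[of 0]] by simp
    have "norm x = exp (- pi * Im z)"
      by (simp add: x norm_ee)
    then have nx: "norm x ^ A = exp (- pi * real A * Im z)" "norm x ^ (2 * A) = exp (- 2 * pi * real A * Im z)"
      by (auto simp: exp_of_nat_mult [symmetric] mult_ac)
    have "norm (Q x) = norm (E z) * norm x ^ A"
      by (simp add: Q_def z_def norm_mult norm_power)
    also have "\<dots> \<le> C * exp (pi * real A * \<bar>Im z\<bar>) * norm x ^ A"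
      by (intro mult_right_mono growth) auto
    also have "\<dots> = C * exp (pi * real A * (\<bar>Im z\<bar> - Im z))"
      unfolding nx by (simp add: exp_add [symmetric] algebra_simps)
    \<comment> \<open>|Im z| - Im z is 0 if |x| <= 1 and - 2 Im z otherwise, where the exponential
      is |x|^(2 A).\<close>
    also have "\<dots> \<le> C * max 1 (norm x ^ (2 * A))"
      using \<open>C \<ge> 0\<close> unfolding nx by (intro mult_left_mono) (auto simp: abs_if le_max_iff_disj algebra_simps)
    finally show ?thesis .
  qed
  have "\<forall>\<^sub>F x in at 0. norm (Q x) \<le> C"
  proof -
    have "\<forall>\<^sub>F x in at (0::complex). x \<in> ball 0 1 - {0}"
      by (intro eventually_at_in_open) auto
    then show ?thesis
    proof eventually_elim
      case (elim x)
      then have "norm x ^ (2 * A) \<le> 1"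
        by (intro power_le_one) auto
      then show ?case
        using bound[of x] elim by (auto simp: max_def split: if_splits)
    qed
  qed
  then obtain G where G: "G holomorphic_on UNIV" "\<And>x. x \<noteq> 0 \<Longrightarrow> G x = Q x"
    using holomorphic_on_extend_bounded[OF holQ] by auto
  have "norm (G x) \<le> C * norm x ^ (2 * A)" if "1 \<le> norm x" for x
  proof -
    have "x \<noteq> 0" using that by auto
    then show ?thesis
      using bound[of x] that G(2)[of x] by (auto simp: max_def split: if_splits)
  qed
  then have poly: "G x = (\<Sum>k\<le>2 * A. (deriv ^^ k) G 0 / fact k * x ^ k)" for x
    by (rule Liouville_polynomial[OF G(1)])
  define p where "p = (\<Sum>k\<le>2 * A. monom ((deriv ^^ k) G 0 / fact k) k)"
  have "E z = ee (- of_nat A * z / 2) * poly p (ee (z / 2))" for z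
  proof -
    have "poly p (ee (z / 2)) = E z * ee (of_nat A * z / 2)"
      using Q_ee[of z] G(2)[of "ee (z / 2)"] poly[of "ee (z / 2)"]
      by (simp add: p_def poly_sum poly_monom)
    then show ?thesis
      by (simp add: mult.left_commute ee_add [symmetric])
  qed
  then show ?thesis by blast
qed

subsection \<open>The order along the zero section\<close>

text \<open>A pole of order at most p at 0; a negative p demands a zero of order at least
  -p.\<close>

definition pole_le :: "(complex \<Rightarrow> complex) \<Rightarrow> int \<Rightarrow> bool" where
  "pole_le f p \<longleftrightarrow> (\<exists>L. ((\<lambda>z. z powi p * f z) \<longlongrightarrow> L) (at 0))"

lemma eventually_at_punctured: "eventually (\<lambda>z. z \<noteq> a) (at a)"
  by (simp add: eventually_at_filter)

lemma tendsto_powi_mult_higher: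
  fixes f :: "complex \<Rightarrow> complex"
  assumes "((\<lambda>z. z powi p * f z) \<longlongrightarrow> L) (at 0)" "p < q"
  shows "((\<lambda>z. z powi q * f z) \<longlongrightarrow> 0) (at 0)"
proof -
  have "((\<lambda>z. z ^ nat (q - p) * (z powi p * f z)) \<longlongrightarrow> 0 ^ nat (q - p) * L) (at 0)"
    by (intro tendsto_mult tendsto_power tendsto_ident_at assms)
  moreover have "\<forall>\<^sub>F z in at 0. z ^ nat (q - p) * (z powi p * f z) = z powi q * f z"
    using eventually_at_punctured[of 0]
  proof eventually_elim
    case (elim z)
    have "z powi q = z powi (int (nat (q - p)) + p)"
      using assms(2) by simp
    also have "\<dots> = z ^ nat (q - p) * z powi p"
      using elim by (subst power_int_add) (auto simp flip: power_int_of_nat)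
    finally show ?case
      by (simp add: mult.assoc)
  qed
  ultimately have "((\<lambda>z. z powi q * f z) \<longlongrightarrow> 0 ^ nat (q - p) * L) (at 0)"
    by (rule Lim_transform_eventually)
  then show ?thesis
    using assms(2) by (simp add: zero_power)
qed

lemma pole_le_mono: "pole_le f p \<Longrightarrow> p \<le> q \<Longrightarrow> pole_le f q"
  unfolding pole_le_def using tendsto_powi_mult_higher[of p f _ q] by (cases "p = q") auto

lemma pole_le_extend:
  assumes "f holomorphic_on ball 0 r - {0}" "((\<lambda>z. z powi p * f z) \<longlongrightarrow> L) (at 0)" "r > 0"
  obtains h where "h holomorphic_on ball 0 r" "h 0 = L" "\<And>z. z \<noteq> 0 \<Longrightarrow> h z = z powi p * f z"
proof
  define h where "h z = (if z = 0 then L else z powi p * f z)" for z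
  show "h 0 = L" "\<And>z. z \<noteq> 0 \<Longrightarrow> h z = z powi p * f z"
    by (auto simp: h_def)
  show "h holomorphic_on ball 0 r"
  proof (rule no_isolated_singularity'[where K = "{0}"])
    have "(\<lambda>z. z powi p * f z) holomorphic_on ball 0 r - {0}"
      by (intro holomorphic_intros assms) auto
    then show "h holomorphic_on ball 0 r - {0}"
      by (rule holomorphic_transform) (auto simp: h_def)
    show "(h \<longlongrightarrow> h z) (at z within ball 0 r)" if "z \<in> {0}" for z
    proof -
      have "(h \<longlongrightarrow> L) (at 0)"
        by (rule Lim_transform_eventually[OF assms(2)])
           (use eventually_at_punctured[of 0] in \<open>eventually_elim, auto simp: h_def\<close>)
      then show ?thesis
        using that by (auto simp: h_def intro: Lim_at_imp_Lim_at_within)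
    qed
  qed auto
qed

lemma pole_le_lower:
  assumes "f holomorphic_on ball 0 r - {0}" "((\<lambda>z. z powi p * f z) \<longlongrightarrow> 0) (at 0)" "r > 0"
  shows "pole_le f (p - 1)"
proof -
  obtain h where h: "h holomorphic_on ball 0 r" "h 0 = 0" "\<And>z. z \<noteq> 0 \<Longrightarrow> h z = z powi p * f z"
    using pole_le_extend[OF assms] by blast
  obtain k where k: "k holomorphic_on ball 0 r" "\<And>z. norm z < r \<Longrightarrow> h z = z * k z"
    using Schwarz3[OF h(1,2)] by blast
  have "isCont k 0"
    using k(1) assms(3) by (intro holomorphic_on_imp_continuous_on[THEN continuous_on_interior]) auto
  then have "(k \<longlongrightarrow> k 0) (at 0)"
    by (simp add: isCont_def)
  moreover have "\<forall>\<^sub>F z in at 0. k z = z powi (p - 1) * f z"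
  proof -
    have "\<forall>\<^sub>F z in at (0::complex). z \<in> ball 0 r - {0}"
      using assms(3) by (intro eventually_at_in_open) auto
    then show ?thesis
    proof eventually_elim
      case (elim z)
      then have "z * k z = z powi p * f z"
        using k(2)[of z] h(3)[of z] by simp
      moreover have "z powi p = z * z powi (p - 1)"
        using elim by (simp add: power_int_diff)
      ultimately show ?case
        using elim by (simp add: mult.assoc)
    qed
  qed
  ultimately show ?thesis
    unfolding pole_le_def by (blast intro: Lim_transform_eventually)
qed

text \<open>The integral of f(z) z^k is 2 pi i times the Laurent coefficient of z^(-k-1). The bound
  q descends to N one order at a time, each leading coefficient being one of the vanishing
  integrals.\<close>

lemma pole_le_if_contour_integrals_vanish:
  assumes f: "f holomorphic_on ball 0 R - {0}" and r: "0 < r" "r < R" and q: "pole_le f q"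
    and int: "\<And>k. k \<ge> N \<Longrightarrow> contour_integral (circlepath 0 r) (\<lambda>z. f z * z powi k) = 0"
  shows "pole_le f N"
proof -
  have "pole_le f N" if "pole_le f (N + int n)" for n
    using that
  proof (induction n)
    case (Suc n)
    obtain L where L: "((\<lambda>z. z powi (N + int (Suc n)) * f z) \<longlongrightarrow> L) (at 0)"
      using Suc.prems by (auto simp: pole_le_def)
    obtain h where h: "h holomorphic_on ball 0 R" "h 0 = L"
        "\<And>z. z \<noteq> 0 \<Longrightarrow> h z = z powi (N + int (Suc n)) * f z"
      using r by - (rule pole_le_extend[OF f L], auto)
    have "((\<lambda>u. h u / (u - 0)) has_contour_integral (2 * of_real pi * \<i> * h 0)) (circlepath 0 r)"
      using r by (intro Cauchy_integral_circlepath_simple holomorphic_on_subset[OF h(1)]) auto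
    then have "contour_integral (circlepath 0 r) (\<lambda>u. h u / (u - 0)) = 2 * of_real pi * \<i> * L"
      using h(2) contour_integral_unique by blast
    moreover have "contour_integral (circlepath 0 r) (\<lambda>u. h u / (u - 0))
                 = contour_integral (circlepath 0 r) (\<lambda>z. f z * z powi (N + int n))"
    proof (rule contour_integral_eq)
      fix z assume "z \<in> path_image (circlepath 0 r)"
      then have "z \<noteq> 0"
        using r by auto
      then have "z powi (N + int (Suc n)) = z * z powi (N + int n)"
        using power_int_add_1'[of z "N + int n"] by (simp add: algebra_simps)
      then show "h z / (z - 0) = f z * z powi (N + int n)"
        using h(3)[OF \<open>z \<noteq> 0\<close>] \<open>z \<noteq> 0\<close> by simp
    qed
    ultimately have "L = 0"
      using int[of "N + int n"] by simp
    then have "pole_le f (N + int (Suc n) - 1)"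
      using L r by (intro pole_le_lower[OF f]) auto
    then show ?case
      using Suc.IH by simp
  qed auto
  moreover have "pole_le f (N + int (nat (q - N)))"
    using q by (rule pole_le_mono) auto
  ultimately show ?thesis by blast
qed

text \<open>A zero of infinite order: a nonconstant f would factor as z^n g(z) with g(0) nonzero,
  although z^(-n) f(z) tends to 0.\<close>

lemma pole_le_all_imp_zero:
  assumes f: "f holomorphic_on ball 0 r - {0}" "r > 0" and p: "\<And>p. pole_le f p"
    and z: "z \<in> ball 0 r - {0}"
  shows "f z = 0"
proof -
  have lim0: "((\<lambda>z. z powi p * f z) \<longlongrightarrow> 0) (at 0)" for p
    using p[of "p - 1"] tendsto_powi_mult_higher[of "p - 1" f _ p] by (auto simp: pole_le_def)
  obtain h where h: "h holomorphic_on ball 0 r" "h 0 = 0" "\<And>z. z \<noteq> 0 \<Longrightarrow> h z = f z"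
    by (rule pole_le_extend[OF f(1) lim0[of 0] f(2)]) simp
  show ?thesis
  proof (cases "h constant_on ball 0 r")
    case True
    then have "h z = h 0"
      using z f(2) by (auto simp: constant_on_def)
    then show ?thesis
      using h z by auto
  next
    case False
    obtain g \<rho> n where g: "0 < n" "0 < \<rho>" "g holomorphic_on ball 0 \<rho>"
        "\<And>w. w \<in> ball 0 \<rho> \<Longrightarrow> h w = (w - 0) ^ n * g w" "\<And>w. w \<in> ball 0 \<rho> \<Longrightarrow> g w \<noteq> 0"
      using f(2) by - (rule holomorphic_factor_zero_nonconstant[OF h(1) open_ball connected_ball _ h(2) False], auto)
    have "isCont g 0"
      using g by (intro holomorphic_on_imp_continuous_on[THEN continuous_on_interior]) auto
    then have "(g \<longlongrightarrow> g 0) (at 0)"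
      by (simp add: isCont_def)
    moreover have "\<forall>\<^sub>F z in at 0. g z = z powi (- int n) * f z"
    proof -
      have "\<forall>\<^sub>F z in at (0::complex). z \<in> ball 0 \<rho> - {0}"
        using g by (intro eventually_at_in_open) auto
      then show ?thesis
      proof eventually_elim
        case (elim z)
        then have "f z = z ^ n * g z"
          using g(4)[of z] h(3)[of z] by simp
        then show ?case
          using elim by (simp add: power_int_minus field_simps)
      qed
    qed
    ultimately have "((\<lambda>z. z powi (- int n) * f z) \<longlongrightarrow> g 0) (at 0)"
      by (rule Lim_transform_eventually)
    then have "g 0 = 0"
      using lim0[of "- int n"] LIM_unique by blast
    then show ?thesis
      using g(5)[of 0] g(2) by simp
  qed
qed

section \<open>Functions of two variables and their slices\<close>

lemma holomorphic2_on_isCont: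
  assumes "holomorphic2_on f S" "p \<in> S"
  shows "isCont (\<lambda>(\<tau>, z). f \<tau> z) p"
  using assms unfolding holomorphic2_on_def by (blast intro: has_derivative_continuous)

lemma holomorphic2_on_imp_differentiable:
  assumes "holomorphic2_on f S" "(\<tau>, z) \<in> S"
  shows "(\<lambda>z. f \<tau> z) field_differentiable at z" "(\<lambda>\<tau>. f \<tau> z) field_differentiable at \<tau>"
proof -
  obtain A B where D: "((\<lambda>(\<tau>, z). f \<tau> z) has_derivative (\<lambda>(s, t). A * s + B * t)) (at (\<tau>, z))"
    using assms unfolding holomorphic2_on_def by blast
  have "((\<lambda>(\<tau>, z). f \<tau> z) \<circ> Pair \<tau> has_derivative (\<lambda>(s, t). A * s + B * t) \<circ> Pair 0) (at z)"
    by (rule diff_chain_at) (use D in \<open>auto intro!: derivative_eq_intros\<close>)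
  then have "((\<lambda>z. f \<tau> z) has_field_derivative B) (at z)"
    by (simp add: has_field_derivative_def o_def)
  then show "(\<lambda>z. f \<tau> z) field_differentiable at z"
    by (auto simp: field_differentiable_def)
  have "((\<lambda>(\<tau>, z). f \<tau> z) \<circ> (\<lambda>\<tau>. (\<tau>, z)) has_derivative (\<lambda>(s, t). A * s + B * t) \<circ> (\<lambda>s. (s, 0))) (at \<tau>)"
    by (rule diff_chain_at) (use D in \<open>auto intro!: derivative_eq_intros\<close>)
  then have "((\<lambda>\<tau>. f \<tau> z) has_field_derivative A) (at \<tau>)"
    by (simp add: has_field_derivative_def o_def)
  then show "(\<lambda>\<tau>. f \<tau> z) field_differentiable at \<tau>"
    by (auto simp: field_differentiable_def)
qed

text \<open>A lattice point u \<tau> + v has imaginary part u Im \<tau>, so those in this strip have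
  u = 0 and are integers.\<close>

lemma jacobi_domI:
  assumes "\<bar>Im z\<bar> < Im \<tau>" "z \<notin> \<int>"
  shows "(\<tau>, z) \<in> jacobi_dom"
proof -
  have "z \<noteq> of_int u * \<tau> + of_int v" for u v
  proof
    assume z: "z = of_int u * \<tau> + of_int v"
    have [simp]: "\<bar>Im \<tau>\<bar> = Im \<tau>"
      using assms(1) by simp
    from z have "\<bar>of_int u\<bar> * Im \<tau> < 1 * Im \<tau>"
      using assms(1) by (simp add: abs_mult)
    then have "\<bar>of_int u :: real\<bar> < 1"
      using assms(1) by (subst (asm) mult_less_cancel_right) auto
    then have "u = 0"
      by linarith
    then show False
      using z assms(2) by simp
  qed
  then show ?thesis
    using assms by (auto simp: jacobi_dom_def upper_half_def period_lattice_def)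
qed

lemma small_not_Ints: "z \<noteq> 0 \<Longrightarrow> norm z < 1 \<Longrightarrow> (z :: complex) \<notin> \<int>"
  by (auto simp: Ints_def norm_of_int)

lemma small_in_jacobi_dom: "z \<noteq> 0 \<Longrightarrow> norm z < 1 \<Longrightarrow> norm z < Im \<tau> \<Longrightarrow> (\<tau>, z) \<in> jacobi_dom"
  using abs_Im_le_cmod[of z] by (intro jacobi_domI small_not_Ints) auto

lemma holomorphic_slice:
  assumes "lattice_meromorphic \<phi>" "\<And>z. z \<in> S \<Longrightarrow> (\<tau>, z) \<in> jacobi_dom"
  shows "\<phi> \<tau> holomorphic_on S"
  unfolding holomorphic_on_def
  using holomorphic2_on_imp_differentiable(1)[of \<phi> jacobi_dom \<tau>] assms
  by (auto simp: lattice_meromorphic_def intro: field_differentiable_at_within)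

lemma holomorphic_slice_ball:
  assumes "lattice_meromorphic \<phi>" "r \<le> 1" "r \<le> Im \<tau>"
  shows "\<phi> \<tau> holomorphic_on ball 0 r - {0}"
  using assms by (intro holomorphic_slice small_in_jacobi_dom) auto

lemma closed_period_lattice:
  assumes "Im \<tau> > 0"
  shows "closed (period_lattice \<tau>)"
proof (rule discrete_imp_closed[where \<epsilon> = "min 1 (Im \<tau>)"])
  show "\<forall>x\<in>period_lattice \<tau>. \<forall>y\<in>period_lattice \<tau>. dist y x < min 1 (Im \<tau>) \<longrightarrow> y = x"
  proof (intro ballI impI)
    fix x y assume xy: "x \<in> period_lattice \<tau>" "y \<in> period_lattice \<tau>" and d: "dist y x < min 1 (Im \<tau>)"
    obtain u v u' v' where "x = of_int u * \<tau> + of_int v" "y = of_int u' * \<tau> + of_int v'"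
      using xy by (auto simp: period_lattice_def)
    then have "y - x = of_int (u' - u) * \<tau> + of_int (v' - v)"
      by (simp add: algebra_simps)
    then have "y - x \<in> period_lattice \<tau>"
      unfolding period_lattice_def by blast
    then have "(\<tau>, y - x) \<notin> jacobi_dom"
      by (auto simp: jacobi_dom_def)
    then show "y = x"
      using small_in_jacobi_dom[of "y - x" \<tau>] d by (auto simp: dist_norm)
  qed
qed (use assms in auto)

lemma countable_period_lattice: "countable (period_lattice \<tau>)"
proof -
  have "period_lattice \<tau> = (\<lambda>(u, v). of_int u * \<tau> + of_int v) ` (UNIV :: (int \<times> int) set)"
    by (auto simp: period_lattice_def)
  then show ?thesis by simp
qed

text \<open>The definition bounds the pole order only locally in \<tau>. The Laurent coefficients at
  z = 0 are contour integrals and hence holomorphic in \<tau>; those beyond the bound at one base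
  point vanish near it, and so everywhere by analytic continuation.\<close>

lemma ex_pole_le_uniform:
  assumes \<phi>: "lattice_meromorphic \<phi>"
  shows "\<exists>N. \<forall>\<tau>\<in>upper_half. pole_le (\<phi> \<tau>) N"
proof -
  have local: "\<exists>N V. open V \<and> \<tau>0 \<in> V \<and> (\<forall>\<tau>\<in>V \<inter> upper_half. pole_le (\<phi> \<tau>) (int N))" if \<tau>0: "\<tau>0 \<in> upper_half" for \<tau>0
  proof -
    obtain N U g where U: "open U" "(\<tau>0, of_int 0 * \<tau>0 + of_int 0) \<in> U" "holomorphic2_on g U"
        "\<forall>(\<tau>, z) \<in> U \<inter> jacobi_dom. (z - of_int 0 * \<tau> - of_int 0) ^ N * \<phi> \<tau> z = g \<tau> z"
      using \<phi>[unfolded lattice_meromorphic_def, THEN conjunct2, THEN bspec, OF \<tau>0, THEN spec[of _ 0], THEN spec[of _ 0]]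
      by (elim exE conjE)
    define V where "V = (\<lambda>\<tau>. (\<tau>, 0)) -` U"
    have "open V"
      unfolding V_def using U(1) by (intro open_vimage continuous_intros)
    moreover have "\<tau>0 \<in> V"
      using U by (simp add: V_def)
    moreover have "pole_le (\<phi> \<tau>) (int N)" if \<tau>: "\<tau> \<in> V" "\<tau> \<in> upper_half" for \<tau>
    proof -
      have "(\<lambda>z. g \<tau> z) field_differentiable at 0"
        using U \<tau> by (intro holomorphic2_on_imp_differentiable(1)[OF U(3)]) (auto simp: V_def)
      then have "(g \<tau> \<longlongrightarrow> g \<tau> 0) (at 0)"
        using field_differentiable_imp_continuous_at isCont_def by blast
      moreover have "\<forall>\<^sub>F z in at 0. g \<tau> z = z powi int N * \<phi> \<tau> z"
      proof -
        have "open ((\<lambda>z. (\<tau>, z)) -` U)"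
          using U(1) by (intro open_vimage continuous_intros)
        then have "\<forall>\<^sub>F z in at 0. z \<in> ((\<lambda>z. (\<tau>, z)) -` U \<inter> ball 0 (min 1 (Im \<tau>))) - {0}"
          using \<tau> by (intro eventually_at_in_open open_Int) (auto simp: V_def upper_half_def)
        then show ?thesis
        proof eventually_elim
          case (elim z)
          then have "(\<tau>, z) \<in> U \<inter> jacobi_dom"
            by (auto intro!: small_in_jacobi_dom)
          then show ?case
            using bspec[OF U(4), of "(\<tau>, z)"] by simp
        qed
      qed
      ultimately show ?thesis
        unfolding pole_le_def by (blast intro: Lim_transform_eventually)
    qed
    ultimately show ?thesis by blast
  qed
  have hol2: "holomorphic2_on \<phi> jacobi_dom"
    using \<phi> by (simp add: lattice_meromorphic_def)
  define \<tau>0 where "\<tau>0 = Complex 0 2"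
  obtain N V where V: "open V" "\<tau>0 \<in> V" "\<And>\<tau>. \<tau> \<in> V \<Longrightarrow> \<tau> \<in> upper_half \<Longrightarrow> pole_le (\<phi> \<tau>) (int N)"
    using local[of \<tau>0] by (auto simp: \<tau>0_def upper_half_def)
  have "pole_le (\<phi> \<tau>) (int N)" if \<tau>: "\<tau> \<in> upper_half" for \<tau>
  proof -
    \<comment> \<open>The half plane \<open>H\<close> of points above height r contains both \<tau>
      and the base point 2 i, and for all its points the circle of radius r meets no lattice
      point.\<close>
    define r where "r = min 1 (Im \<tau>) / 2"
    have r: "0 < r" "r < 1" "r < Im \<tau>"
      using \<tau> by (auto simp: r_def upper_half_def)
    define H where "H = {\<tau>. Im \<tau> > r}"
    have H: "open H" "convex H" "\<tau> \<in> H"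
      unfolding H_def using r by (auto simp: convex_halfspace_Im_gt intro!: open_Collect_less continuous_intros)
    have dom: "(\<tau>, z) \<in> jacobi_dom" if "\<tau> \<in> H" "z \<in> path_image (circlepath 0 r)" for \<tau> z
      using that r by (intro small_in_jacobi_dom) (auto simp: H_def)
    have int: "contour_integral (circlepath 0 r) (\<lambda>z. \<phi> \<tau> z * z powi k) = 0" if k: "k \<ge> int N" for k
    proof -
      define A where "A \<tau> = contour_integral (circlepath 0 r) (\<lambda>z. \<phi> \<tau> z * z powi k)" for \<tau>
      have vd: "continuous_on {0..1} (\<lambda>t. vector_derivative (circlepath 0 r) (at t))"
        unfolding vector_derivative_circlepath by (intro continuous_intros)
      have holA: "A holomorphic_on H"
        unfolding A_def
      proof (rule holomorphic_on_contour_integral_param[OF H(1) _ vd])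
        have "continuous_on (H \<times> path_image (circlepath 0 r)) (\<lambda>(\<tau>, z). \<phi> \<tau> z)"
          using dom by (intro continuous_at_imp_continuous_on ballI holomorphic2_on_isCont[OF hol2]) auto
        then show "continuous_on (H \<times> path_image (circlepath 0 r)) (\<lambda>(\<tau>, z). \<phi> \<tau> z * z powi k)"
          using r by (auto simp: case_prod_unfold intro!: continuous_intros)
        show "(\<lambda>\<tau>. \<phi> \<tau> z * z powi k) holomorphic_on H" if "z \<in> path_image (circlepath 0 r)" for z
        proof (intro holomorphic_intros)
          show "(\<lambda>\<tau>. \<phi> \<tau> z) holomorphic_on H"
            unfolding holomorphic_on_def
            using field_differentiable_at_within[OF holomorphic2_on_imp_differentiable(2)[OF hol2]] dom that by blast
        qed
      qed auto
      have "A \<tau> = 0" if "\<tau> \<in> V \<inter> {\<tau>. Im \<tau> > 1}" for \<tau>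
      proof -
        have "pole_le (\<phi> \<tau>) k"
          using that by (intro pole_le_mono[OF V(3) k]) (auto simp: upper_half_def)
        then obtain L where L: "((\<lambda>z. z powi k * \<phi> \<tau> z) \<longlongrightarrow> L) (at 0)"
          by (auto simp: pole_le_def)
        have "\<phi> \<tau> holomorphic_on ball 0 1 - {0}"
          using that by (intro holomorphic_slice_ball \<phi>) auto
        then obtain h where h: "h holomorphic_on ball 0 1" "\<And>z. z \<noteq> 0 \<Longrightarrow> h z = z powi k * \<phi> \<tau> z"
          using pole_le_extend[OF _ L zero_less_one] by blast
        have "(h has_contour_integral 0) (circlepath 0 r)"
          using r by (intro Cauchy_theorem_disc_simple[OF h(1)]) auto
        moreover have "contour_integral (circlepath 0 r) h = A \<tau>"
          unfolding A_def by (intro contour_integral_eq) (use r in \<open>auto simp: h(2)\<close>)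
        ultimately show ?thesis
          using contour_integral_unique by metis
      qed
      moreover have "\<tau>0 \<in> V \<inter> {\<tau>. Im \<tau> > 1}"
        using V(2) by (simp add: \<tau>0_def)
      moreover have "V \<inter> {\<tau>. Im \<tau> > 1} \<subseteq> H"
        using r by (auto simp: H_def)
      moreover have "open (V \<inter> {\<tau>. Im \<tau> > 1})"
        using V(1) by (intro open_Int open_halfspace_Im_gt)
      ultimately have "A \<tau> = 0"
        using analytic_continuation_open[of "V \<inter> {\<tau>. Im \<tau> > 1}" H A "\<lambda>_. 0" \<tau>]
          H convex_connected[OF H(2)] holA holomorphic_on_const by blast
      then show ?thesis
        by (simp add: A_def)
    qed
    \<comment> \<open>The local bound at \<tau> itself only excludes an essential singularity; the
      vanishing integrals improve it to N.\<close>
    obtain q where q: "pole_le (\<phi> \<tau>) q"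
      using local[OF \<tau>] \<tau> by blast
    have hol: "\<phi> \<tau> holomorphic_on ball 0 (min 1 (Im \<tau>)) - {0}"
      by (intro holomorphic_slice_ball \<phi>) auto
    show ?thesis
      by (rule pole_le_if_contour_integrals_vanish[OF hol r(1) _ q int]) (use r in simp)
  qed
  then show ?thesis by blast
qed

text \<open>The bounds valid for all \<tau> form an upward closed set \<open>S\<close>. It is not
  all of the integers, since otherwise the slice at \<open>\<tau>0\<close> would vanish; so some
  \<nu> in \<open>S\<close> has its predecessor outside, and this makes the leading coefficient
  nonzero at some \<tau>.\<close>

lemma ex_leading_laurent_coeff:
  assumes \<phi>: "lattice_meromorphic \<phi>" and nz: "(\<tau>0, z0) \<in> jacobi_dom" "\<phi> \<tau>0 z0 \<noteq> 0"
  shows "\<exists>\<nu> f. leading_laurent_coeff \<phi> \<nu> f"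
proof -
  define S where "S = {p. \<forall>\<tau>\<in>upper_half. pole_le (\<phi> \<tau>) p}"
  obtain N where N: "N \<in> S"
    using ex_pole_le_uniform[OF \<phi>] by (auto simp: S_def)
  have \<tau>0: "\<tau>0 \<in> upper_half" "Im \<tau>0 > 0" "z0 \<in> - period_lattice \<tau>0"
    using nz by (auto simp: jacobi_dom_def upper_half_def)
  have "\<exists>p. p \<notin> S"
  proof (rule ccontr)
    assume "\<nexists>p. p \<notin> S"
    then have p: "pole_le (\<phi> \<tau>0) p" for p
      using \<tau>0 by (auto simp: S_def)
    define r where "r = min 1 (Im \<tau>0)"
    have r: "0 < r" "r \<le> 1" "r \<le> Im \<tau>0"
      using \<tau>0 by (auto simp: r_def)
    have zero: "\<phi> \<tau>0 z = 0" if "z \<in> ball 0 r - {0}" for z :: complex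
      by (rule pole_le_all_imp_zero[OF holomorphic_slice_ball[OF \<phi> r(2,3)] r(1) p that])
    \<comment> \<open>The complement of a countable set in the plane is connected, so vanishing near
      0 spreads to \<open>z0\<close>.\<close>
    have "\<phi> \<tau>0 z0 = 0"
    proof (rule analytic_continuation_open[of "ball 0 r - {0}" "- period_lattice \<tau>0" "\<phi> \<tau>0" "\<lambda>_. 0"])
      show "open (- period_lattice \<tau>0)"
        using closed_period_lattice[OF \<tau>0(2)] by (rule open_Compl)
      show "connected (- period_lattice \<tau>0)"
        unfolding Compl_eq_Diff_UNIV
        by (rule connected_open_diff_countable) (auto simp: countable_period_lattice)
      show "\<phi> \<tau>0 holomorphic_on - period_lattice \<tau>0"
        using \<tau>0 by (intro holomorphic_slice \<phi>) (auto simp: jacobi_dom_def)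
      show "ball 0 r - {0 :: complex} \<subseteq> - period_lattice \<tau>0"
      proof
        fix z :: complex assume "z \<in> ball 0 r - {0}"
        then have "(\<tau>0, z) \<in> jacobi_dom"
          using r by (intro small_in_jacobi_dom) auto
        then show "z \<in> - period_lattice \<tau>0"
          by (auto simp: jacobi_dom_def)
      qed
      have "of_real (r / 2) \<in> ball 0 r - {0 :: complex}"
        using r by simp
      then show "ball 0 r - {0 :: complex} \<noteq> {}" by blast
    qed (use zero \<tau>0 in auto)
    then show False
      using nz by simp
  qed
  then obtain p where p: "p \<notin> S" by blast
  have mono: "q' \<in> S" if "q \<in> S" "q \<le> q'" for q q'
    using that unfolding S_def by (blast intro: pole_le_mono)
  have "p < N"
    using mono[OF N, of p] p by force
  have "\<exists>\<nu>. \<nu> \<in> S \<and> \<nu> - 1 \<notin> S"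
  proof (rule ccontr)
    assume "\<nexists>\<nu>. \<nu> \<in> S \<and> \<nu> - 1 \<notin> S"
    then have step: "\<nu> - 1 \<in> S" if "\<nu> \<in> S" for \<nu>
      using that by blast
    have "N - int n \<in> S" for n
    proof (induction n)
      case (Suc n)
      then show ?case
        using step[of "N - int n"] by (simp add: algebra_simps)
    qed (use N in simp)
    from this[of "nat (N - p)"] show False
      using p \<open>p < N\<close> by simp
  qed
  then obtain \<nu> where \<nu>: "\<nu> \<in> S" "\<nu> - 1 \<notin> S" by blast
  have "\<forall>\<tau>\<in>upper_half. \<exists>L. ((\<lambda>z. z powi \<nu> * \<phi> \<tau> z) \<longlongrightarrow> L) (at 0)"
    using \<nu>(1) by (auto simp: S_def pole_le_def)
  from bchoice[OF this] obtain f
    where f: "\<And>\<tau>. \<tau> \<in> upper_half \<Longrightarrow> ((\<lambda>z. z powi \<nu> * \<phi> \<tau> z) \<longlongrightarrow> f \<tau>) (at 0)"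
    by blast
  obtain \<tau> where \<tau>: "\<tau> \<in> upper_half" "\<not> pole_le (\<phi> \<tau>) (\<nu> - 1)"
    using \<nu>(2) by (auto simp: S_def)
  have "f \<tau> \<noteq> 0"
  proof
    assume "f \<tau> = 0"
    then have "pole_le (\<phi> \<tau>) (\<nu> - 1)"
      using f[OF \<tau>(1)] \<tau>(1)
      by (intro pole_le_lower[OF holomorphic_slice_ball[OF \<phi>, of "min 1 (Im \<tau>)"]]) (auto simp: upper_half_def)
    then show False
      using \<tau> by simp
  qed
  then have "leading_laurent_coeff \<phi> \<nu> f"
    using f \<tau> by (auto simp: leading_laurent_coeff_def)
  then show ?thesis by blast
qed

lemma leading_laurent_coeff_unique:
  assumes "leading_laurent_coeff \<phi> \<nu> f" "leading_laurent_coeff \<phi> \<nu>' f'"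
  shows "\<nu> = \<nu>'"
proof -
  have "\<not> \<nu> < \<nu>'" if lead: "leading_laurent_coeff \<phi> \<nu> f" "leading_laurent_coeff \<phi> \<nu>' f'" for \<nu> \<nu>' f f'
  proof
    assume less: "\<nu> < \<nu>'"
    have "f' \<tau> = 0" if \<tau>: "\<tau> \<in> upper_half" for \<tau>
    proof -
      have "((\<lambda>z. z powi \<nu>' * \<phi> \<tau> z) \<longlongrightarrow> 0) (at 0)"
        using lead(1) \<tau> less by (intro tendsto_powi_mult_higher[where p = \<nu>]) (auto simp: leading_laurent_coeff_def)
      then show ?thesis
        using lead(2) \<tau> LIM_unique unfolding leading_laurent_coeff_def by blast
    qed
    then show False
      using lead(2) by (auto simp: leading_laurent_coeff_def)
  qed
  from this[OF assms] this[OF assms(2,1)] show ?thesis by simp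
qed

lemma ex_leading_laurent_coeff_pole_order:
  assumes "lattice_meromorphic \<phi>" "(\<tau>0, z0) \<in> jacobi_dom" "\<phi> \<tau>0 z0 \<noteq> 0"
  shows "\<exists>f. leading_laurent_coeff \<phi> (pole_order \<phi>) f"
proof -
  obtain \<nu> f where \<nu>: "leading_laurent_coeff \<phi> \<nu> f"
    using ex_leading_laurent_coeff[OF assms] by blast
  show ?thesis
    unfolding pole_order_def
  proof (rule theI)
    show "\<exists>f. leading_laurent_coeff \<phi> \<nu> f"
      using \<nu> by blast
  qed (use leading_laurent_coeff_unique[OF _ \<nu>] in auto)
qed

subsection \<open>The metaplectic group\<close>

lemma mat2_nth [simp]:
  "mat2 a b c d $ 1 $ 1 = a" "mat2 a b c d $ 1 $ 2 = b"
  "mat2 a b c d $ 2 $ 1 = c" "mat2 a b c d $ 2 $ 2 = d"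
  by (simp_all add: mat2_def vector_2)

lemma mat2_eqI:
  fixes A B :: "real ^ 2 ^ 2"
  assumes "A $ 1 $ 1 = B $ 1 $ 1" "A $ 1 $ 2 = B $ 1 $ 2" "A $ 2 $ 1 = B $ 2 $ 1" "A $ 2 $ 2 = B $ 2 $ 2"
  shows "A = B"
  using assms by (simp add: vec_eq_iff forall_2)

lemma mat2_mult_nth:
  fixes A B :: "real ^ 2 ^ 2"
  shows "(A ** B) $ i $ j = A $ i $ 1 * B $ 1 $ j + A $ i $ 2 * B $ 2 $ j"
  by (simp add: matrix_matrix_mult_def sum_2)

lemma Im_mob:
  "Im (mob A \<tau>) = det A * Im \<tau> / (norm (autfac A \<tau>))\<^sup>2"
  unfolding cmod_power2 by (simp add: mob_def Im_divide autfac_def det_2 algebra_simps power2_eq_square)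

lemma autfac_nonzero:
  assumes "det A > 0" "\<tau> \<in> upper_half"
  shows "autfac A \<tau> \<noteq> 0"
proof
  assume "autfac A \<tau> = 0"
  then have "A $ 2 $ 1 = 0" "A $ 2 $ 2 = 0"
    using assms(2) by (auto simp: autfac_def complex_eq_iff upper_half_def)
  then show False
    using assms(1) by (simp add: det_2)
qed

lemma mob_in_upper_half:
  assumes "det A > 0" "\<tau> \<in> upper_half"
  shows "mob A \<tau> \<in> upper_half"
  using assms autfac_nonzero[OF assms] by (auto simp: upper_half_def Im_mob intro!: divide_pos_pos)

lemma autfac_mult:
  assumes "autfac B \<tau> \<noteq> 0"
  shows "autfac (A ** B) \<tau> = autfac A (mob B \<tau>) * autfac B \<tau>"
proof -
  have "mob B \<tau> * autfac B \<tau> = of_real (B $ 1 $ 1) * \<tau> + of_real (B $ 1 $ 2)"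
    using assms by (simp add: mob_def)
  then have "autfac A (mob B \<tau>) * autfac B \<tau> =
      of_real (A $ 2 $ 1) * (of_real (B $ 1 $ 1) * \<tau> + of_real (B $ 1 $ 2)) + of_real (A $ 2 $ 2) * autfac B \<tau>"
    by (simp add: autfac_def[of A] ring_distribs mult.assoc)
  then show ?thesis
    by (simp add: autfac_def mat2_mult_nth algebra_simps)
qed

lemma mob_mult:
  assumes "autfac B \<tau> \<noteq> 0"
  shows "mob (A ** B) \<tau> = mob A (mob B \<tau>)"
proof -
  define N where "N = of_real (A $ 1 $ 1) * mob B \<tau> + of_real (A $ 1 $ 2)"
  have "mob B \<tau> * autfac B \<tau> = of_real (B $ 1 $ 1) * \<tau> + of_real (B $ 1 $ 2)"
    using assms by (simp add: mob_def)
  then have "N * autfac B \<tau> =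
      of_real (A $ 1 $ 1) * (of_real (B $ 1 $ 1) * \<tau> + of_real (B $ 1 $ 2)) + of_real (A $ 1 $ 2) * autfac B \<tau>"
    by (simp add: N_def ring_distribs mult.assoc)
  also have "\<dots> = of_real ((A ** B) $ 1 $ 1) * \<tau> + of_real ((A ** B) $ 1 $ 2)"
    by (simp add: autfac_def mat2_mult_nth algebra_simps)
  finally have "mob (A ** B) \<tau> = (N * autfac B \<tau>) / (autfac A (mob B \<tau>) * autfac B \<tau>)"
    by (simp add: mob_def[of "A ** B"] autfac_mult[OF assms])
  also have "\<dots> = mob A (mob B \<tau>)"
    using assms by (simp add: mob_def[of A] N_def)
  finally show ?thesis .
qed

lemma mob_holomorphic: "det A > 0 \<Longrightarrow> mob A holomorphic_on upper_half"
  unfolding mob_def [abs_def] autfac_def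
  by (intro holomorphic_intros) (auto dest: autfac_nonzero simp: autfac_def)

lemma carrier_GMp:
  "(A, \<omega>) \<in> carrier GMp \<longleftrightarrow> det A > 0 \<and> \<omega> \<in> extensional upper_half \<and> \<omega> holomorphic_on upper_half \<and>
     (\<forall>\<tau>\<in>upper_half. (\<omega> \<tau>)\<^sup>2 = autfac A \<tau>)"
  by (simp add: GMp_def)

lemma mult_GMp:
  "(A1, \<omega>1) \<otimes>\<^bsub>GMp\<^esub> (A2, \<omega>2) = (A1 ** A2, restrict (\<lambda>\<tau>. \<omega>1 (mob A2 \<tau>) * \<omega>2 \<tau>) upper_half)"
  by (simp add: GMp_def)

lemma one_GMp: "\<one>\<^bsub>GMp\<^esub> = (mat 1, restrict (\<lambda>_. 1) upper_half)"
  by (simp add: GMp_def)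

lemma mat_1_eq_mat2: "mat 1 = mat2 1 0 0 1"
  by (rule mat2_eqI) (auto simp: mat_def)

lemma autfac_mat_1 [simp]: "autfac (mat 1) \<tau> = 1"
  by (simp add: mat_1_eq_mat2 autfac_def)

lemma mob_mat_1 [simp]: "mob (mat 1) \<tau> = \<tau>"
  by (simp add: mob_def) (simp add: mat_1_eq_mat2)

lemma monoid_GMp: "monoid GMp"
proof (rule monoidI)
  fix x y assume xy: "x \<in> carrier GMp" "y \<in> carrier GMp"
  obtain A \<omega> B \<theta> where [simp]: "x = (A, \<omega>)" "y = (B, \<theta>)"
    by (metis surj_pair)
  have A: "det A > 0" "\<omega> holomorphic_on upper_half" "\<And>\<tau>. \<tau> \<in> upper_half \<Longrightarrow> (\<omega> \<tau>)\<^sup>2 = autfac A \<tau>"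
    and B: "det B > 0" "\<theta> holomorphic_on upper_half" "\<And>\<tau>. \<tau> \<in> upper_half \<Longrightarrow> (\<theta> \<tau>)\<^sup>2 = autfac B \<tau>"
    using xy by (auto simp: carrier_GMp)
  have "(\<omega> \<circ> mob B) holomorphic_on upper_half"
    using A B by (intro holomorphic_on_compose_gen[OF mob_holomorphic]) (auto intro: mob_in_upper_half)
  then have "(\<lambda>\<tau>. \<omega> (mob B \<tau>) * \<theta> \<tau>) holomorphic_on upper_half"
    using B by (intro holomorphic_intros) (auto simp: o_def)
  then have "restrict (\<lambda>\<tau>. \<omega> (mob B \<tau>) * \<theta> \<tau>) upper_half holomorphic_on upper_half"
    by (rule holomorphic_transform) auto
  then show "x \<otimes>\<^bsub>GMp\<^esub> y \<in> carrier GMp"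
    using A B by (auto simp: mult_GMp carrier_GMp det_mul power_mult_distrib mob_in_upper_half autfac_mult autfac_nonzero)
next
  show "\<one>\<^bsub>GMp\<^esub> \<in> carrier GMp"
    by (auto simp: one_GMp carrier_GMp intro: holomorphic_transform[OF holomorphic_on_const[of 1]])
next
  fix x y z assume xyz: "x \<in> carrier GMp" "y \<in> carrier GMp" "z \<in> carrier GMp"
  obtain A \<omega> B \<theta> C \<psi> where [simp]: "x = (A, \<omega>)" "y = (B, \<theta>)" "z = (C, \<psi>)"
    by (metis surj_pair)
  have "det C > 0"
    using xyz by (simp add: carrier_GMp)
  then show "x \<otimes>\<^bsub>GMp\<^esub> y \<otimes>\<^bsub>GMp\<^esub> z = x \<otimes>\<^bsub>GMp\<^esub> (y \<otimes>\<^bsub>GMp\<^esub> z)"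
    by (auto simp: mult_GMp matrix_mul_assoc mob_mult autfac_nonzero mob_in_upper_half mult.assoc restrict_def
             intro!: ext)
next
  fix x assume x: "x \<in> carrier GMp"
  obtain A \<omega> where [simp]: "x = (A, \<omega>)"
    by (metis surj_pair)
  have A: "det A > 0" "\<omega> \<in> extensional upper_half"
    using x by (auto simp: carrier_GMp)
  show "\<one>\<^bsub>GMp\<^esub> \<otimes>\<^bsub>GMp\<^esub> x = x" "x \<otimes>\<^bsub>GMp\<^esub> \<one>\<^bsub>GMp\<^esub> = x"
    using A by (auto simp: one_GMp mult_GMp mob_in_upper_half restrict_def extensional_def intro!: ext)
qed

interpretation GMp: monoid GMp
  by (rule monoid_GMp)

section \<open>Translations and conjugation by \<open>mp_delta M\<close>\<close>

definition mp_translate :: "real \<Rightarrow> mp" where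
  "mp_translate x = (mat2 1 x 0 1, restrict (\<lambda>_. 1) upper_half)"

lemma autfac_translate [simp]: "autfac (mat2 1 x 0 1) \<tau> = 1"
  by (simp add: autfac_def)

lemma mob_translate [simp]: "mob (mat2 1 x 0 1) \<tau> = \<tau> + of_real x"
  by (simp add: mob_def)

lemma mp_translate_carrier: "mp_translate x \<in> carrier GMp"
  by (auto simp: mp_translate_def carrier_GMp det_2 intro: holomorphic_transform[OF holomorphic_on_const[of 1]])

lemma mp_translate_mult: "mp_translate x \<otimes>\<^bsub>GMp\<^esub> mp_translate y = mp_translate (x + y)"
proof -
  have "mat2 1 x 0 1 ** mat2 1 y 0 1 = mat2 1 (x + y) 0 1"
    by (rule mat2_eqI) (auto simp: mat2_mult_nth)
  then show ?thesis
    by (auto simp: mp_translate_def mult_GMp restrict_def upper_half_def intro!: ext)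
qed

lemma mp_translate_0: "mp_translate 0 = \<one>\<^bsub>GMp\<^esub>"
  by (simp add: mp_translate_def one_GMp mat_1_eq_mat2)

lemma mpT_int_pow: "mpT [^]\<^bsub>GMp\<^esub> (n :: int) = mp_translate (of_int n)"
proof -
  have nat_pow: "mpT [^]\<^bsub>GMp\<^esub> (k :: nat) = mp_translate (of_nat k)" for k
  proof (induction k)
    case (Suc k)
    have "mpT = mp_translate 1"
      by (simp add: mpT_def mp_translate_def)
    then show ?case
      using Suc mp_translate_mult[of "real k" 1] by (simp add: add.commute)
  qed (simp add: mp_translate_0)
  have "inv\<^bsub>GMp\<^esub> (mp_translate x) = mp_translate (- x)" for x
    by (rule GMp.inv_unique'[symmetric]) (auto simp: mp_translate_carrier mp_translate_mult mp_translate_0)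
  then show ?thesis
    by (simp add: int_pow_def2 nat_pow)
qed

lemma mp_delta_carrier: "M > 0 \<Longrightarrow> mp_delta M \<in> carrier GMp"
  by (auto simp: mp_delta_def carrier_GMp det_2 autfac_def simp flip: of_real_power
           intro: holomorphic_transform[OF holomorphic_on_const[of "of_real (sqrt (real M))"]])

lemma mob_diag [simp]: "mob (mat2 x 0 0 y) \<tau> = of_real x * \<tau> / of_real y"
  by (simp add: mob_def autfac_def)

lemma inv_mp_delta:
  assumes "M > 0"
  shows "inv\<^bsub>GMp\<^esub> (mp_delta M) =
           (mat2 1 0 0 (1 / real M), restrict (\<lambda>_. of_real (1 / sqrt (real M))) upper_half)"
proof (rule GMp.inv_unique'[symmetric])
  let ?d = "(mat2 1 0 0 (1 / real M), restrict (\<lambda>_. of_real (1 / sqrt (real M))) upper_half)"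
  have "restrict (\<lambda>_. of_real (1 / sqrt (real M))) upper_half holomorphic_on upper_half"
    by (rule holomorphic_transform[OF holomorphic_on_const]) auto
  then show "?d \<in> carrier GMp"
    using assms by (auto simp: carrier_GMp det_2 autfac_def power_divide simp flip: of_real_power)
  have mat: "mat2 1 0 0 (real M) ** mat2 1 0 0 (1 / real M) = mat 1" "mat2 1 0 0 (1 / real M) ** mat2 1 0 0 (real M) = mat 1"
    using assms by (auto simp: mat_1_eq_mat2 mat2_mult_nth intro!: mat2_eqI)
  have [simp]: "Im (complex_of_real x * \<tau>) = x * Im \<tau>" for x \<tau>
    by simp
  show "mp_delta M \<otimes>\<^bsub>GMp\<^esub> ?d = \<one>\<^bsub>GMp\<^esub>" "?d \<otimes>\<^bsub>GMp\<^esub> mp_delta M = \<one>\<^bsub>GMp\<^esub>"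
    using assms by (auto simp: mp_delta_def mult_GMp one_GMp mat restrict_def upper_half_def simp flip: of_real_mult intro!: ext)
qed (use assms mp_delta_carrier in auto)

lemma delta_conj_eq:
  assumes "M > 0" "(B, \<theta>) \<in> carrier GMp"
  shows "inv\<^bsub>GMp\<^esub> (mp_delta M) \<otimes>\<^bsub>GMp\<^esub> (B, \<theta>) \<otimes>\<^bsub>GMp\<^esub> mp_delta M =
    (mat2 (B $ 1 $ 1) (B $ 1 $ 2 * real M) (B $ 2 $ 1 / real M) (B $ 2 $ 2),
     restrict (\<lambda>\<tau>. \<theta> (\<tau> / of_nat M)) upper_half)"
proof -
  have "mat2 1 0 0 (1 / real M) ** B ** mat2 1 0 0 (real M) =
        mat2 (B $ 1 $ 1) (B $ 1 $ 2 * real M) (B $ 2 $ 1 / real M) (B $ 2 $ 2)"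
    using assms by (intro mat2_eqI) (auto simp: mat2_mult_nth)
  moreover have "det B > 0"
    using assms by (simp add: carrier_GMp)
  moreover have "\<tau> / of_nat M \<in> upper_half" if "\<tau> \<in> upper_half" for \<tau>
    using that assms by (auto simp: upper_half_def)
  ultimately show ?thesis
    unfolding inv_mp_delta[OF assms(1)] using assms
    by (auto simp: mult_GMp mp_delta_def mob_in_upper_half intro!: ext simp flip: of_real_mult)
qed

text \<open>\<open>mp_iota M\<close> undoes the conjugation by \<open>mp_delta M\<close>, so
  \<open>chi_tilde\<close> at a conjugate of an element of \<open>\<Gamma>\<close> is the value of
  \<open>chi\<close> at that element.\<close>

lemma mp_iota_delta_conj:
  assumes "M > 0" "g \<in> carrier GMp"
  shows "mp_iota M (inv\<^bsub>GMp\<^esub> (mp_delta M) \<otimes>\<^bsub>GMp\<^esub> g \<otimes>\<^bsub>GMp\<^esub> mp_delta M) = g"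
proof -
  obtain B \<theta> where g [simp]: "g = (B, \<theta>)"
    by (metis surj_pair)
  have "\<theta> \<in> extensional upper_half"
    using assms by (simp add: carrier_GMp)
  moreover have "of_nat M * \<tau> \<in> upper_half" if "\<tau> \<in> upper_half" for \<tau>
    using that assms by (auto simp: upper_half_def)
  ultimately show ?thesis
    using assms by (auto simp: delta_conj_eq mp_iota_def intro!: ext mat2_eqI simp: restrict_def extensional_def)
qed

lemma T_twist_eq:
  assumes "(A, \<omega>) \<in> carrier GMp"
  shows "T_twist a h (A, \<omega>) =
    (mat2 1 (of_int (a\<^sup>2 * h)) 0 1 ** A ** mat2 1 (- of_int h) 0 1,
     restrict (\<lambda>\<tau>. \<omega> (\<tau> - of_int h)) upper_half)"
proof -
  have "\<tau> - of_int h \<in> upper_half" if "\<tau> \<in> upper_half" for \<tau>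
    using that by (auto simp: upper_half_def)
  moreover have "det A > 0"
    using assms by (simp add: carrier_GMp)
  ultimately show ?thesis
    unfolding T_twist_def mpT_int_pow mp_translate_def
    by (auto simp: mult_GMp mob_in_upper_half restrict_def intro!: ext)
qed

text \<open>\<open>B\<close> is the conjugate of the twisted element by \<open>mp_delta M\<close>,
  which acts as \<tau> -> \<tau> / M; hence it carries (\<tau> + h)/M to (g \<tau> + a^2 h)/M. Its
  square root of the automorphy factor there is that of g at \<tau>, in which h does not
  occur.\<close>

lemma T_twist_in_delta_conj:
  assumes M: "M > 0" and \<Gamma>: "\<Gamma> \<subseteq> carrier GMp" and g: "g \<in> carrier GMp" "has_entries g a b c d"
    and tw: "T_twist a h g \<in> delta_conj \<Gamma> M"
  obtains B :: "real ^ 2 ^ 2" and \<theta> :: "complex \<Rightarrow> complex"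
  where "(B, \<theta>) \<in> \<Gamma>" "mp_iota M (T_twist a h g) = (B, \<theta>)"
    "B $ 2 $ 1 = of_int (int M * c)" "B $ 2 $ 2 = of_int (d - c * h)"
    "\<And>\<tau>. \<tau> \<in> upper_half \<Longrightarrow> \<theta> ((\<tau> + of_int h) / of_nat M) = snd g \<tau>"
    "\<And>\<tau>. \<tau> \<in> upper_half \<Longrightarrow> mob B ((\<tau> + of_int h) / of_nat M) = (mob (fst g) \<tau> + of_int (a\<^sup>2 * h)) / of_nat M"
proof -
  obtain A \<omega> where [simp]: "g = (A, \<omega>)"
    by (metis surj_pair)
  have A: "A = mat2 (of_int a) (of_int b) (of_int c) (of_int d)" and detA: "det A > 0"
    using g by (auto simp: has_entries_def carrier_GMp)
  obtain B \<theta> where B: "(B, \<theta>) \<in> \<Gamma>"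
      "T_twist a h g = inv\<^bsub>GMp\<^esub> (mp_delta M) \<otimes>\<^bsub>GMp\<^esub> (B, \<theta>) \<otimes>\<^bsub>GMp\<^esub> mp_delta M"
    using tw by (auto simp: delta_conj_def)
  have BC: "(B, \<theta>) \<in> carrier GMp"
    using B \<Gamma> by auto
  have iota: "mp_iota M (T_twist a h g) = (B, \<theta>)"
    unfolding B(2) by (rule mp_iota_delta_conj[OF M BC])
  have eq: "(mat2 1 (of_int (a\<^sup>2 * h)) 0 1 ** A ** mat2 1 (- of_int h) 0 1,
         restrict (\<lambda>\<tau>. \<omega> (\<tau> - of_int h)) upper_half) =
        (mat2 (B $ 1 $ 1) (B $ 1 $ 2 * real M) (B $ 2 $ 1 / real M) (B $ 2 $ 2),
         restrict (\<lambda>\<tau>. \<theta> (\<tau> / of_nat M)) upper_half)"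
    using B(2) T_twist_eq[of A \<omega> a h] delta_conj_eq[OF M BC] g(1) by simp
  then have eq1: "mat2 1 (of_int (a\<^sup>2 * h)) 0 1 ** A ** mat2 1 (- of_int h) 0 1 =
        mat2 (B $ 1 $ 1) (B $ 1 $ 2 * real M) (B $ 2 $ 1 / real M) (B $ 2 $ 2)"
    and eq2: "restrict (\<lambda>\<tau>. \<omega> (\<tau> - of_int h)) upper_half = restrict (\<lambda>\<tau>. \<theta> (\<tau> / of_nat M)) upper_half"
    by (simp_all only: prod.inject)
  have B11: "B $ 1 $ 1 = of_int (a + a\<^sup>2 * h * c)"
    using arg_cong[OF eq1, of "\<lambda>X. X $ 1 $ 1"] by (simp add: mat2_mult_nth A)
  have B12: "B $ 1 $ 2 * real M = of_int (b + a\<^sup>2 * h * d - h * (a + a\<^sup>2 * h * c))"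
    using arg_cong[OF eq1, of "\<lambda>X. X $ 1 $ 2"] by (simp add: mat2_mult_nth A algebra_simps)
  have B21: "B $ 2 $ 1 = of_int (int M * c)"
    using arg_cong[OF eq1, of "\<lambda>X. X $ 2 $ 1"] M by (simp add: mat2_mult_nth A field_simps)
  have B22: "B $ 2 $ 2 = of_int (d - c * h)"
    using arg_cong[OF eq1, of "\<lambda>X. X $ 2 $ 2"] by (simp add: mat2_mult_nth A)
  have \<theta>: "\<theta> ((\<tau> + of_int h) / of_nat M) = snd g \<tau>" if "\<tau> \<in> upper_half" for \<tau>
  proof -
    have "\<tau> + of_int h \<in> upper_half"
      using that by (auto simp: upper_half_def)
    then show ?thesis
      using fun_cong[OF eq2, of "\<tau> + of_int h"] by simp
  qed
  have mob: "mob B ((\<tau> + of_int h) / of_nat M) = (mob (fst g) \<tau> + of_int (a\<^sup>2 * h)) / of_nat M"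
    if \<tau>: "\<tau> \<in> upper_half" for \<tau>
  proof -
    define j where "j = autfac A \<tau>"
    have j: "j \<noteq> 0" "j = of_int c * \<tau> + of_int d"
      using autfac_nonzero[OF detA \<tau>] by (auto simp: j_def A autfac_def)
    have M0: "(of_nat M :: complex) \<noteq> 0"
      using M by simp
    have "autfac B ((\<tau> + of_int h) / of_nat M) = j"
      using M0 by (simp add: autfac_def B21 B22 j(2) field_simps)
    moreover have "of_real (B $ 1 $ 1) * ((\<tau> + of_int h) / of_nat M) + of_real (B $ 1 $ 2)
        = (of_int a * \<tau> + of_int b + of_int (a\<^sup>2 * h) * j) / of_nat M"
    proof -
      have "complex_of_real (B $ 1 $ 2) * of_nat M = of_int (b + a\<^sup>2 * h * d - h * (a + a\<^sup>2 * h * c))"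
        using arg_cong[OF B12, of complex_of_real] by simp
      then have "(of_real (B $ 1 $ 1) * ((\<tau> + of_int h) / of_nat M) + of_real (B $ 1 $ 2)) * of_nat M
          = of_real (B $ 1 $ 1) * (\<tau> + of_int h) + of_int (b + a\<^sup>2 * h * d - h * (a + a\<^sup>2 * h * c))"
        using M0 by (simp add: distrib_right)
      also have "\<dots> = of_int a * \<tau> + of_int b + of_int (a\<^sup>2 * h) * j"
        unfolding B11 j(2) by (simp add: algebra_simps)
      finally show ?thesis
        by (simp only: nonzero_eq_divide_eq[OF M0])
    qed
    ultimately have "mob B ((\<tau> + of_int h) / of_nat M)
        = ((of_int a * \<tau> + of_int b + of_int (a\<^sup>2 * h) * j) / of_nat M) / j"
      by (simp add: mob_def)
    also have "\<dots> = ((of_int a * \<tau> + of_int b) / j + of_int (a\<^sup>2 * h)) / of_nat M"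
      using j(1) by (simp add: field_simps)
    also have "(of_int a * \<tau> + of_int b) / j = mob (fst g) \<tau>"
      by (simp add: mob_def j_def A)
    finally show ?thesis .
  qed
  show ?thesis
    using that[OF B(1) iota B21 B22 \<theta> mob] by blast
qed

lemma has_entries_unique:
  assumes "has_entries g a b c d" "has_entries g a' b' c' d'"
  shows "a = a'" "b = b'" "c = c'" "d = d'"
proof -
  have eq: "mat2 (of_int a) (of_int b) (of_int c) (of_int d) = mat2 (of_int a') (of_int b') (of_int c') (of_int d')"
    using assms by (simp add: has_entries_def)
  show "a = a'" "b = b'" "c = c'" "d = d'"
    using arg_cong[OF eq, of "\<lambda>X. X $ 1 $ 1"] arg_cong[OF eq, of "\<lambda>X. X $ 1 $ 2"]
      arg_cong[OF eq, of "\<lambda>X. X $ 2 $ 1"] arg_cong[OF eq, of "\<lambda>X. X $ 2 $ 2"] by simp_all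
qed

lemma Mp1Z_det:
  assumes "g \<in> Mp1Z" "has_entries g a b c d"
  shows "a * d - b * c = 1"
proof -
  have "det (fst g) = 1"
    using assms by (auto simp: Mp1Z_def Mp1R_def)
  then have "real_of_int (a * d - b * c) = 1"
    using assms(2) by (simp add: has_entries_def det_2)
  then show ?thesis
    by linarith
qed

lemma one_in_Mp1Z: "\<one>\<^bsub>GMp\<^esub> \<in> Mp1Z"
proof -
  have "has_entries \<one>\<^bsub>GMp\<^esub> 1 0 0 1"
    by (simp add: has_entries_def one_GMp mat_1_eq_mat2)
  moreover have "det (fst \<one>\<^bsub>GMp\<^esub>) = 1"
    by (simp add: one_GMp)
  ultimately show ?thesis
    unfolding Mp1Z_def Mp1R_def using GMp.one_closed by blast
qed

subsection \<open>Uniqueness of Fourier expansions\<close>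

text \<open>Real translations of \<tau> isolate the exponent n, and real translations of z then
  isolate r; both preserve the chamber.\<close>

lemma jacobi_fourier_zero:
  assumes "\<And>\<tau> z. 0 < Im z \<Longrightarrow> Im z < Im \<tau> \<Longrightarrow>
             ((\<lambda>(n, r). c n r * ee (of_real n * \<tau> + of_int r * z)) has_sum 0) UNIV"
  shows "c n r = (0 :: complex)"
proof -
  define a where "a \<tau> z i = c (fst i) (snd i) * ee (of_real (fst i) * \<tau> + of_int (snd i) * z)"
    for \<tau> z and i :: "real \<times> int"
  have 1: "(a \<tau> z has_sum 0) {i \<in> UNIV. fst i = n}" if "0 < Im z" "Im z < Im \<tau>" for \<tau> z
  proof (rule almost_periodic_unique)
    fix x :: real
    have "(a (\<tau> + of_real x) z has_sum 0) UNIV"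
      using assms[of z "\<tau> + of_real x"] that by (simp add: a_def [abs_def] case_prod_unfold)
    also have "a (\<tau> + of_real x) z = (\<lambda>i. a \<tau> z i * ee (of_real (fst i * x)))"
      by (auto simp: a_def ee_add [symmetric] algebra_simps)
    finally show "((\<lambda>i. a \<tau> z i * ee (of_real (fst i * x))) has_sum 0) UNIV" .
  qed
  have 2: "(a \<tau> z has_sum 0) {i \<in> {i \<in> UNIV. fst i = n}. real_of_int (snd i) = of_int r}"
    if "0 < Im z" "Im z < Im \<tau>" for \<tau> z
  proof (rule almost_periodic_unique)
    fix x :: real
    have "(a \<tau> (z + of_real x) has_sum 0) {i \<in> UNIV. fst i = n}"
      using 1 that by simp
    also have "a \<tau> (z + of_real x) = (\<lambda>i. a \<tau> z i * ee (of_real (real_of_int (snd i) * x)))"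
      by (auto simp: a_def ee_add [symmetric] algebra_simps)
    finally show "((\<lambda>i. a \<tau> z i * ee (of_real (real_of_int (snd i) * x))) has_sum 0) {i \<in> UNIV. fst i = n}" .
  qed
  have "{i \<in> {i \<in> UNIV. fst i = n}. real_of_int (snd i) = of_int r} = {(n, r)}"
    by auto
  then have "(a (Complex 0 2) (Complex 0 1) has_sum 0) {(n, r)}"
    using 2[of "Complex 0 1" "Complex 0 2"] by simp
  then have "a (Complex 0 2) (Complex 0 1) (n, r) = 0"
    by (simp add: has_sum_finite_iff)
  then show ?thesis
    by (simp add: a_def)
qed

lemma jacobi_fourier_unique:
  assumes "jacobi_fourier \<phi> c" "jacobi_fourier \<phi> c'"
  shows "c = c'"
proof (intro ext)
  fix n r
  have "c n r - c' n r = 0"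
  proof (rule jacobi_fourier_zero[where c = "\<lambda>n r. c n r - c' n r"])
    fix \<tau> z :: complex assume "0 < Im z" "Im z < Im \<tau>"
    then have "((\<lambda>(n, r). c n r * ee (of_real n * \<tau> + of_int r * z)) has_sum \<phi> \<tau> z) UNIV"
      "((\<lambda>(n, r). c' n r * ee (of_real n * \<tau> + of_int r * z)) has_sum \<phi> \<tau> z) UNIV"
      using assms by (auto simp: jacobi_fourier_def)
    from has_sum_diff[OF this]
    show "((\<lambda>(n, r). (c n r - c' n r) * ee (of_real n * \<tau> + of_int r * z)) has_sum 0) UNIV"
      by (simp add: case_prod_unfold left_diff_distrib)
  qed
  then show "c n r = c' n r" by simp
qed

lemma jacobi_fourier_coeff:
  assumes "jacobi_fourier \<phi> c"
  shows "fourier_coeff \<phi> = c"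
  unfolding fourier_coeff_def using assms jacobi_fourier_unique by blast

subsection \<open>The function \<open>e(z/2) - e(-z/2)\<close>\<close>

lemma ee_1 [simp]: "ee 1 = 1"
  using ee_of_int[of 1] by simp

text \<open>This is 2 i sin(pi z), with simple zeros exactly at the integers.\<close>

definition esin :: "complex \<Rightarrow> complex" where
  "esin z = ee (z / 2) - ee (- z / 2)"

lemma esin_eq_0_iff: "esin z = 0 \<longleftrightarrow> z \<in> \<int>"
proof -
  have "esin z = 0 \<longleftrightarrow> ee (z / 2) / ee (- z / 2) = 1"
    by (simp add: esin_def)
  also have "ee (z / 2) / ee (- z / 2) = ee z"
    by (simp add: ee_diff [symmetric])
  finally show ?thesis
    by (simp add: ee_eq_1_iff)
qed

text \<open>The factor \<open>ee (of_int k / 2)\<close> is the sign (-1)^k; for odd \<nu> it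
  survives in the power, so only the period 2 is available below.\<close>

lemma esin_add_int: "esin (z + of_int k) = ee (of_int k / 2) * esin z"
proof -
  have "ee (- of_int k / 2) = ee (of_int k / 2)"
    using ee_diff[of "of_int k / 2" "of_int k"] by simp
  moreover have "ee ((z + of_int k) / 2) = ee (of_int k / 2) * ee (z / 2)"
      "ee (- (z + of_int k) / 2) = ee (- of_int k / 2) * ee (- z / 2)"
    unfolding ee_add [symmetric] by (rule arg_cong[where f = ee], simp add: field_simps)+
  ultimately show ?thesis
    by (simp add: esin_def right_diff_distrib)
qed

lemma esin_add_2: "esin (z + 2) = esin z"
  using esin_add_int[of z 2] ee_of_int[of 1] by simp

lemma esin_holomorphic [holomorphic_intros]:
  "f holomorphic_on A \<Longrightarrow> (\<lambda>z. esin (f z)) holomorphic_on A"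
  unfolding esin_def by (intro holomorphic_intros) auto

lemma esin_over_id_tendsto: "((\<lambda>z. esin z / z) \<longlongrightarrow> 2 * of_real pi * \<i>) (at 0)"
proof -
  have "(esin has_field_derivative 2 * of_real pi * \<i>) (at 0)"
    unfolding esin_def [abs_def] ee_def by (auto intro!: derivative_eq_intros)
  moreover have "esin 0 = 0"
    by (simp add: esin_def)
  ultimately show ?thesis
    by (simp add: has_field_derivative_iff)
qed

text \<open>Negative \<nu> is admissible because \<open>esin\<close> is bounded away from 0 at
  distance at least y from the real line.\<close>

lemma norm_esin_powi_le:
  assumes "y > 0"
  obtains D where "D > 0"
    "\<And>z. \<bar>Im z\<bar> \<ge> y \<Longrightarrow> norm (esin z powi \<nu>) \<le> D * exp (pi * real (nat \<bar>\<nu>\<bar>) * \<bar>Im z\<bar>)"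
proof -
  \<comment> \<open>Lower bound from |e(z/2)| and |e(-z/2)|: their difference is exp(pi |Im z|) (1 -
    exp(- 2 pi |Im z|)) in absolute value.\<close>
  define q where "q = 1 - exp (- 2 * pi * y)"
  have q: "0 < q" "q < 1"
    using assms by (auto simp: q_def)
  \<comment> \<open>The value 2 serves the upper bound on \<open>esin\<close>, the value 1/q the
    bound on its inverse.\<close>
  define D where "D = max 2 (1 / q)"
  have D: "D \<ge> 2" "1 / q \<le> D"
    by (auto simp: D_def)
  have bounds: "norm (esin z) \<le> D * exp (pi * \<bar>Im z\<bar>) \<and> inverse (norm (esin z)) \<le> D * exp (pi * \<bar>Im z\<bar>)"
    if z: "\<bar>Im z\<bar> \<ge> y" for z
  proof
    define u where "u = exp (pi * \<bar>Im z\<bar>)"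
    have u: "u \<ge> 1"
      by (simp add: u_def)
    have ns: "norm (ee (z / 2)) = exp (- pi * Im z)" "norm (ee (- z / 2)) = exp (pi * Im z)"
      by (auto simp: norm_ee)
    have "norm (esin z) \<le> exp (- pi * Im z) + exp (pi * Im z)"
      unfolding esin_def using norm_triangle_ineq4[of "ee (z / 2)" "ee (- z / 2)"] ns by simp
    also have "\<dots> \<le> u + u"
      unfolding u_def by (intro add_mono) (auto simp: abs_if)
    also have "\<dots> \<le> D * u"
      using D u by (auto simp: mult_right_mono[of 2 D u])
    finally show "norm (esin z) \<le> D * exp (pi * \<bar>Im z\<bar>)"
      by (simp add: u_def)
    have "u * q \<le> u * (1 - exp (- 2 * pi * \<bar>Im z\<bar>))"
      using z u by (intro mult_left_mono) (auto simp: q_def)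
    also have "\<dots> = exp (pi * \<bar>Im z\<bar>) - exp (- pi * \<bar>Im z\<bar>)"
      by (simp add: u_def right_diff_distrib exp_add [symmetric])
    also have "\<dots> = \<bar>exp (- pi * Im z) - exp (pi * Im z)\<bar>"
      by (cases "Im z \<ge> 0") (auto simp: abs_if zero_less_mult_iff mult_less_0_iff)
    also have "\<dots> \<le> norm (esin z)"
      unfolding esin_def using norm_triangle_ineq3[of "ee (z / 2)" "ee (- z / 2)"] ns by simp
    finally have "u * q \<le> norm (esin z)" .
    moreover have "q \<le> u * q"
      using u q by simp
    ultimately have "q \<le> norm (esin z)"
      by linarith
    then have "inverse (norm (esin z)) \<le> inverse q"
      using q by (intro le_imp_inverse_le) auto
    also have "\<dots> \<le> D * u"
      using D u q mult_mono[of "1 / q" D 1 u] by (simp add: divide_inverse)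
    finally show "inverse (norm (esin z)) \<le> D * exp (pi * \<bar>Im z\<bar>)"
      by (simp add: u_def)
  qed
  have "norm (esin z powi \<nu>) \<le> D ^ nat \<bar>\<nu>\<bar> * exp (pi * real (nat \<bar>\<nu>\<bar>) * \<bar>Im z\<bar>)" if z: "\<bar>Im z\<bar> \<ge> y" for z
  proof -
    have "norm (esin z powi \<nu>) \<le> (D * exp (pi * \<bar>Im z\<bar>)) ^ nat \<bar>\<nu>\<bar>"
    proof (cases "\<nu> \<ge> 0")
      case True
      then have "norm (esin z powi \<nu>) = norm (esin z) ^ nat \<bar>\<nu>\<bar>"
        by (simp add: power_int_def norm_power)
      then show ?thesis
        using bounds[OF z] by (simp add: power_mono)
    next
      case False
      then have "norm (esin z powi \<nu>) = inverse (norm (esin z)) ^ nat \<bar>\<nu>\<bar>"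
        by (simp add: power_int_def norm_power norm_inverse)
      also have "\<dots> \<le> (D * exp (pi * \<bar>Im z\<bar>)) ^ nat \<bar>\<nu>\<bar>"
        using bounds[OF z] by (intro power_mono) auto
      finally show ?thesis .
    qed
    also have "\<dots> = D ^ nat \<bar>\<nu>\<bar> * exp (pi * real (nat \<bar>\<nu>\<bar>) * \<bar>Im z\<bar>)"
      by (simp add: power_mult_distrib exp_of_nat_mult [symmetric] mult_ac)
    finally show ?thesis .
  qed
  then show ?thesis
    using that[of "D ^ nat \<bar>\<nu>\<bar>"] D by simp
qed

subsection \<open>Fourier expansions in the two chambers adjacent to the real line\<close>

locale jacobi_form =
  fixes \<Gamma> :: "mp set" and chi :: "mp \<Rightarrow> complex" and \<beta> :: rat
    and w :: int and m :: real and \<phi> :: "complex \<Rightarrow> complex \<Rightarrow> complex"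
  assumes subgroup: "subgroup \<Gamma> GMp" and \<Gamma>_subset: "\<Gamma> \<subseteq> Mp1Z"
    and character: "is_character \<Gamma> chi"
    and mpT_in: "mpT \<in> \<Gamma>" and chi_mpT: "chi mpT = ee (of_rat \<beta>)"
    and jacobi: "weakly_holomorphic_jacobi_form \<Gamma> chi w m \<phi>"
begin

lemma mero: "lattice_meromorphic \<phi>"
  using jacobi by (simp add: weakly_holomorphic_jacobi_form_def)

lemma transformation:
  assumes "g \<in> \<Gamma>" "(\<tau>, z) \<in> jacobi_dom"
  shows "heis_slash m (mp_slash w m \<phi> g) X \<tau> z = chi g * \<phi> \<tau> z"
proof -
  have "\<forall>g\<in>\<Gamma>. \<forall>X. \<forall>(\<tau>, z) \<in> jacobi_dom. heis_slash m (mp_slash w m \<phi> g) X \<tau> z = chi g * \<phi> \<tau> z"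
    using jacobi[unfolded weakly_holomorphic_jacobi_form_def] by (elim conjE)
  from bspec[OF spec[OF bspec[OF this assms(1)]] assms(2), of X] show ?thesis
    by simp
qed

lemma one_in: "\<one>\<^bsub>GMp\<^esub> \<in> \<Gamma>"
  using subgroup by (rule subgroup.one_closed)

lemma chi_one: "chi \<one>\<^bsub>GMp\<^esub> = 1"
proof -
  have "chi \<one>\<^bsub>GMp\<^esub> \<noteq> 0"
    using character one_in unfolding is_character_def by blast
  moreover have "chi (\<one>\<^bsub>GMp\<^esub> \<otimes>\<^bsub>GMp\<^esub> \<one>\<^bsub>GMp\<^esub>) = chi \<one>\<^bsub>GMp\<^esub> * chi \<one>\<^bsub>GMp\<^esub>"
    using character one_in unfolding is_character_def by blast
  ultimately show ?thesis by simp
qed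

lemma mp_slash_one:
  assumes "Im \<tau> > 0"
  shows "mp_slash w m \<phi> \<one>\<^bsub>GMp\<^esub> \<tau> z = \<phi> \<tau> z"
  using assms by (simp add: mp_slash_def one_GMp upper_half_def) (simp add: mat_1_eq_mat2)

lemma elliptic:
  assumes "(\<tau>, z) \<in> jacobi_dom"
  shows "ee (of_real m * (of_int u ^ 2 * \<tau> + 2 * of_int u * z + of_int (u * v + \<kappa>))) *
           \<phi> \<tau> (z + of_int u * \<tau> + of_int v) = \<phi> \<tau> z"
proof -
  have "Im \<tau> > 0"
    using assms by (simp add: jacobi_dom_def upper_half_def)
  then show ?thesis
    using transformation[OF one_in assms, of "(u, v, \<kappa>)"] by (simp add: heis_slash_def chi_one mp_slash_one)
qed

lemma z_period:
  assumes "(\<tau>, z) \<in> jacobi_dom"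
  shows "\<phi> \<tau> (z + of_int v) = \<phi> \<tau> z"
  using elliptic[OF assms, of 0 v 0] by simp

lemma modular:
  assumes "(A, \<omega>) \<in> \<Gamma>" "(\<tau>, z) \<in> jacobi_dom"
  shows "\<omega> \<tau> powi (- w) * ee (- of_real m * of_real (A $ 2 $ 1) * z\<^sup>2 / autfac A \<tau>) *
           \<phi> (mob A \<tau>) (z / autfac A \<tau>) = chi (A, \<omega>) * \<phi> \<tau> z"
  using transformation[OF assms, of "(0, 0, 0)"] by (simp add: heis_slash_def mp_slash_def)

lemma \<tau>_period:
  assumes "(\<tau>, z) \<in> jacobi_dom"
  shows "\<phi> (\<tau> + 1) z = ee (of_rat \<beta>) * \<phi> \<tau> z"
proof -
  have "\<tau> \<in> upper_half"
    using assms by (simp add: jacobi_dom_def)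
  then show ?thesis
    using modular[of "mat2 1 1 0 1" "restrict (\<lambda>_. 1) upper_half", OF _ assms] mpT_in chi_mpT by (simp add: mpT_def)
qed

lemma ex_fourier:
  "\<exists>n0. jacobi_fourier \<phi> (fourier_coeff \<phi>) \<and> (\<forall>n r. fourier_coeff \<phi> n r \<noteq> 0 \<longrightarrow> n \<ge> n0)"
proof -
  obtain c n0 where c: "jacobi_fourier (mp_slash w m \<phi> \<one>\<^bsub>GMp\<^esub>) c" "\<forall>n r. c n r \<noteq> 0 \<longrightarrow> n \<ge> n0"
    using jacobi one_in_Mp1Z unfolding weakly_holomorphic_jacobi_form_def by blast
  have "jacobi_fourier \<phi> c"
    using c(1) unfolding jacobi_fourier_def by (auto simp: mp_slash_one)
  then show ?thesis
    using c(2) jacobi_fourier_coeff by auto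
qed

lemma fourier: "jacobi_fourier \<phi> (fourier_coeff \<phi>)"
  using ex_fourier by blast

definition n0 :: real where
  "n0 = (SOME n0. \<forall>n r. fourier_coeff \<phi> n r \<noteq> 0 \<longrightarrow> n \<ge> n0)"

lemma n0: "fourier_coeff \<phi> n r \<noteq> 0 \<Longrightarrow> n \<ge> n0"
proof -
  have "\<forall>n r. fourier_coeff \<phi> n r \<noteq> 0 \<longrightarrow> n \<ge> n0"
    unfolding n0_def using ex_fourier by (intro someI_ex[of "\<lambda>n0. \<forall>n r. fourier_coeff \<phi> n r \<noteq> 0 \<longrightarrow> n \<ge> n0"]) blast
  then show "fourier_coeff \<phi> n r \<noteq> 0 \<Longrightarrow> n \<ge> n0" by blast
qed

lemma of_real_of_rat [simp]: "complex_of_real (of_rat q) = of_rat q"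
  by (cases q) (simp add: of_rat_rat)

text \<open>Substituting \<tau> + 1 multiplies the coefficient at n by e(n) and the form by
  e(\<beta>). Thus the coefficients times e(n - \<beta>) expand the same form, and uniqueness forces
  this factor to be 1 on the support.\<close>

lemma fourier_support:
  assumes "fourier_coeff \<phi> n r \<noteq> 0"
  shows "n - of_rat \<beta> \<in> \<int>"
proof -
  define c where "c n r = ee (of_real (n - of_rat \<beta>)) * fourier_coeff \<phi> n r" for n r
  have "jacobi_fourier \<phi> c"
    unfolding jacobi_fourier_def
  proof (intro allI impI)
    fix \<tau> z :: complex assume *: "0 < Im z \<and> Im z < Im \<tau>"
    have "z \<notin> \<int>"
      using * by (auto elim!: Ints_cases)
    then have dom: "(\<tau>, z) \<in> jacobi_dom"
      using * by (intro jacobi_domI) auto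
    have "((\<lambda>(n, r). fourier_coeff \<phi> n r * ee (of_real n * (\<tau> + 1) + of_int r * z)) has_sum \<phi> (\<tau> + 1) z) UNIV"
      using fourier * unfolding jacobi_fourier_def by simp
    then have "((\<lambda>i. ee (- of_rat \<beta>) * (\<lambda>(n, r). fourier_coeff \<phi> n r * ee (of_real n * (\<tau> + 1) + of_int r * z)) i)
        has_sum (ee (- of_rat \<beta>) * \<phi> (\<tau> + 1) z)) UNIV"
      by (rule has_sum_cmult_right)
    also have "ee (- of_rat \<beta>) * \<phi> (\<tau> + 1) z = \<phi> \<tau> z"
      by (simp add: \<tau>_period[OF dom] mult.assoc [symmetric] ee_add [symmetric])
    also have "(\<lambda>i. ee (- of_rat \<beta>) * (\<lambda>(n, r). fourier_coeff \<phi> n r * ee (of_real n * (\<tau> + 1) + of_int r * z)) i)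
       = (\<lambda>(n, r). c n r * ee (of_real n * \<tau> + of_int r * z))"
    proof (intro ext, clarify)
      fix n :: real and r :: int
      have "ee (- of_rat \<beta>) * ee (of_real n * (\<tau> + 1) + of_int r * z) =
            ee (of_real (n - of_rat \<beta>)) * ee (of_real n * \<tau> + of_int r * z)"
        unfolding ee_add [symmetric] by (rule arg_cong[where f = ee]) (simp add: algebra_simps)
      then show "ee (- of_rat \<beta>) * (fourier_coeff \<phi> n r * ee (of_real n * (\<tau> + 1) + of_int r * z)) =
            c n r * ee (of_real n * \<tau> + of_int r * z)"
        by (simp add: c_def mult_ac)
    qed
    finally show "((\<lambda>(n, r). c n r * ee (of_real n * \<tau> + of_int r * z)) has_sum \<phi> \<tau> z) UNIV" .
  qed
  then have "fourier_coeff \<phi> = c"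
    by (rule jacobi_fourier_coeff)
  then have "fourier_coeff \<phi> n r = ee (of_real (n - of_rat \<beta>)) * fourier_coeff \<phi> n r"
    by (metis c_def)
  then have "ee (of_real (n - of_rat \<beta>)) = 1"
    using assms by simp
  then show ?thesis
    by (simp only: ee_of_real_eq_1_iff)
qed

end

text \<open>Tails are taken along fibres of f: F is a finite set of values, each possibly attained
  by infinitely many indices. This is the form needed to sum over all r before summing over
  n.\<close>

lemma infsum_tail_tendsto_0:
  fixes W :: "'a \<Rightarrow> real" and f :: "'a \<Rightarrow> 'b"
  assumes "W summable_on UNIV" "\<And>i. W i \<ge> 0"
  shows "((\<lambda>F. infsum W {i. f i \<notin> F}) \<longlongrightarrow> 0) (finite_subsets_at_top UNIV)"
proof (rule tendstoI)
  fix \<epsilon> :: real assume "\<epsilon> > 0"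
  obtain I where I: "finite I" "dist (sum W I) (infsum W UNIV) \<le> \<epsilon> / 2"
    using infsum_finite_approximation[OF assms(1), of "\<epsilon> / 2"] \<open>\<epsilon> > 0\<close> by auto
  have "\<forall>\<^sub>F F in finite_subsets_at_top UNIV. f ` I \<subseteq> F"
    unfolding eventually_finite_subsets_at_top using I(1) by (intro exI[of _ "f ` I"]) auto
  then show "\<forall>\<^sub>F F in finite_subsets_at_top UNIV. dist (infsum W {i. f i \<notin> F}) 0 < \<epsilon>"
  proof eventually_elim
    case (elim F)
    have "infsum W {i. f i \<notin> F} \<le> infsum W (UNIV - I)"
      using elim assms by (intro infsum_mono_neutral) (auto intro: summable_on_subset)
    also have "\<dots> = infsum W UNIV - sum W I"
      using I assms by (subst infsum_Diff) auto
    also have "\<dots> < \<epsilon>"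
      using I(2) \<open>\<epsilon> > 0\<close> unfolding dist_real_def by linarith
    finally show ?case
      using assms(2) by (simp add: dist_real_def infsum_nonneg)
  qed
qed

text \<open>The zero form has no leading Laurent coefficient, so its \<open>pole_order\<close> is
  unspecified; a point of nonvanishing makes \<nu> meaningful and also forces the index to be
  integral.\<close>

locale nonzero_jacobi_form = jacobi_form +
  fixes \<tau>0 z0 :: complex
  assumes nonzero: "(\<tau>0, z0) \<in> jacobi_dom" "\<phi> \<tau>0 z0 \<noteq> 0"
begin

definition mi :: int where "mi = \<lfloor>m\<rfloor>"

text \<open>The central Heisenberg element with \<open>\<kappa>\<close> = 1 acts by e(m), and the
  character is trivial on it, so e(m) = 1 for a nonzero form.\<close>

lemma of_int_mi [simp]: "real_of_int mi = m" "complex_of_int mi = of_real m"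
proof -
  have "ee (of_real m) = 1"
    using elliptic[OF nonzero(1), of 0 0 1] nonzero(2) by simp
  then have "m \<in> \<int>"
    by (simp add: ee_of_real_eq_1_iff)
  then show "real_of_int mi = m"
    by (auto simp: mi_def elim: Ints_cases)
  then show "complex_of_int mi = of_real m"
    by (metis of_real_of_int_eq)
qed

definition cc :: "real \<times> int \<Rightarrow> complex" where
  "cc i = fourier_coeff \<phi> (fst i) (snd i)"

text \<open>For \<open>b = True\<close> the pair \<open>(lam b i, rho b i)\<close> is the exponent \<open>i\<close> of the expansion in the chamber
  \<open>0 < Im z < Im \<tau>\<close>. For \<open>b = False\<close> it is its image under the elliptic transformation
  \<open>z \<mapsto> z + \<tau>\<close>, which yields the expansion in the chamber \<open>- Im \<tau> < Im z < 0\<close>.\<close>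

definition lam :: "bool \<Rightarrow> real \<times> int \<Rightarrow> real" where
  "lam b i = (if b then fst i else fst i + of_int (snd i) + of_int mi)"

definition rho :: "bool \<Rightarrow> real \<times> int \<Rightarrow> int" where
  "rho b i = (if b then snd i else snd i + 2 * mi)"

lemma lam_rho_inject: "lam b i = lam b j \<Longrightarrow> rho b i = rho b j \<Longrightarrow> i = j"
  by (auto simp: lam_def rho_def prod_eq_iff split: if_splits)

lemma nonreal_in_dom: "Im z \<noteq> 0 \<Longrightarrow> \<bar>Im z\<bar> < Im \<tau> \<Longrightarrow> (\<tau>, z) \<in> jacobi_dom"
  by (rule jacobi_domI) (auto elim!: Ints_cases)

lemma expansion:
  assumes "Im z \<noteq> 0" "\<bar>Im z\<bar> < Im \<tau>"
  shows "((\<lambda>i. cc i * ee (of_real (lam (Im z > 0) i) * \<tau> + of_int (rho (Im z > 0) i) * z)) has_sum \<phi> \<tau> z) UNIV"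
proof (cases "Im z > 0")
  case True
  then show ?thesis
    using fourier assms by (auto simp: jacobi_fourier_def cc_def lam_def rho_def case_prod_unfold)
next
  case False
  have "((\<lambda>i. cc i * ee (of_real (fst i) * \<tau> + of_int (snd i) * (z + \<tau>))) has_sum \<phi> \<tau> (z + \<tau>)) UNIV"
    using fourier assms False by (auto simp: jacobi_fourier_def cc_def case_prod_unfold)
  then have "((\<lambda>i. ee (of_real m * (\<tau> + 2 * z)) * (cc i * ee (of_real (fst i) * \<tau> + of_int (snd i) * (z + \<tau>))))
      has_sum ee (of_real m * (\<tau> + 2 * z)) * \<phi> \<tau> (z + \<tau>)) UNIV"
    by (rule has_sum_cmult_right)
  also have "ee (of_real m * (\<tau> + 2 * z)) * \<phi> \<tau> (z + \<tau>) = \<phi> \<tau> z"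
    using elliptic[OF nonreal_in_dom[OF assms], of 1 0 0] by simp
  also have "(\<lambda>i. ee (of_real m * (\<tau> + 2 * z)) * (cc i * ee (of_real (fst i) * \<tau> + of_int (snd i) * (z + \<tau>))))
      = (\<lambda>i. cc i * ee (of_real (lam (Im z > 0) i) * \<tau> + of_int (rho (Im z > 0) i) * z))"
  proof
    fix i :: "real \<times> int"
    have "ee (of_real m * (\<tau> + 2 * z)) * ee (of_real (fst i) * \<tau> + of_int (snd i) * (z + \<tau>))
        = ee (of_real (lam (Im z > 0) i) * \<tau> + of_int (rho (Im z > 0) i) * z)"
      unfolding ee_add [symmetric] using False
      by (intro arg_cong[where f = ee]) (simp add: lam_def rho_def algebra_simps)
    then show "ee (of_real m * (\<tau> + 2 * z)) * (cc i * ee (of_real (fst i) * \<tau> + of_int (snd i) * (z + \<tau>)))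
        = cc i * ee (of_real (lam (Im z > 0) i) * \<tau> + of_int (rho (Im z > 0) i) * z)"
      by (simp add: mult_ac)
  qed
  finally show ?thesis .
qed

definition coeff_z :: "real \<Rightarrow> complex \<Rightarrow> complex" where
  "coeff_z n z = infsum (\<lambda>i. cc i * ee (of_int (rho (Im z > 0) i) * z)) {i. lam (Im z > 0) i = n}"

lemma coeff_z_has_sum:
  assumes "Im z \<noteq> 0"
  shows "((\<lambda>i. cc i * ee (of_int (rho (Im z > 0) i) * z)) has_sum coeff_z n z) {i. lam (Im z > 0) i = n}"
    (is "(?f has_sum _) ?I")
proof -
  \<comment> \<open>Any \<tau> with Im \<tau> > |Im z| will do: e(n \<tau>) is a common factor of
    the terms with exponent n and is divided out again.\<close>
  define \<tau> where "\<tau> = Complex 0 (\<bar>Im z\<bar> + 1)"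
  have "(\<lambda>i. cc i * ee (of_real (lam (Im z > 0) i) * \<tau> + of_int (rho (Im z > 0) i) * z)) summable_on UNIV"
    using expansion[of z \<tau>] assms by (intro has_sum_imp_summable[where S = "\<phi> \<tau> z"]) (auto simp: \<tau>_def)
  then have "(\<lambda>i. cc i * ee (of_real (lam (Im z > 0) i) * \<tau> + of_int (rho (Im z > 0) i) * z)) summable_on ?I"
    by (rule summable_on_subset) auto
  then have "(\<lambda>i. ?f i * ee (of_real n * \<tau>)) summable_on ?I"
    by (rule summable_on_cong[THEN iffD1, rotated]) (auto simp: ee_add)
  then have "(\<lambda>i. (?f i * ee (of_real n * \<tau>)) * inverse (ee (of_real n * \<tau>))) summable_on ?I"
    by (rule summable_on_cmult_left)
  then have "?f summable_on ?I"
    by (simp add: mult.assoc)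
  then show ?thesis
    unfolding coeff_z_def by (rule has_sum_infsum)
qed

lemma coeff_z_has_sum_\<tau>:
  assumes "Im z \<noteq> 0"
  shows "((\<lambda>i. cc i * ee (of_real (lam (Im z > 0) i) * \<tau> + of_int (rho (Im z > 0) i) * z)) has_sum
            ee (of_real n * \<tau>) * coeff_z n z) {i. lam (Im z > 0) i = n}"
proof -
  have "((\<lambda>i. ee (of_real n * \<tau>) * (cc i * ee (of_int (rho (Im z > 0) i) * z))) has_sum
            ee (of_real n * \<tau>) * coeff_z n z) {i. lam (Im z > 0) i = n}"
    by (intro has_sum_cmult_right coeff_z_has_sum assms)
  then show ?thesis
    by (rule has_sum_cong[THEN iffD1, rotated]) (auto simp: ee_add)
qed

lemma coeff_z_period:
  shows "coeff_z n (z + 2) = coeff_z n z"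
proof -
  have "ee (of_int k * (z + 2)) = ee (of_int k * z)" for k
    using ee_add[of "of_int k * z" "of_int (k * 2)"] ee_of_int[of "k * 2"] by (simp add: algebra_simps)
  then show ?thesis
    by (simp add: coeff_z_def)
qed

section \<open>Removing the poles at the integers\<close>

definition \<nu> :: int where "\<nu> = pole_order \<phi>"

text \<open>In the strip |Im z| < Im \<tau> the only singularities are integers, and there the
  product has finite limits; \<open>remove_sings\<close> inserts them as values.\<close>

definition \<psi> :: "complex \<Rightarrow> complex \<Rightarrow> complex" where
  "\<psi> \<tau> = remove_sings (\<lambda>z. esin z powi \<nu> * \<phi> \<tau> z)"

lemma holomorphic_off_Ints:
  "(\<lambda>z. esin z powi \<nu> * \<phi> \<tau> z) holomorphic_on {z. \<bar>Im z\<bar> < Im \<tau>} - \<int>"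
proof (intro holomorphic_intros)
  show "\<phi> \<tau> holomorphic_on {z. \<bar>Im z\<bar> < Im \<tau>} - \<int>"
    by (intro holomorphic_slice mero jacobi_domI) auto
qed (auto simp: esin_eq_0_iff)

lemma open_strip_minus_Ints: "open ({z. \<bar>Im z\<bar> < Y} - \<int>)"
  by (intro open_Diff open_strip closed_Ints)

lemma \<psi>_off_Ints:
  assumes "\<bar>Im z\<bar> < Im \<tau>" "z \<notin> \<int>"
  shows "\<psi> \<tau> z = esin z powi \<nu> * \<phi> \<tau> z"
  unfolding \<psi>_def
  by (intro remove_sings_at_analytic holomorphic_on_imp_analytic_at[OF holomorphic_off_Ints])
     (use assms in \<open>auto intro!: open_strip_minus_Ints\<close>)

text \<open>\<open>esin z / z\<close> tends to 2 pi i, which is nonzero, so powers of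
  \<open>esin\<close> may replace powers of z for either sign of \<nu>.\<close>

lemma ex_lim_at_0:
  assumes "Im \<tau> > 0"
  shows "\<exists>L. ((\<lambda>z. esin z powi \<nu> * \<phi> \<tau> z) \<longlongrightarrow> L) (at 0)"
proof -
  obtain f where "leading_laurent_coeff \<phi> \<nu> f"
    using ex_leading_laurent_coeff_pole_order[OF mero nonzero] by (auto simp: \<nu>_def)
  then have "((\<lambda>z. z powi \<nu> * \<phi> \<tau> z) \<longlongrightarrow> f \<tau>) (at 0)"
    using assms by (auto simp: leading_laurent_coeff_def upper_half_def)
  then have "((\<lambda>z. (esin z / z) powi \<nu> * (z powi \<nu> * \<phi> \<tau> z)) \<longlongrightarrow> (2 * of_real pi * \<i>) powi \<nu> * f \<tau>) (at 0)"
    by (intro tendsto_mult tendsto_power_int esin_over_id_tendsto) auto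
  moreover have "\<forall>\<^sub>F z in at 0. (esin z / z) powi \<nu> * (z powi \<nu> * \<phi> \<tau> z) = esin z powi \<nu> * \<phi> \<tau> z"
    using eventually_at_punctured[of 0]
    by eventually_elim (simp add: power_int_divide_distrib)
  ultimately show ?thesis
    by (blast intro: Lim_transform_eventually)
qed

lemma lim_at_int:
  assumes \<tau>: "Im \<tau> > 0" and L: "((\<lambda>z. esin z powi \<nu> * \<phi> \<tau> z) \<longlongrightarrow> L) (at 0)"
  shows "((\<lambda>z. esin z powi \<nu> * \<phi> \<tau> z) \<longlongrightarrow> ee (of_int k / 2) powi \<nu> * L) (at (of_int k))"
proof (rule LIM_offset_zero_cancel)
  have "((\<lambda>h. ee (of_int k / 2) powi \<nu> * (esin h powi \<nu> * \<phi> \<tau> h)) \<longlongrightarrow> ee (of_int k / 2) powi \<nu> * L) (at 0)"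
    by (intro tendsto_mult tendsto_const L)
  moreover have "\<forall>\<^sub>F h in at 0. ee (of_int k / 2) powi \<nu> * (esin h powi \<nu> * \<phi> \<tau> h)
      = esin (of_int k + h) powi \<nu> * \<phi> \<tau> (of_int k + h)"
  proof -
    have "\<forall>\<^sub>F h in at (0::complex). h \<in> ball 0 (min 1 (Im \<tau>)) - {0}"
      using \<tau> by (intro eventually_at_in_open) auto
    then show ?thesis
    proof eventually_elim
      case (elim h)
      then have "(\<tau>, h) \<in> jacobi_dom"
        by (intro small_in_jacobi_dom) auto
      then show ?case
        using z_period[of \<tau> h k] esin_add_int[of h k] by (simp add: add.commute power_int_mult_distrib)
    qed
  qed
  ultimately show "((\<lambda>h. esin (of_int k + h) powi \<nu> * \<phi> \<tau> (of_int k + h)) \<longlongrightarrow> ee (of_int k / 2) powi \<nu> * L) (at 0)"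
    by (rule Lim_transform_eventually)
qed

lemma \<psi>_holomorphic:
  assumes \<tau>: "Im \<tau> > 0"
  shows "\<psi> \<tau> holomorphic_on {z. \<bar>Im z\<bar> < Im \<tau>}"
proof -
  have "\<psi> \<tau> analytic_on {z}" if z: "\<bar>Im z\<bar> < Im \<tau>" for z
  proof (cases "z \<in> \<int>")
    case False
    then have "(\<lambda>z. esin z powi \<nu> * \<phi> \<tau> z) analytic_on {z}"
      by (intro holomorphic_on_imp_analytic_at[OF holomorphic_off_Ints]) (use z in \<open>auto intro!: open_strip_minus_Ints\<close>)
    then show ?thesis
      unfolding \<psi>_def
      by (intro remove_sings_analytic_at[OF isolated_singularity_at_analytic isContD] analytic_at_imp_isCont)
  next
    case True
    then obtain k where k: "z = of_int k"
      by (auto elim: Ints_cases)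
    define r where "r = min 1 (Im \<tau>)"
    have "(\<lambda>z. esin z powi \<nu> * \<phi> \<tau> z) holomorphic_on ball z r - {z}"
    proof (rule holomorphic_on_subset[OF holomorphic_off_Ints])
      show "ball z r - {z} \<subseteq> {z. \<bar>Im z\<bar> < Im \<tau>} - \<int>"
      proof
        fix v assume v: "v \<in> ball z r - {z}"
        then have "norm (v - z) < 1" "norm (v - z) < Im \<tau>" "v - z \<noteq> 0"
          by (auto simp: r_def dist_norm norm_minus_commute)
        moreover have "\<bar>Im v\<bar> \<le> norm (v - z)"
          using abs_Im_le_cmod[of "v - z"] by (simp add: k)
        moreover have "v \<notin> \<int>"
        proof
          assume "v \<in> \<int>"
          then have "v - z \<in> \<int>"
            by (simp add: k)
          then show False
            using calculation small_not_Ints by blast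
        qed
        ultimately show "v \<in> {z. \<bar>Im z\<bar> < Im \<tau>} - \<int>"
          by auto
      qed
    qed
    then have "isolated_singularity_at (\<lambda>z. esin z powi \<nu> * \<phi> \<tau> z) z"
      by (rule isolated_singularity_at_holomorphic) (use \<tau> in \<open>auto simp: r_def\<close>)
    moreover obtain L where "((\<lambda>z. esin z powi \<nu> * \<phi> \<tau> z) \<longlongrightarrow> L) (at 0)"
      using ex_lim_at_0[OF \<tau>] by blast
    ultimately show ?thesis
      unfolding \<psi>_def using lim_at_int[OF \<tau>, of L k] k by (blast intro: remove_sings_analytic_at)
  qed
  then have "\<psi> \<tau> analytic_on {z. \<bar>Im z\<bar> < Im \<tau>}"
    by (subst analytic_on_analytic_at) auto
  then show ?thesis
    by (rule analytic_imp_holomorphic)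
qed

lemma \<psi>_period:
  assumes "\<bar>Im z\<bar> < Im \<tau>"
  shows "\<psi> \<tau> (z + 2) = \<psi> \<tau> z"
proof (cases "z \<in> \<int>")
  case True
  then obtain k where k: "z = of_int k"
    by (auto elim: Ints_cases)
  have \<tau>: "Im \<tau> > 0"
    using assms by simp
  obtain L where "((\<lambda>z. esin z powi \<nu> * \<phi> \<tau> z) \<longlongrightarrow> L) (at 0)"
    using ex_lim_at_0[OF \<tau>] by blast
  then have *: "\<psi> \<tau> (of_int k) = ee (of_int k / 2) powi \<nu> * L" for k
    unfolding \<psi>_def by (intro remove_sings_eqI lim_at_int \<tau>)
  have "ee (of_int (k + 2) / 2) = ee (of_int k / 2)"
    using ee_add[of "of_int k / 2" "of_int 1"] by (simp add: add_divide_distrib)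
  then show ?thesis
    using *[of k] *[of "k + 2"] by (simp add: k)
next
  case False
  then have "z + 2 \<notin> \<int>"
    by (metis Ints_diff Ints_numeral add_diff_cancel_right')
  moreover have "\<phi> \<tau> (z + 2) = \<phi> \<tau> z"
    using z_period[OF jacobi_domI[OF assms False], of 2] by simp
  ultimately show ?thesis
    using False assms by (simp add: \<psi>_off_Ints esin_add_2)
qed

lemma \<psi>_nonreal: "Im z \<noteq> 0 \<Longrightarrow> \<bar>Im z\<bar> < Im \<tau> \<Longrightarrow> \<psi> \<tau> z = esin z powi \<nu> * \<phi> \<tau> z"
  by (rule \<psi>_off_Ints) (auto elim!: Ints_cases)

end

lemma has_sum_fibres:
  fixes a :: "'i \<Rightarrow> 'b :: topological_comm_monoid_add"
  assumes "finite F" "\<And>n. n \<in> F \<Longrightarrow> (a has_sum S n) {i. f i = n}"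
  shows "(a has_sum (\<Sum>n\<in>F. S n)) {i. f i \<in> F}"
  using assms
proof (induction F rule: finite_induct)
  case (insert n F)
  have "(a has_sum (S n + (\<Sum>n\<in>F. S n))) ({i. f i = n} \<union> {i. f i \<in> F})"
    using insert by (intro has_sum_Un_disjoint) auto
  also have "{i. f i = n} \<union> {i. f i \<in> F} = {i. f i \<in> insert n F}"
    by auto
  finally show ?case
    using insert by simp
qed simp

section \<open>Entire continuation of the coefficients\<close>

context nonzero_jacobi_form
begin

text \<open>The support of a summable family is countable; this permits the choice of a nonresonant
  step. Both chambers use the same coefficients \<open>cc\<close>, so one expansion is
  enough.\<close>

lemma countable_cc: "countable {i. cc i \<noteq> 0}"
proof -
  define a where "a i = cc i * ee (of_real (lam True i) * Complex 0 2 + of_int (rho True i) * Complex 0 1)" for i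
  have "(a has_sum \<phi> (Complex 0 2) (Complex 0 1)) UNIV"
    using expansion[of "Complex 0 1" "Complex 0 2"] by (simp add: a_def [abs_def])
  then have "countable {i \<in> UNIV. a i \<noteq> 0}"
    by (intro abs_summable_countable complex_summable_imp_norm_summable) (rule has_sum_imp_summable)
  then show ?thesis
    by (simp add: a_def)
qed

text \<open>Fourier coefficients in \<open>\<tau>\<close> at height \<open>Y\<close> are limits of averages of \<open>\<psi>\<close> over
  arithmetic progressions. The averages are holomorphic across the real line, and by the maximum
  principle on strips they converge there because they do so on nearby horizontal lines.\<close>

lemma ex_coeff_extension_strip:
  assumes Y: "Y > 0"
  shows "\<exists>G. G holomorphic_on {z. \<bar>Im z\<bar> < Y} \<and>
              (\<forall>z. \<bar>Im z\<bar> < Y \<longrightarrow> Im z \<noteq> 0 \<longrightarrow> G z = esin z powi \<nu> * coeff_z n z)"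
proof -
  \<comment> \<open>The step t has to be nonresonant in both chambers at once, since the same
    averages must converge on either side of the real line.\<close>
  have "countable ((\<lambda>(b, i). lam b i - n) ` (UNIV \<times> {i. cc i \<noteq> 0}))"
    using countable_cc by (intro countable_image countable_SIGMA) auto
  from ex_nonresonant_step[OF this] obtain t where t:
      "\<forall>\<delta>\<in>(\<lambda>(b, i). lam b i - n) ` (UNIV \<times> {i. cc i \<noteq> 0}). \<delta> \<noteq> 0 \<longrightarrow> ee (of_real (\<delta> * t)) \<noteq> 1"
    by blast
  have t: "ee (of_real ((lam b i - n) * t)) \<noteq> 1" if "cc i \<noteq> 0" "lam b i \<noteq> n" for b i
  proof -
    have "lam b i - n \<in> (\<lambda>(b, i). lam b i - n) ` (UNIV \<times> {i. cc i \<noteq> 0})"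
      using that by (intro image_eqI[of _ _ "(b, i)"]) auto
    from mp[OF bspec[OF t this]] show ?thesis
      using that by simp
  qed
  define \<tau> where "\<tau> x = Complex x Y" for x
  have \<tau>_eq: "\<tau> x = \<tau> 0 + of_real x" for x
    by (simp add: \<tau>_def complex_eq_iff)
  have Im_\<tau> [simp]: "Im (\<tau> x) = Y" for x
    by (simp add: \<tau>_def)
  \<comment> \<open>The factor in front removes e(n \<open>\<tau> 0\<close>), so that the limit is
    independent of the base point in \<tau>.\<close>
  define A where "A K z = ee (- of_real n * \<tau> 0) *
      ((\<Sum>j<K. ee (- of_real (n * (t * real j))) * \<psi> (\<tau> (t * real j)) z) / of_nat K)" for K z
  define a where "a z i = cc i * ee (of_real (lam (Im z > 0) i) * \<tau> 0 + of_int (rho (Im z > 0) i) * z)" for z i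
  \<comment> \<open>Evaluating at i y represents the whole line Im z = y, because the moduli of
    \<open>a z i\<close> depend on Im z alone.\<close>
  define err where "err y K = avg_error (a (Complex 0 y)) (lam (y > 0)) UNIV n t K" for y K
  define N where "N = norm (ee (- of_real n * \<tau> 0))"
  have "N > 0"
    by (simp add: N_def)
  have hs: "((\<lambda>i. a z i * ee (of_real (lam (Im z > 0) i * x))) has_sum \<phi> (\<tau> x) z) UNIV"
    if z: "Im z \<noteq> 0" "\<bar>Im z\<bar> < Y" for z x
  proof -
    have "(\<lambda>i. a z i * ee (of_real (lam (Im z > 0) i * x))) =
          (\<lambda>i. cc i * ee (of_real (lam (Im z > 0) i) * \<tau> x + of_int (rho (Im z > 0) i) * z))"
      unfolding a_def \<tau>_eq[of x] by (auto simp: mult.assoc ee_add [symmetric] algebra_simps)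
    then show ?thesis
      using expansion[of z "\<tau> x"] z by simp
  qed
  have hs0: "(a z has_sum \<phi> (\<tau> 0) z) UNIV" if z: "Im z \<noteq> 0" "\<bar>Im z\<bar> < Y" for z
    using hs[OF z, of 0] by simp
  have err_tendsto: "err y \<longlonglongrightarrow> 0" if y: "y \<noteq> 0" "\<bar>y\<bar> < Y" for y
  proof -
    have "(\<lambda>i. norm (a (Complex 0 y) i)) summable_on UNIV"
      using hs0[of "Complex 0 y"] y by (intro complex_summable_imp_norm_summable) (auto intro: has_sum_imp_summable)
    then show ?thesis
      unfolding err_def [abs_def] by (rule avg_error_tendsto_0) (rule t, auto simp: a_def)
  qed
  have bound: "norm (A K z - esin z powi \<nu> * coeff_z n z) \<le> N * norm (esin z powi \<nu>) * err (Im z) K"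
    if z: "Im z \<noteq> 0" "\<bar>Im z\<bar> < Y" for z K
  proof -
    define V where "V = (\<Sum>j<K. ee (- of_real (n * (t * real j))) * \<phi> (\<tau> (t * real j)) z) / of_nat K"
    have "(a z has_sum ee (of_real n * \<tau> 0) * coeff_z n z) {i \<in> UNIV. lam (Im z > 0) i = n}"
      using coeff_z_has_sum_\<tau>[OF z(1), where \<tau> = "\<tau> 0" and n = n] by (simp add: a_def [abs_def])
    from norm_avg_le_avg_error[OF hs[OF z] this, where K = K and t = t]
    have "norm (V - ee (of_real n * \<tau> 0) * coeff_z n z) \<le> avg_error (a z) (lam (Im z > 0)) UNIV n t K"
      by (simp add: V_def)
    also have "avg_error (a z) (lam (Im z > 0)) UNIV n t K = err (Im z) K"
      unfolding err_def avg_error_def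
      by (intro infsum_cong arg_cong2[where f = "(*)"] refl) (simp add: a_def norm_mult norm_ee)
    finally have V: "norm (V - ee (of_real n * \<tau> 0) * coeff_z n z) \<le> err (Im z) K" .
    have "(\<Sum>j<K. ee (- of_real (n * (t * real j))) * \<psi> (\<tau> (t * real j)) z) / of_nat K = esin z powi \<nu> * V"
      using z by (simp add: V_def \<psi>_nonreal sum_distrib_left mult_ac)
    then have "A K z - esin z powi \<nu> * coeff_z n z =
        ee (- of_real n * \<tau> 0) * esin z powi \<nu> * (V - ee (of_real n * \<tau> 0) * coeff_z n z)"
      unfolding A_def by (simp add: right_diff_distrib mult.assoc mult.left_commute[of _ "ee (of_real n * \<tau> 0)"]
          flip: ee_add)
    then show ?thesis
      using mult_left_mono[OF V, of "N * norm (esin z powi \<nu>)"] by (simp add: N_def norm_mult)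
  qed
  have A_lim: "(\<lambda>K. A K z) \<longlonglongrightarrow> esin z powi \<nu> * coeff_z n z" if z: "Im z \<noteq> 0" "\<bar>Im z\<bar> < Y" for z
  proof -
    have "(\<lambda>K. N * norm (esin z powi \<nu>) * err (Im z) K) \<longlonglongrightarrow> 0"
      using err_tendsto[OF z] by (rule tendsto_mult_right_zero)
    then have "(\<lambda>K. A K z - esin z powi \<nu> * coeff_z n z) \<longlonglongrightarrow> 0"
      by (rule Lim_null_comparison[OF always_eventually[OF allI[OF bound[OF z]]]])
    then show ?thesis
      by (simp add: LIM_zero_iff)
  qed
  have hol: "A K holomorphic_on {z. \<bar>Im z\<bar> < Y}" for K
    unfolding A_def [abs_def] using \<psi>_holomorphic[of "\<tau> x" for x] Y by (intro holomorphic_intros) auto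
  have per: "A K (z + 2) = A K z" if "\<bar>Im z\<bar> < Y" for K z
    using that by (simp add: A_def \<psi>_period)
  have Cauchy: "uniformly_Cauchy_on {z. \<bar>Im z\<bar> \<le> \<epsilon>} A" if \<epsilon>: "0 < \<epsilon>" "\<epsilon> < Y" for \<epsilon>
  proof (rule uniformly_Cauchy_onI)
    fix e :: real assume "e > 0"
    obtain D where D: "D > 0" "\<And>z. \<bar>Im z\<bar> \<ge> \<epsilon> \<Longrightarrow> norm (esin z powi \<nu>) \<le> D * exp (pi * real (nat \<bar>\<nu>\<bar>) * \<bar>Im z\<bar>)"
      using norm_esin_powi_le[OF \<epsilon>(1), of \<nu>] by metis
    define B where "B = N * (D * exp (pi * real (nat \<bar>\<nu>\<bar>) * \<epsilon>))"
    have "(\<lambda>K. B * err \<epsilon> K + B * err (- \<epsilon>) K) \<longlonglongrightarrow> 0"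
      using \<epsilon> by (intro tendsto_add_zero tendsto_mult_right_zero err_tendsto) auto
    then have "\<forall>\<^sub>F K in sequentially. B * err \<epsilon> K + B * err (- \<epsilon>) K < e / 2"
      by (rule order_tendstoD) (use \<open>e > 0\<close> in auto)
    then obtain K0 where K0: "\<And>K. K \<ge> K0 \<Longrightarrow> B * err \<epsilon> K + B * err (- \<epsilon>) K < e / 2"
      unfolding eventually_sequentially by blast
    have err_nonneg: "err y K \<ge> 0" for y K
      unfolding err_def avg_error_def by (intro infsum_nonneg) auto
    have "B > 0"
      using D \<open>N > 0\<close> by (simp add: B_def)
    show "\<exists>M. \<forall>x\<in>{z. \<bar>Im z\<bar> \<le> \<epsilon>}. \<forall>m\<ge>M. \<forall>n\<ge>M. dist (A m x) (A n x) < e"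
    proof (intro exI ballI allI impI)
      fix z j k assume z: "z \<in> {z. \<bar>Im z\<bar> \<le> \<epsilon>}" and j: "j \<ge> K0" and k: "k \<ge> K0"
      \<comment> \<open>The errors of the two boundary lines are added, so that one bound holds on
        |Im v| = \<epsilon> for both signs.\<close>
      define e' where "e' = (B * err \<epsilon> j + B * err (- \<epsilon>) j) + (B * err \<epsilon> k + B * err (- \<epsilon>) k)"
      have "norm (A j z - A k z) \<le> e'"
      proof (rule periodic_strip_maximum_principle[where h = "\<lambda>z. A j z - A k z"])
        show "(\<lambda>z. A j z - A k z) holomorphic_on {z. \<bar>Im z\<bar> < Y}"
          by (intro holomorphic_intros hol)
        fix v assume v: "\<bar>Im v\<bar> = \<epsilon>"
        have le: "norm (A K v - esin v powi \<nu> * coeff_z n v) \<le> B * err \<epsilon> K + B * err (- \<epsilon>) K" for K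
        proof -
          have "norm (A K v - esin v powi \<nu> * coeff_z n v) \<le> N * norm (esin v powi \<nu>) * err (Im v) K"
            using v \<epsilon> by (intro bound) auto
          also have "\<dots> \<le> B * err (Im v) K"
            unfolding B_def using D(2)[of v] v \<open>N > 0\<close> err_nonneg by (intro mult_right_mono mult_left_mono) auto
          also have "\<dots> \<le> B * err \<epsilon> K + B * err (- \<epsilon>) K"
            using v \<open>B > 0\<close> err_nonneg by (cases "Im v > 0") (auto simp: abs_if split: if_splits)
          finally show ?thesis .
        qed
        show "norm (A j v - A k v) \<le> e'"
          using norm_triangle_ineq4[of "A j v - esin v powi \<nu> * coeff_z n v" "A k v - esin v powi \<nu> * coeff_z n v"]
            le[of j] le[of k] by (simp add: e'_def)
      qed (use per \<epsilon> z in auto)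
      also have "\<dots> < e"
        using K0[of j] K0[of k] j k by (simp add: e'_def)
      finally show "dist (A j z) (A k z) < e"
        by (simp add: dist_norm)
    qed
  qed
  define G where "G z = lim (\<lambda>K. A K z)" for z
  have "G holomorphic_on {z. \<bar>Im z\<bar> < Y}"
  proof (rule holomorphic_uniform_sequence[OF open_strip hol])
    fix x assume x: "x \<in> {z. \<bar>Im z\<bar> < Y}"
    define d where "d = (Y - \<bar>Im x\<bar>) / 2"
    have sub: "cball x d \<subseteq> {z. \<bar>Im z\<bar> \<le> \<bar>Im x\<bar> + d}"
    proof
      fix v assume "v \<in> cball x d"
      then have "\<bar>Im (x - v)\<bar> \<le> d"
        using abs_Im_le_cmod[of "x - v"] by (simp add: dist_norm)
      then show "v \<in> {z. \<bar>Im z\<bar> \<le> \<bar>Im x\<bar> + d}"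
        by auto
    qed
    have d: "0 < d" "\<bar>Im x\<bar> + d < Y"
      using x by (auto simp: d_def field_simps)
    have "uniform_limit {z. \<bar>Im z\<bar> \<le> \<bar>Im x\<bar> + d} A G sequentially"
      using Cauchy_uniformly_convergent[OF Cauchy[of "\<bar>Im x\<bar> + d"]] d
      by (simp add: uniformly_convergent_uniform_limit_iff G_def [abs_def])
    then have "uniform_limit (cball x d) A G sequentially"
      by (rule uniform_limit_on_subset[OF _ sub])
    then show "\<exists>d>0. cball x d \<subseteq> {z. \<bar>Im z\<bar> < Y} \<and> uniform_limit (cball x d) A G sequentially"
      using d sub by (intro exI[of _ d]) force
  qed
  moreover have "G z = esin z powi \<nu> * coeff_z n z" if "\<bar>Im z\<bar> < Y" "Im z \<noteq> 0" for z
    unfolding G_def using A_lim[of z] that by (intro limI) auto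
  ultimately show ?thesis by blast
qed

text \<open>Extensions to strips of different widths agree off the real line by their formula and on
  it by the identity theorem, so they glue; on the real line the values of \<open>G 1\<close> are
  used.\<close>

lemma ex_coeff_extension:
  "\<exists>E. E holomorphic_on UNIV \<and> (\<forall>z. Im z \<noteq> 0 \<longrightarrow> E z = esin z powi \<nu> * coeff_z n z)"
proof -
  have "\<forall>Y. \<exists>G. Y > 0 \<longrightarrow> G holomorphic_on {z. \<bar>Im z\<bar> < Y} \<and>
              (\<forall>z. \<bar>Im z\<bar> < Y \<longrightarrow> Im z \<noteq> 0 \<longrightarrow> G z = esin z powi \<nu> * coeff_z n z)"
    using ex_coeff_extension_strip[of _ n] by blast
  from choice[OF this] obtain G where
    hol: "\<And>Y. Y > 0 \<Longrightarrow> G Y holomorphic_on {z. \<bar>Im z\<bar> < Y}" and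
    G: "\<And>Y z. Y > 0 \<Longrightarrow> \<bar>Im z\<bar> < Y \<Longrightarrow> Im z \<noteq> 0 \<Longrightarrow> G Y z = esin z powi \<nu> * coeff_z n z"
    by blast
  have agree: "G Y z = G 1 z" if Y: "Y \<ge> 1" and z: "\<bar>Im z\<bar> < 1" for Y z
  proof (rule analytic_continuation_open[of "{z. Im z > 0} \<inter> {z. \<bar>Im z\<bar> < 1}" "{z. \<bar>Im z\<bar> < 1}" "G Y" "G 1"])
    show "open ({z. Im z > 0} \<inter> {z. \<bar>Im z\<bar> < 1})"
      by (intro open_Int open_strip open_halfspace_Im_gt)
    have "Complex 0 (1/2) \<in> {z. Im z > 0} \<inter> {z. \<bar>Im z\<bar> < 1}"
      by simp
    then show "{z. Im z > 0} \<inter> {z. \<bar>Im z\<bar> < 1} \<noteq> {}" by blast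
    show "G Y holomorphic_on {z. \<bar>Im z\<bar> < 1}"
      using Y by (intro holomorphic_on_subset[OF hol[of Y]]) auto
  qed (use Y z hol G in \<open>auto simp: open_strip convex_connected convex_strip\<close>)
  define E where "E z = (if Im z = 0 then G 1 z else esin z powi \<nu> * coeff_z n z)" for z
  have "E holomorphic_on UNIV"
  proof (rule holomorphic_onI)
    fix z :: complex
    define Y where "Y = \<bar>Im z\<bar> + 1"
    have "G Y holomorphic_on {z. \<bar>Im z\<bar> < Y}"
      by (rule hol) (simp add: Y_def)
    then have "E holomorphic_on {z. \<bar>Im z\<bar> < Y}"
    proof (rule holomorphic_transform)
      fix v assume "v \<in> {z. \<bar>Im z\<bar> < Y}"
      then show "G Y v = E v"
        using G[of Y v] agree[of Y v] by (auto simp: E_def Y_def)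
    qed
    then have "E field_differentiable at z"
      using open_strip by (rule holomorphic_on_imp_differentiable_at) (simp add: Y_def)
    then show "E field_differentiable at z within UNIV" .
  qed
  then show ?thesis
    by (auto simp: E_def)
qed

text \<open>The entire continuation of \<open>fourier_coeff_tilde \<phi> n\<close> from the upper
  half plane; on the lower half plane it is given by the expansion of the other chamber.\<close>

definition E :: "real \<Rightarrow> complex \<Rightarrow> complex" where
  "E n = (SOME E. E holomorphic_on UNIV \<and> (\<forall>z. Im z \<noteq> 0 \<longrightarrow> E z = esin z powi \<nu> * coeff_z n z))"

lemma E_holomorphic: "E n holomorphic_on UNIV"
  and E_nonreal: "Im z \<noteq> 0 \<Longrightarrow> E n z = esin z powi \<nu> * coeff_z n z"
  using someI_ex[OF ex_coeff_extension[of n]] unfolding E_def [symmetric] by auto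

lemma E_eqI:
  assumes "f holomorphic_on UNIV" "\<And>z. Im z > 0 \<Longrightarrow> E n z = f z"
  shows "E n z = f z"
proof (rule analytic_continuation_open[of "{z. Im z > 0}" UNIV "E n" f])
  have "\<i> \<in> {z. Im z > 0}" by simp
  then show "{z. Im z > 0} \<noteq> {}" by blast
qed (use assms E_holomorphic in \<open>auto simp: open_halfspace_Im_gt\<close>)

lemma E_period: "E n (z + 2) = E n z"
proof (rule E_eqI[symmetric])
  show "(\<lambda>z. E n (z + 2)) holomorphic_on UNIV"
    using holomorphic_on_compose_gen[OF _ E_holomorphic, of "\<lambda>z. z + 2" UNIV]
    by (simp add: o_def holomorphic_on_add)
qed (simp add: E_nonreal esin_add_2 coeff_z_period)

lemma E_eq_0I:
  assumes "\<And>r. fourier_coeff \<phi> n r = 0"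
  shows "E n z = 0"
proof (rule E_eqI)
  fix z assume "Im z > 0"
  have "coeff_z n z = 0"
    unfolding coeff_z_def using assms \<open>Im z > 0\<close> by (intro infsum_0) (auto simp: cc_def lam_def)
  then show "E n z = 0"
    using \<open>Im z > 0\<close> by (simp add: E_nonreal)
qed auto

lemma coeff_z_reindex:
  assumes "Im z > 0"
  shows "coeff_z n z = fourier_coeff_z \<phi> n z"
proof -
  have "{i. lam True i = n} = Pair n ` (UNIV :: int set)"
    by (auto simp: lam_def image_iff)
  then have "coeff_z n z = infsum (\<lambda>i. cc i * ee (of_int (rho True i) * z)) (Pair n ` UNIV)"
    using assms by (simp add: coeff_z_def)
  also have "\<dots> = fourier_coeff_z \<phi> n z"
    unfolding fourier_coeff_z_def
    by (subst infsum_reindex) (auto simp: inj_on_def cc_def rho_def o_def)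
  finally show ?thesis .
qed

lemma E_eq_fourier_coeff_tilde:
  assumes "Im z > 0"
  shows "E n z = fourier_coeff_tilde \<phi> n z"
  using assms by (simp add: E_nonreal coeff_z_reindex fourier_coeff_tilde_def esin_def \<nu>_def)

subsection \<open>Laurent polynomials\<close>

text \<open>The bound is given in the upper chamber and has to be carried to the lower one: for n <
  \<open>n0\<close> the function \<open>E n\<close> vanishes above the real line, hence everywhere,
  and uniqueness below the line kills the coefficients with exponent n there.\<close>

lemma cc_lam_ge:
  assumes "cc i \<noteq> 0"
  shows "lam b i \<ge> n0"
proof (cases b)
  case True
  then show ?thesis
    using assms n0 by (simp add: cc_def lam_def)
next
  case False
  show ?thesis
  proof (rule ccontr)
    assume less: "\<not> lam b i \<ge> n0"
    define n where "n = lam b i"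
    have b: "b = False"
      using False by simp
    have "fourier_coeff \<phi> n r = 0" for r
      using n0[of n r] less by (auto simp: n_def)
    then have "E n z = 0" for z
      by (rule E_eq_0I)
    then have coeff: "coeff_z n z = 0" if "Im z < 0" for z
      using E_nonreal[of z n] that esin_eq_0_iff[of z] by (auto elim!: Ints_cases)
    define a where "a i = cc i * ee (of_int (rho False i) * Complex 0 (-1))" for i
    have "(a has_sum 0) {j \<in> {i. lam False i = n}. real_of_int (rho False j) = of_int (rho False i)}"
    proof (rule almost_periodic_unique)
      fix x :: real
      have "((\<lambda>i. cc i * ee (of_int (rho False i) * Complex x (-1))) has_sum 0) {i. lam False i = n}"
        using coeff_z_has_sum[of "Complex x (-1)" n] coeff[of "Complex x (-1)"] by simp
      moreover have "Complex x (-1) = Complex 0 (-1) + of_real x"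
        by (simp add: complex_eq_iff)
      ultimately show "((\<lambda>i. a i * ee (of_real (real_of_int (rho False i) * x))) has_sum 0) {i. lam False i = n}"
        by (simp add: a_def distrib_left ee_add mult.assoc)
    qed
    moreover have "{j \<in> {i. lam False i = n}. real_of_int (rho False j) = of_int (rho False i)} = {i}"
      using lam_rho_inject[of False _ i] by (auto simp: n_def b)
    ultimately have "a i = 0"
      by (simp add: has_sum_finite_iff)
    then show False
      using assms by (simp add: a_def)
  qed
qed

text \<open>The exponents of \<tau> in the two chambers differ by r + m, so with one of them fixed
  at n the lower bound on the other becomes a one-sided bound on r.\<close>

lemma cc_rho_ge:
  assumes "cc i \<noteq> 0" "lam b i = n"
  shows "(if b then real_of_int (rho b i) else - real_of_int (rho b i)) \<ge> n0 - n - m"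
proof -
  have "real_of_int (rho False i) = snd i + 2 * m"
    by (simp add: rho_def)
  then show ?thesis
    using assms(2) cc_lam_ge[OF assms(1), of True] cc_lam_ge[OF assms(1), of False]
    by (cases b) (auto simp: lam_def rho_def)
qed

text \<open>Each term is compared with its value at height 1 or -1; by the one-sided bound on the
  exponents it grows at most like exp(2 pi \<rho> |Im z|) from there.\<close>

lemma norm_coeff_z_le:
  "\<exists>C R. \<forall>z. \<bar>Im z\<bar> \<ge> 1 \<longrightarrow> norm (coeff_z n z) \<le> C * exp (pi * real R * \<bar>Im z\<bar>)"
proof -
  define \<rho> where "\<rho> = \<bar>n + m - n0\<bar>"
  \<comment> \<open>R measures growth in units of pi, matching a polynomial in e(z/2); hence the
    factor 2.\<close>
  obtain R :: nat where R: "2 * \<rho> \<le> real R"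
    using real_arch_simple by blast
  define C where "C b = infsum (\<lambda>i. norm (cc i * ee (of_int (rho b i) * Complex 0 (if b then 1 else -1)))) {i. lam b i = n}" for b
  have bound: "norm (coeff_z n z) \<le> C (Im z > 0) * exp (pi * real R * \<bar>Im z\<bar>)" if z: "\<bar>Im z\<bar> \<ge> 1" for z
  proof -
    define b where "b = (Im z > 0)"
    define z1 where "z1 = Complex 0 (if b then 1 else -1)"
    have "Im z1 \<noteq> 0" and b1: "(Im z1 > 0) = b"
      by (auto simp: z1_def)
    have f: "((\<lambda>i. cc i * ee (of_int (rho b i) * z)) has_sum coeff_z n z) {i. lam b i = n}"
      unfolding b_def using z by (intro coeff_z_has_sum) auto
    have "(\<lambda>i. norm (cc i * ee (of_int (rho b i) * z1))) summable_on {i. lam b i = n}"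
      using coeff_z_has_sum[OF \<open>Im z1 \<noteq> 0\<close>, of n] unfolding b1
      by (intro complex_summable_imp_norm_summable has_sum_imp_summable)
    then have "((\<lambda>i. norm (cc i * ee (of_int (rho b i) * z1))) has_sum C b) {i. lam b i = n}"
      unfolding C_def z1_def [symmetric] by (rule has_sum_infsum)
    then have g: "((\<lambda>i. norm (cc i * ee (of_int (rho b i) * z1)) * exp (pi * real R * \<bar>Im z\<bar>)) has_sum
        C b * exp (pi * real R * \<bar>Im z\<bar>)) {i. lam b i = n}"
      by (rule has_sum_cmult_left)
    show ?thesis
      unfolding b_def [symmetric]
    proof (rule norm_infsum_le[OF f g])
      fix i assume i: "i \<in> {i. lam b i = n}"
      show "norm (cc i * ee (of_int (rho b i) * z)) \<le>
          norm (cc i * ee (of_int (rho b i) * z1)) * exp (pi * real R * \<bar>Im z\<bar>)"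
      proof (cases "cc i = 0")
        case False
        define s where "s = (if b then real_of_int (rho b i) else - real_of_int (rho b i))"
        have s: "s \<ge> - \<rho>"
          using cc_rho_ge[OF False, of b n] i by (auto simp: s_def \<rho>_def)
        have "\<rho> \<ge> 0"
          by (simp add: \<rho>_def)
        have e1: "real_of_int (rho b i) * Im z = s * \<bar>Im z\<bar>" "real_of_int (rho b i) * Im z1 = s"
          using z by (auto simp: s_def b_def z1_def)
        have "- s * (\<bar>Im z\<bar> - 1) \<le> \<rho> * (\<bar>Im z\<bar> - 1)"
          using s z by (intro mult_right_mono) auto
        also have "\<dots> \<le> \<rho> * \<bar>Im z\<bar>"
          using \<open>\<rho> \<ge> 0\<close> by (intro mult_left_mono) auto
        also have "2 * (\<rho> * \<bar>Im z\<bar>) \<le> real R * \<bar>Im z\<bar>"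
          using R mult_right_mono[OF R, of "\<bar>Im z\<bar>"] by (simp add: mult.assoc)
        finally have "2 * (- s * (\<bar>Im z\<bar> - 1)) \<le> real R * \<bar>Im z\<bar>"
          by simp
        then have "pi * (2 * (- s * (\<bar>Im z\<bar> - 1))) \<le> pi * (real R * \<bar>Im z\<bar>)"
          by (intro mult_left_mono) auto
        then have "- 2 * pi * (real_of_int (rho b i) * Im z) \<le>
            - 2 * pi * (real_of_int (rho b i) * Im z1) + pi * real R * \<bar>Im z\<bar>"
          unfolding e1 by (simp add: algebra_simps)
        then have "exp (- 2 * pi * (real_of_int (rho b i) * Im z)) \<le>
            exp (- 2 * pi * (real_of_int (rho b i) * Im z1)) * exp (pi * real R * \<bar>Im z\<bar>)"
          unfolding exp_add [symmetric] by simp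
        then show ?thesis
          using mult_left_mono[of _ _ "norm (cc i)"] by (simp add: norm_mult norm_ee mult.assoc)
      qed simp
    qed
  qed
  have "norm (coeff_z n z) \<le> (C True + C False) * exp (pi * real R * \<bar>Im z\<bar>)" if z: "\<bar>Im z\<bar> \<ge> 1" for z
  proof -
    have "C b \<ge> 0" for b
      unfolding C_def by (intro infsum_nonneg) auto
    then have "C (Im z > 0) \<le> C True + C False"
      by (cases "Im z > 0") (auto simp: add_increasing add_increasing2)
    then have "C (Im z > 0) * exp (pi * real R * \<bar>Im z\<bar>) \<le> (C True + C False) * exp (pi * real R * \<bar>Im z\<bar>)"
      by (rule mult_right_mono) simp
    then show ?thesis
      using bound[OF z] by linarith
  qed
  then show ?thesis by blast
qed

lemma E_eq_laurent_polynomial: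
  "\<exists>A p. \<forall>z. E n z = ee (- of_nat A * z / 2) * poly p (ee (z / 2))"
proof -
  obtain C R where CR: "\<And>z. \<bar>Im z\<bar> \<ge> 1 \<Longrightarrow> norm (coeff_z n z) \<le> C * exp (pi * real R * \<bar>Im z\<bar>)"
    using norm_coeff_z_le[of n] by blast
  obtain D where D: "D > 0"
    "\<And>z. \<bar>Im z\<bar> \<ge> 1 \<Longrightarrow> norm (esin z powi \<nu>) \<le> D * exp (pi * real (nat \<bar>\<nu>\<bar>) * \<bar>Im z\<bar>)"
    using norm_esin_powi_le[of 1 \<nu>] by (metis zero_less_one)
  define A where "A = nat \<bar>\<nu>\<bar> + R"
  have large: "norm (E n z) \<le> D * C * exp (pi * real A * \<bar>Im z\<bar>)" if z: "\<bar>Im z\<bar> \<ge> 1" for z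
  proof -
    have "norm (E n z) = norm (esin z powi \<nu>) * norm (coeff_z n z)"
      using z by (subst E_nonreal) (auto simp: norm_mult)
    also have "\<dots> \<le> (D * exp (pi * real (nat \<bar>\<nu>\<bar>) * \<bar>Im z\<bar>)) * (C * exp (pi * real R * \<bar>Im z\<bar>))"
      using D CR[OF z] z by (intro mult_mono) (auto simp: less_imp_le)
    also have "\<dots> = D * C * exp (pi * real A * \<bar>Im z\<bar>)"
      by (simp add: A_def exp_add [symmetric] algebra_simps)
    finally show ?thesis .
  qed
  define B where "B = D * C * exp (pi * real A)"
  \<comment> \<open>The term-by-term estimates say nothing near the real line; the maximum principle
    fills in the strip |Im z| <= 1.\<close>
  have line: "norm (E n z) \<le> B" if "\<bar>Im z\<bar> \<le> 1" for z
  proof (rule periodic_strip_maximum_principle[where h = "E n" and Y = 2 and \<epsilon> = 1])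
    show "E n holomorphic_on {z. \<bar>Im z\<bar> < 2}"
      using E_holomorphic by (rule holomorphic_on_subset) auto
    show "norm (E n z) \<le> B" if "\<bar>Im z\<bar> = 1" for z
      using large[of z] that by (simp add: B_def)
  qed (use that E_period in auto)
  have "B \<ge> 0"
    using order_trans[OF norm_ge_zero line[of 0]] by simp
  have "norm (E n z) \<le> B * exp (pi * real A * \<bar>Im z\<bar>)" for z
  proof (cases "\<bar>Im z\<bar> \<le> 1")
    case True
    have "B * 1 \<le> B * exp (pi * real A * \<bar>Im z\<bar>)"
      using \<open>B \<ge> 0\<close> by (intro mult_left_mono) auto
    then show ?thesis
      using line[OF True] by simp
  next
    case False
    have "0 \<le> D * C"
      using \<open>B \<ge> 0\<close> by (simp add: B_def zero_le_mult_iff)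
    then have "D * C * 1 \<le> B"
      unfolding B_def by (intro mult_left_mono) auto
    then have "D * C * exp (pi * real A * \<bar>Im z\<bar>) \<le> B * exp (pi * real A * \<bar>Im z\<bar>)"
      by (intro mult_right_mono) auto
    then show ?thesis
      using large[of z] False by linarith
  qed
  then show ?thesis
    using periodic_entire_exponential_growth[OF E_holomorphic E_period] by blast
qed

subsection \<open>The expansion on the real line\<close>

text \<open>On the lines |Im v| = \<epsilon> the remainders have tail bounds that do not depend on
  Re v. The remainder after finitely many n is holomorphic and periodic in the whole strip, so the
  maximum principle brings these bounds to z, even when z is real.\<close>

lemma \<psi>_has_sum:
  assumes z: "\<bar>Im z\<bar> < Im \<tau>"
  shows "((\<lambda>n. E n z * ee (of_real n * \<tau>)) has_sum \<psi> \<tau> z) UNIV"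
proof -
  \<comment> \<open>The midpoint lies strictly between |Im z| and Im \<tau>: the lines enclose z and
    stay inside the chambers.\<close>
  define \<epsilon> where "\<epsilon> = (\<bar>Im z\<bar> + Im \<tau>) / 2"
  have \<epsilon>: "0 < \<epsilon>" "\<epsilon> < Im \<tau>" "\<bar>Im z\<bar> \<le> \<epsilon>" and \<tau>: "Im \<tau> > 0"
    using z by (auto simp: \<epsilon>_def)
  define a where "a v i = cc i * ee (of_real (lam (Im v > 0) i) * \<tau> + of_int (rho (Im v > 0) i) * v)" for v i
  define W where "W b i = norm (a (Complex 0 (if b then \<epsilon> else - \<epsilon>)) i)" for b i
  have a: "(a v has_sum \<phi> \<tau> v) UNIV" if "\<bar>Im v\<bar> = \<epsilon>" for v
    unfolding a_def [abs_def] using \<epsilon> that by (intro expansion) auto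
  have norm_a: "norm (a v i) = W (Im v > 0) i" if "\<bar>Im v\<bar> = \<epsilon>" for v i
    using that \<epsilon> by (auto simp: W_def a_def norm_mult norm_ee abs_if split: if_splits)
  have W: "W b summable_on UNIV" "W b i \<ge> 0" for b i
    unfolding W_def [abs_def] using a[of "Complex 0 (if b then \<epsilon> else - \<epsilon>)"] \<epsilon>
    by (auto intro!: complex_summable_imp_norm_summable dest!: has_sum_imp_summable)
  obtain D where D: "D > 0" "\<And>v. \<bar>Im v\<bar> \<ge> \<epsilon> \<Longrightarrow> norm (esin v powi \<nu>) \<le> D * exp (pi * real (nat \<bar>\<nu>\<bar>) * \<bar>Im v\<bar>)"
    using norm_esin_powi_le[OF \<epsilon>(1), of \<nu>] by metis
  define B where "B = D * exp (pi * real (nat \<bar>\<nu>\<bar>) * \<epsilon>)"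
  have B: "B \<ge> 0"
    using D by (simp add: B_def)
  define tail where "tail b F = infsum (W b) {i. lam b i \<notin> F}" for b F
  have tail_nonneg: "tail b F \<ge> 0" for b F
    unfolding tail_def by (intro infsum_nonneg W)
  have bound: "norm (\<psi> \<tau> z - (\<Sum>n\<in>F. E n z * ee (of_real n * \<tau>))) \<le> B * (tail True F + tail False F)"
    if F: "finite F" for F
  proof (rule periodic_strip_maximum_principle[where h = "\<lambda>z. \<psi> \<tau> z - (\<Sum>n\<in>F. E n z * ee (of_real n * \<tau>))", OF _ \<epsilon>(1,2) _ _ \<epsilon>(3)])
    show "(\<lambda>z. \<psi> \<tau> z - (\<Sum>n\<in>F. E n z * ee (of_real n * \<tau>))) holomorphic_on {z. \<bar>Im z\<bar> < Im \<tau>}"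
      by (intro holomorphic_intros \<psi>_holomorphic \<tau> holomorphic_on_subset[OF E_holomorphic]) auto
    show "\<psi> \<tau> (z + 2) - (\<Sum>n\<in>F. E n (z + 2) * ee (of_real n * \<tau>)) = \<psi> \<tau> z - (\<Sum>n\<in>F. E n z * ee (of_real n * \<tau>))"
      if "\<bar>Im z\<bar> < Im \<tau>" for z
      using that by (simp add: \<psi>_period E_period)
  next
    fix v assume v: "\<bar>Im v\<bar> = \<epsilon>"
    define b where "b = (Im v > 0)"
    have nz: "Im v \<noteq> 0" "\<bar>Im v\<bar> < Im \<tau>"
      using v \<epsilon> by auto
    have "(a v has_sum ee (of_real n * \<tau>) * coeff_z n v) {i. lam b i = n}" for n
      unfolding b_def a_def [abs_def] by (rule coeff_z_has_sum_\<tau>[OF nz(1)])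
    then have head: "(a v has_sum (\<Sum>n\<in>F. ee (of_real n * \<tau>) * coeff_z n v)) {i. lam b i \<in> F}"
      by (intro has_sum_fibres F)
    have "(a v has_sum (\<phi> \<tau> v - (\<Sum>n\<in>F. ee (of_real n * \<tau>) * coeff_z n v))) (UNIV - {i. lam b i \<in> F})"
      by (rule has_sum_Diff[OF a[OF v] head]) auto
    also have "UNIV - {i. lam b i \<in> F} = {i. lam b i \<notin> F}"
      by auto
    finally have "norm (\<phi> \<tau> v - (\<Sum>n\<in>F. ee (of_real n * \<tau>) * coeff_z n v)) \<le> tail b F"
    proof (rule norm_infsum_le)
      show "(W b has_sum tail b F) {i. lam b i \<notin> F}"
        unfolding tail_def using W(1)[of b] by (intro has_sum_infsum) (rule summable_on_subset, auto)
    qed (use norm_a[OF v] in \<open>auto simp: b_def\<close>)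
    moreover have "tail b F \<le> tail True F + tail False F"
      using tail_nonneg by (cases b) auto
    ultimately have le: "norm (\<phi> \<tau> v - (\<Sum>n\<in>F. ee (of_real n * \<tau>) * coeff_z n v)) \<le> tail True F + tail False F"
      by linarith
    have "\<psi> \<tau> v - (\<Sum>n\<in>F. E n v * ee (of_real n * \<tau>)) =
        esin v powi \<nu> * (\<phi> \<tau> v - (\<Sum>n\<in>F. ee (of_real n * \<tau>) * coeff_z n v))"
      using nz by (simp add: \<psi>_nonreal E_nonreal right_diff_distrib sum_distrib_left mult_ac)
    then have "norm (\<psi> \<tau> v - (\<Sum>n\<in>F. E n v * ee (of_real n * \<tau>))) =
        norm (esin v powi \<nu>) * norm (\<phi> \<tau> v - (\<Sum>n\<in>F. ee (of_real n * \<tau>) * coeff_z n v))"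
      by (simp add: norm_mult)
    also have "\<dots> \<le> B * (tail True F + tail False F)"
      using D(2)[of v] v le B by (intro mult_mono) (auto simp: B_def)
    finally show "norm (\<psi> \<tau> v - (\<Sum>n\<in>F. E n v * ee (of_real n * \<tau>))) \<le> B * (tail True F + tail False F)" .
  qed
  have "((\<lambda>F. B * (tail True F + tail False F)) \<longlongrightarrow> 0) (finite_subsets_at_top UNIV)"
    unfolding tail_def by (intro tendsto_mult_right_zero tendsto_add_zero infsum_tail_tendsto_0 W)
  then have "((\<lambda>F. \<psi> \<tau> z - (\<Sum>n\<in>F. E n z * ee (of_real n * \<tau>))) \<longlongrightarrow> 0) (finite_subsets_at_top UNIV)"
    by (rule Lim_null_comparison[rotated]) (use bound in \<open>auto intro!: eventually_finite_subsets_at_top_weakI\<close>)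
  then have "((\<lambda>F. \<psi> \<tau> z - (\<psi> \<tau> z - (\<Sum>n\<in>F. E n z * ee (of_real n * \<tau>)))) \<longlongrightarrow> \<psi> \<tau> z - 0) (finite_subsets_at_top UNIV)"
    by (intro tendsto_diff tendsto_const)
  then show ?thesis
    by (simp add: has_sum_def)
qed

end

subsection \<open>Divisibility by cyclotomic polynomials\<close>

text \<open>Each factor x^2 - (f k)^2 has the roots f k and - f k; distinct squares ensure that the
  remaining zeros survive division by it.\<close>

lemma quadratic_factors_dvd:
  fixes p :: "complex poly"
  assumes "finite S" "\<And>k. k \<in> S \<Longrightarrow> f k \<noteq> 0" "inj_on (\<lambda>k. (f k)\<^sup>2) S"
    and "\<And>k. k \<in> S \<Longrightarrow> poly p (f k) = 0" "\<And>k. k \<in> S \<Longrightarrow> poly p (- f k) = 0"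
  shows "(\<Prod>k\<in>S. [:- (f k)\<^sup>2, 0, 1:]) dvd p"
  using assms
proof (induction S arbitrary: p rule: finite_induct)
  case (insert x S)
  have "[:- f x, 1:] dvd p"
    using insert.prems(3)[of x] by (simp add: poly_eq_0_iff_dvd)
  then obtain p1 where p1: "p = [:- f x, 1:] * p1"
    by (elim dvdE)
  have "poly p (- f x) = 0" "f x \<noteq> 0"
    using insert.prems by auto
  then have "poly p1 (- f x) = 0"
    by (simp add: p1)
  then have "[:- (- f x), 1:] dvd p1"
    by (simp only: poly_eq_0_iff_dvd)
  then obtain q where q: "p1 = [:- (- f x), 1:] * q"
    by (elim dvdE)
  have p: "p = [:- (f x)\<^sup>2, 0, 1:] * q"
    unfolding p1 q mult.assoc [symmetric] by (simp add: power2_eq_square)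
  have "poly q (f k) = 0 \<and> poly q (- f k) = 0" if k: "k \<in> S" for k
  proof -
    have "(f k)\<^sup>2 \<noteq> (f x)\<^sup>2"
      using insert.prems(2) insert.hyps k by (auto simp: inj_on_def)
    moreover have "poly p (f k) = 0" "poly p (- f k) = 0"
      using insert.prems(3,4) k by auto
    ultimately show ?thesis
      by (auto simp: p power2_eq_square)
  qed
  then have "(\<Prod>k\<in>S. [:- (f k)\<^sup>2, 0, 1:]) dvd q"
    using insert.prems by (intro insert.IH) auto
  then show ?case
    unfolding p prod.insert[OF insert.hyps] by (intro mult_dvd_mono dvd_refl)
qed simp

lemma poly_cyclotomic_poly: "poly (cyclotomic_poly l) x = (\<Prod>k | k < l \<and> coprime k l. x - ee (of_nat k / of_nat l))"
  by (simp add: cyclotomic_poly_def poly_prod)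

lemma poly_cyclotomic_poly_root:
  assumes "prime l" "\<not> int l dvd k"
  shows "poly (cyclotomic_poly l) (ee (of_int k / of_nat l)) = 0"
proof -
  have l: "l > 0"
    using assms(1) by (simp add: prime_gt_0_nat)
  define k' where "k' = nat (k mod int l)"
  have k': "int k' = k mod int l"
    using l by (simp add: k'_def)
  have "int k' < int l"
    unfolding k' using l by simp
  moreover have "\<not> l dvd k'"
    using assms(2) l by (metis k' dvd_mod_iff int_dvd_int_iff dvd_refl)
  then have "coprime k' l"
    using assms(1) by (metis coprime_commute prime_imp_coprime)
  moreover have "ee (of_int k / of_nat l) = ee (of_nat k' / of_nat l)"
  proof -
    have "k = int k' + (k div int l) * int l"
      by (simp add: k')
    then have "(of_int k :: complex) = of_int (int k' + (k div int l) * int l)"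
      by (rule arg_cong)
    then have "(of_int k :: complex) = of_nat k' + of_int (k div int l) * of_nat l"
      by simp
    then have "(of_int k / of_nat l :: complex) = of_nat k' / of_nat l + of_int (k div int l)"
      using l by (simp add: field_simps)
    then show ?thesis
      by (simp add: ee_add)
  qed
  ultimately show ?thesis
    unfolding poly_cyclotomic_poly by (intro prod_zero) (auto intro!: bexI[of _ k'])
qed

lemma not_dvd_imp_not_Ints:
  assumes "l > 0" "\<not> int l dvd k"
  shows "(of_int k / of_nat l :: complex) \<notin> \<int>"
proof
  assume "(of_int k / of_nat l :: complex) \<in> \<int>"
  then obtain j where "(of_int k / of_nat l :: complex) = of_int j"
    by (auto elim: Ints_cases)
  then have "(of_int k :: complex) = of_int (j * int l)"
    using assms(1) by (simp add: field_simps)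
  then have "k = j * int l"
    by (simp only: of_int_eq_iff)
  then show False
    using assms(2) by simp
qed

text \<open>In the variable x = e(z/2) the divisor is the cyclotomic polynomial at x^2, whose roots
  are e(k/(2l)) and - e(k/(2l)) for k prime to l. All are simple, so it suffices that p vanishes at
  each.\<close>

lemma cyclotomic_divides_laurent_polynomial:
  assumes l: "prime l"
    and F: "\<And>z. F z = ee (- of_nat A * z / 2) * poly p (ee (z / 2))"
    and zero: "\<And>k. \<not> int l dvd k \<Longrightarrow> F (of_int k / of_nat l) = 0"
  shows "cyclotomic_divides l F"
proof -
  define S where "S = {k. k < l \<and> coprime k l}"
  define f where "f k = ee (of_nat k / of_nat l / 2)" for k :: nat
  have l0: "l > 0"
    using l by (simp add: prime_gt_0_nat)
  have sq: "(f k)\<^sup>2 = ee (of_nat k / of_nat l)" for k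
    unfolding f_def power2_eq_square ee_add [symmetric] by simp
  have root: "poly p (ee (of_int k / of_nat l / 2)) = 0" if "\<not> int l dvd k" for k
    using zero[OF that] F[of "of_int k / of_nat l"] by simp
  have ndvd: "\<not> int l dvd int k" if "k \<in> S" for k
    using that l by (auto simp: S_def coprime_absorb_right)
  have "(\<Prod>k\<in>S. [:- (f k)\<^sup>2, 0, 1:]) dvd p"
  proof (rule quadratic_factors_dvd)
    show "inj_on (\<lambda>k. (f k)\<^sup>2) S"
    proof (rule inj_onI)
      fix j k assume jk: "j \<in> S" "k \<in> S" "(f j)\<^sup>2 = (f k)\<^sup>2"
      then have "ee ((of_int (int j - int k)) / of_nat l) = 1"
        by (simp add: sq diff_divide_distrib ee_diff)
      then have "(of_int (int j - int k) / of_nat l :: complex) \<in> \<int>"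
        by (simp only: ee_eq_1_iff)
      then have "int l dvd int j - int k"
        using not_dvd_imp_not_Ints[OF l0] by blast
      moreover have "\<bar>int j - int k\<bar> < int l"
        using jk by (auto simp: S_def)
      ultimately show "j = k"
        using dvd_imp_le_int[of "int j - int k" "int l"] by force
    qed
    show "poly p (f k) = 0" if "k \<in> S" for k
      using root[OF ndvd[OF that]] by (simp add: f_def)
    \<comment> \<open>Replacing k by k + l multiplies e(k/(2l)) by e(1/2) = -1; so zeros at k and at
      k + l are separate conditions, although k/l and k/l + 1 give the same e(z).\<close>
    show "poly p (- f k) = 0" if "k \<in> S" for k
    proof -
      have "ee (1 / 2) = - 1"
        by (simp add: ee_def)
      then have "- f k = ee (of_nat k / of_nat l / 2) * ee (1 / 2)"
        by (simp add: f_def)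
      also have "\<dots> = ee (of_int (int k + int l) / of_nat l / 2)"
        unfolding ee_add [symmetric] using l0 by (intro arg_cong[where f = ee]) (simp add: field_simps)
      finally show ?thesis
        using root[of "int k + int l"] ndvd[OF that] by simp
    qed
  qed (auto simp: S_def f_def)
  then obtain q where q: "p = (\<Prod>k\<in>S. [:- (f k)\<^sup>2, 0, 1:]) * q"
    by (elim dvdE)
  have "F z = poly (cyclotomic_poly l) (ee z) * (ee (of_int (- int A) * z / 2) * poly q (ee (z / 2)))" for z
  proof -
    have "ee (z / 2) * ee (z / 2) = ee z"
      unfolding ee_add [symmetric] by simp
    then have "poly (\<Prod>k\<in>S. [:- (f k)\<^sup>2, 0, 1:]) (ee (z / 2)) = poly (cyclotomic_poly l) (ee z)"
      by (simp add: poly_prod poly_cyclotomic_poly S_def sq)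
    then show ?thesis
      by (simp add: F q)
  qed
  then show ?thesis
    unfolding cyclotomic_divides_def by blast
qed

lemma sum_mult_coprime_residues:
  fixes G :: "int \<Rightarrow> complex"
  assumes M: "M > 0" and per: "\<And>h. G (h + int M) = G h" and u: "coprime u (int M)"
  shows "(\<Sum>h<M. G (u * int h)) = (\<Sum>h<M. G (int h))"
proof -
  have per_mult: "G (h + k * int M) = G h" for h k
  proof (induction k rule: int_induct[where k = 0])
    case (step1 i)
    then show ?case
      using per[of "h + i * int M"] by (simp add: algebra_simps)
  next
    case (step2 i)
    then show ?case
      using per[of "h + (i - 1) * int M"] by (simp add: algebra_simps)
  qed simp
  have mod: "G (h mod int M) = G h" for h
    using per_mult[of "h mod int M" "h div int M"] by (simp add: add.commute)
  define I where "I = {0..<int M}"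
  define f where "f h = (u * h) mod int M" for h
  have sub: "f ` I \<subseteq> I"
    using M by (auto simp: f_def I_def)
  have inj: "inj_on f I"
  proof (rule inj_onI)
    fix x y assume xy: "x \<in> I" "y \<in> I" "f x = f y"
    then have "int M dvd u * (x - y)"
      by (simp add: f_def mod_eq_dvd_iff right_diff_distrib)
    then have "int M dvd x - y"
      using u by (simp add: coprime_commute coprime_dvd_mult_right_iff)
    moreover have "\<bar>x - y\<bar> < int M"
      using xy by (auto simp: I_def)
    ultimately show "x = y"
      using dvd_imp_le_int[of "x - y" "int M"] by force
  qed
  have fI: "f ` I = I"
    using sub inj by (intro endo_inj_surj) (auto simp: I_def)
  have nat: "(\<Sum>h<M. H (int h)) = (\<Sum>h\<in>I. H h)" for H :: "int \<Rightarrow> complex"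
    unfolding I_def by (rule sum.reindex_bij_witness[of _ nat int]) auto
  have "(\<Sum>h<M. G (u * int h)) = (\<Sum>h\<in>I. G (f h))"
    using nat[of "\<lambda>h. G (u * h)"] by (simp add: f_def mod)
  also have "\<dots> = (\<Sum>h\<in>f ` I. G h)"
    using inj by (simp add: sum.reindex)
  also have "\<dots> = (\<Sum>h<M. G (int h))"
    using nat[of G] fI by simp
  finally show ?thesis .
qed

subsection \<open>Torsion points\<close>

text \<open>Both definitions quantify the entries separately; the matrix determines them, so one
  quadruple serves throughout.\<close>

lemma Gamma_Delta_chiD:
  assumes "g \<in> Gamma_Delta_chi \<Gamma> M chi" "has_entries g a b c d"
  shows "g \<in> \<Gamma>" "T_twist a h g \<in> delta_conj \<Gamma> M"
    "chi_tilde M chi (T_twist a h g) = chi_tilde M chi g" "int M dvd b"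
proof -
  have g: "g \<in> Gamma_Delta \<Gamma> M"
    using assms(1) by (simp add: Gamma_Delta_chi_def)
  obtain a' b' c' d' where 1: "has_entries g a' b' c' d'" "\<forall>h. T_twist a' h g \<in> delta_conj \<Gamma> M" "int M dvd b'"
    using g unfolding Gamma_Delta_def by blast
  obtain a'' b'' c'' d'' where 2: "has_entries g a'' b'' c'' d''"
      "\<forall>h. chi_tilde M chi (T_twist a'' h g) = chi_tilde M chi g"
    using assms(1) unfolding Gamma_Delta_chi_def by blast
  show "g \<in> \<Gamma>"
    using g by (simp add: Gamma_Delta_def)
  show "T_twist a h g \<in> delta_conj \<Gamma> M" "int M dvd b"
    using 1(2,3) has_entries_unique[OF assms(2) 1(1)] by simp_all
  show "chi_tilde M chi (T_twist a h g) = chi_tilde M chi g"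
    using 2(2) has_entries_unique[OF assms(2) 2(1)] by simp
qed

lemma jacobi_dom_add_lattice:
  assumes "(\<tau>, z) \<in> jacobi_dom"
  shows "(\<tau>, z + of_int u * \<tau> + of_int v) \<in> jacobi_dom"
proof -
  have "z \<in> period_lattice \<tau>" if lat: "z + of_int u * \<tau> + of_int v \<in> period_lattice \<tau>"
  proof -
    obtain u' v' where "z + of_int u * \<tau> + of_int v = of_int u' * \<tau> + of_int v'"
      using lat unfolding period_lattice_def by blast
    then have "z = of_int (u' - u) * \<tau> + of_int (v' - v)"
      by (simp add: algebra_simps)
    then show ?thesis
      unfolding period_lattice_def by blast
  qed
  then show ?thesis
    using assms by (auto simp: jacobi_dom_def)
qed

lemma sum_roots_of_unity:
  assumes M: "M > 0" and u: "u \<in> \<int>"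
  shows "(\<Sum>h<M. ee (of_real (real h * u / real M))) = (if u / real M \<in> \<int> then of_nat M else 0)"
proof -
  define \<theta> where "\<theta> = ee (of_real (u / real M))"
  have "ee (of_real (real h * u / real M)) = \<theta> ^ h" for h
    unfolding \<theta>_def ee_of_nat_mult [symmetric] by simp
  then have "(\<Sum>h<M. ee (of_real (real h * u / real M))) = (\<Sum>h<M. \<theta> ^ h)"
    by simp
  also have "\<dots> = (if u / real M \<in> \<int> then of_nat M else 0)"
  proof (cases "\<theta> = 1")
    case True
    then have "u / real M \<in> \<int>"
      unfolding \<theta>_def ee_of_real_eq_1_iff .
    then show ?thesis
      by (simp add: True)
  next
    case False
    have "\<theta> ^ M = ee (of_real u)"
      unfolding \<theta>_def ee_of_nat_mult [symmetric] using M by simp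
    then have "\<theta> ^ M = 1"
      using u by (simp add: ee_of_real_eq_1_iff)
    moreover have "u / real M \<notin> \<int>"
      using False unfolding \<theta>_def ee_of_real_eq_1_iff .
    ultimately show ?thesis
      using False by (simp add: sum_gp_strict)
  qed
  finally show ?thesis .
qed

context nonzero_jacobi_form
begin

lemma real_point_has_sum:
  assumes "Im \<tau> > 0" "Im x = 0" "x \<notin> \<int>"
  shows "((\<lambda>n. E n x * ee (of_real n * \<tau>)) has_sum esin x powi \<nu> * \<phi> \<tau> x) UNIV"
  using \<psi>_has_sum[of x \<tau>] \<psi>_off_Ints[of x \<tau>] assms by simp

lemma E_support: "E n z \<noteq> 0 \<Longrightarrow> n - of_rat \<beta> \<in> \<int>"
  using E_eq_0I[of n] fourier_support[of n] by blast

section \<open>Isolating exponents in a class modulo M\<close>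

definition section_sum :: "nat \<Rightarrow> real \<Rightarrow> complex \<Rightarrow> complex \<Rightarrow> complex" where
  "section_sum M \<gamma> x \<tau> = (\<Sum>h<M. ee (- of_real (real h * \<gamma> / real M)) * \<phi> ((\<tau> + of_nat h) / of_nat M) x)"

text \<open>Orthogonality of roots of unity: the sum over h of e(h (n - \<gamma>)/M) is M or 0
  according to whether M divides n - \<gamma>.\<close>

lemma section_sum_has_sum:
  assumes M: "M > 0" and \<tau>: "Im \<tau> > 0" and x: "Im x = 0" "x \<notin> \<int>" and \<gamma>: "\<gamma> - of_rat \<beta> \<in> \<int>"
  shows "((\<lambda>n. (if (n - \<gamma>) / real M \<in> \<int> then of_nat M * E n x else 0) * ee (of_real (n / real M) * \<tau>)) has_sum
            esin x powi \<nu> * section_sum M \<gamma> x \<tau>) UNIV"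
proof -
  have "((\<lambda>n. \<Sum>h<M. ee (- of_real (real h * \<gamma> / real M)) * (E n x * ee (of_real n * ((\<tau> + of_nat h) / of_nat M)))) has_sum
      (\<Sum>h<M. ee (- of_real (real h * \<gamma> / real M)) * (esin x powi \<nu> * \<phi> ((\<tau> + of_nat h) / of_nat M) x))) UNIV"
    using M \<tau> x by (intro has_sum_sum has_sum_cmult_right real_point_has_sum) auto
  also have "(\<Sum>h<M. ee (- of_real (real h * \<gamma> / real M)) * (esin x powi \<nu> * \<phi> ((\<tau> + of_nat h) / of_nat M) x))
      = esin x powi \<nu> * section_sum M \<gamma> x \<tau>"
    by (simp add: section_sum_def sum_distrib_left mult_ac)
  also have "(\<lambda>n. \<Sum>h<M. ee (- of_real (real h * \<gamma> / real M)) * (E n x * ee (of_real n * ((\<tau> + of_nat h) / of_nat M))))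
      = (\<lambda>n. (if (n - \<gamma>) / real M \<in> \<int> then of_nat M * E n x else 0) * ee (of_real (n / real M) * \<tau>))"
  proof
    fix n
    show "(\<Sum>h<M. ee (- of_real (real h * \<gamma> / real M)) * (E n x * ee (of_real n * ((\<tau> + of_nat h) / of_nat M))))
      = (if (n - \<gamma>) / real M \<in> \<int> then of_nat M * E n x else 0) * ee (of_real (n / real M) * \<tau>)"
    proof (cases "E n x = 0")
      case False
      have "n - \<gamma> = (n - of_rat \<beta>) - (\<gamma> - of_rat \<beta>)"
        by simp
      \<comment> \<open>Integrality of n - \<gamma> is what makes e((n - \<gamma>)/M) an M-th root
        of unity.\<close>
      then have u: "n - \<gamma> \<in> \<int>"
        using E_support[OF False] \<gamma> by (metis Ints_diff)
      have "ee (- of_real (real h * \<gamma> / real M)) * ee (of_real n * ((\<tau> + of_nat h) / of_nat M))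
          = ee (of_real (n / real M) * \<tau>) * ee (of_real (real h * (n - \<gamma>) / real M))" for h
        unfolding ee_add [symmetric] using M by (intro arg_cong[where f = ee]) (simp add: field_simps)
      then have "(\<Sum>h<M. ee (- of_real (real h * \<gamma> / real M)) * (E n x * ee (of_real n * ((\<tau> + of_nat h) / of_nat M))))
          = E n x * ee (of_real (n / real M) * \<tau>) * (\<Sum>h<M. ee (of_real (real h * (n - \<gamma>) / real M)))"
        by (simp only: mult.left_commute[of _ "E n x"] sum_distrib_left mult.assoc)
      then show ?thesis
        unfolding sum_roots_of_unity[OF M u] by simp
    qed simp
  qed
  finally show ?thesis .
qed

lemma section_sum_eq_0:
  assumes M: "M > 0" and \<tau>: "Im \<tau> > 0" and x: "Im x = 0" "x \<notin> \<int>" and \<gamma>: "\<gamma> - of_rat \<beta> \<in> \<int>"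
    and zero: "\<And>n. (n - \<gamma>) / real M \<in> \<int> \<Longrightarrow> E n x = 0"
  shows "section_sum M \<gamma> x \<tau> = 0"
proof -
  have "((\<lambda>n::real. 0) has_sum esin x powi \<nu> * section_sum M \<gamma> x \<tau>) UNIV"
    by (rule has_sum_cong[THEN iffD1, OF _ section_sum_has_sum[OF M \<tau> x \<gamma>]]) (use zero in auto)
  then have "esin x powi \<nu> * section_sum M \<gamma> x \<tau> = 0"
    using has_sum_0_simp has_sum_unique by blast
  then show ?thesis
    using x by (simp add: esin_eq_0_iff)
qed

text \<open>The section sum is an almost periodic series in Re \<tau> with pairwise distinct
  frequencies n/M; if it vanishes, so does each coefficient.\<close>

lemma E_eq_0_if_section_sum_eq_0:
  assumes M: "M > 0" and x: "Im x = 0" "x \<notin> \<int>" and \<gamma>: "\<gamma> - of_rat \<beta> \<in> \<int>"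
    and zero: "\<And>\<tau>. Im \<tau> > 0 \<Longrightarrow> section_sum M \<gamma> x \<tau> = 0" and n: "(n - \<gamma>) / real M \<in> \<int>"
  shows "E n x = 0"
proof -
  define a where "a n = (if (n - \<gamma>) / real M \<in> \<int> then of_nat M * E n x else 0) * ee (of_real (n / real M) * \<i>)" for n
  have "(a has_sum 0) {k \<in> UNIV. k / real M = n / real M}"
  proof (rule almost_periodic_unique)
    fix y :: real
    have "((\<lambda>n. (if (n - \<gamma>) / real M \<in> \<int> then of_nat M * E n x else 0) * ee (of_real (n / real M) * (\<i> + of_real y))) has_sum 0) UNIV"
      using section_sum_has_sum[OF M _ x \<gamma>, of "\<i> + of_real y"] zero[of "\<i> + of_real y"] by simp
    then show "((\<lambda>n. a n * ee (of_real (n / real M * y))) has_sum 0) UNIV"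
      by (simp add: a_def distrib_left ee_add mult.assoc)
  qed
  moreover have "{k \<in> UNIV. k / real M = n / real M} = {n}"
    using M by auto
  ultimately have "a n = 0"
    by (simp add: has_sum_finite_iff)
  then show ?thesis
    using n M by (simp add: a_def)
qed

text \<open>With l dividing c, the automorphy factor of g takes a k/l to a lattice translate of k/l.
  The modular law for the conjugated twist followed by the elliptic law therefore relates torsion
  values; \<open>C\<close> is chosen before h and serves for all h.\<close>

lemma torsion_transformation:
  fixes l M :: nat
  assumes l: "prime l" and M: "M > 0"
    and g: "g \<in> Gamma_Delta_chi \<Gamma> M chi" "has_entries g a b c d" and lc: "int l dvd c"
    and k: "\<not> int l dvd k" and \<tau>: "\<tau> \<in> upper_half"
  obtains C where "C \<noteq> 0"
    "\<And>h. \<phi> ((mob (fst g) \<tau> + of_int (a\<^sup>2 * h)) / of_nat M) (of_int (a * k) / of_nat l) =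
          C * \<phi> ((\<tau> + of_int h) / of_nat M) (of_int k / of_nat l)"
proof -
  note g\<Gamma> = Gamma_Delta_chiD(1)[OF g] and twist = Gamma_Delta_chiD(2)[OF g] and chi_const = Gamma_Delta_chiD(3)[OF g]
  have \<Gamma>C: "\<Gamma> \<subseteq> carrier GMp"
    using subgroup by (rule subgroup.subset)
  obtain c' where c': "c = int l * c'"
    using lc by (elim dvdE)
  have l0: "l > 0"
    using l by (simp add: prime_gt_0_nat)
  have det: "a * d - b * c = 1"
    using g\<Gamma> \<Gamma>_subset by (intro Mp1Z_det[OF _ g(2)]) auto
  define A \<omega> where "A = fst g" and "\<omega> = snd g"
  have g_eq: "g = (A, \<omega>)"
    by (simp add: A_def \<omega>_def)
  have carrier: "(A, \<omega>) \<in> carrier GMp"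
    using g\<Gamma> \<Gamma>C g_eq by auto
  have \<omega>0: "\<omega> \<tau> \<noteq> 0"
  proof -
    have "(\<omega> \<tau>)\<^sup>2 = autfac A \<tau>" "autfac A \<tau> \<noteq> 0"
      using carrier \<tau> by (auto simp: carrier_GMp autfac_nonzero)
    then show ?thesis by auto
  qed
  define j where "j = of_int c * \<tau> + of_int d"
  have j0: "j \<noteq> 0"
  proof -
    have "autfac A \<tau> = j"
      using g(2) by (simp add: g_eq has_entries_def autfac_def j_def)
    then show ?thesis
      using carrier \<tau> autfac_nonzero[of A \<tau>] by (auto simp: carrier_GMp)
  qed
  define k' where "k' = a * k"
  \<comment> \<open>With t = (\<tau> + h)/M, expanding (k'/l)(c \<tau> + d) gives k/l + u t + v; u
    is the coefficient of M t = \<tau> + h times M and is independent of h.\<close>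
  define u where "u = k' * int M * c'"
  define x where "x = (of_int k / of_nat l :: complex)"
  \<comment> \<open>Weight factor and character value come from the modular law; the exponential is
    what remains after the exponents of the two laws cancel.\<close>
  define C where "C = \<omega> \<tau> powi w * chi_tilde M chi g * ee (- of_real m * of_int u * x)"
  have x_notin: "x \<notin> \<int>"
    unfolding x_def by (rule not_dvd_imp_not_Ints[OF l0 k])
  have key: "\<phi> ((mob (fst g) \<tau> + of_int (a\<^sup>2 * h)) / of_nat M) (of_int k' / of_nat l) =
          C * \<phi> ((\<tau> + of_int h) / of_nat M) x \<and> chi_tilde M chi g \<noteq> 0" for h
  proof -
    obtain B \<theta> where B: "(B, \<theta>) \<in> \<Gamma>" "mp_iota M (T_twist a h g) = (B, \<theta>)"
      "B $ 2 $ 1 = of_int (int M * c)" "B $ 2 $ 2 = of_int (d - c * h)"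
      "\<And>\<tau>. \<tau> \<in> upper_half \<Longrightarrow> \<theta> ((\<tau> + of_int h) / of_nat M) = snd g \<tau>"
      "\<And>\<tau>. \<tau> \<in> upper_half \<Longrightarrow> mob B ((\<tau> + of_int h) / of_nat M) = (mob (fst g) \<tau> + of_int (a\<^sup>2 * h)) / of_nat M"
      using T_twist_in_delta_conj[OF M \<Gamma>C _ g(2) twist] g\<Gamma> \<Gamma>C by blast
    have chiB: "chi (B, \<theta>) = chi_tilde M chi g"
      using chi_const[of h] B(2) by (simp add: chi_tilde_def)
    have chi0: "chi_tilde M chi g \<noteq> 0"
      using character B(1) unfolding chiB [symmetric] is_character_def by blast
    define t where "t = (\<tau> + of_int h) / of_nat M"
    have tM: "of_nat M * t = \<tau> + of_int h"
      using M by (simp add: t_def)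
    have Im_t: "Im t > 0"
      using \<tau> M by (simp add: t_def upper_half_def)
    have dom0: "(t, x) \<in> jacobi_dom"
      using Im_t x_notin by (intro jacobi_domI) (auto simp: x_def)
    \<comment> \<open>The first summand is (k' d - k)/l, by the determinant relation; the second
      compensates the shift of M t by h. Only v depends on h.\<close>
    define v where "v = k * b * c' - k' * c' * h"
    define z where "z = x + of_int u * t + of_int v"
    have dom: "(t, z) \<in> jacobi_dom"
      unfolding z_def by (rule jacobi_dom_add_lattice[OF dom0])
    have jB: "autfac B t = j"
    proof -
      have "autfac B t = of_int c * (of_nat M * t) + of_int (d - c * h)"
        by (simp add: autfac_def B(3,4) mult_ac)
      then show ?thesis
        unfolding tM by (simp add: j_def algebra_simps)
    qed
    have zl: "z * of_nat l = of_int k' * j"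
    proof -
      have "z * of_nat l = of_int k + of_int (k' * c) * (of_nat M * t) + of_int (k * b * c - k' * c * h)"
        using l0 by (simp add: z_def x_def u_def v_def c' field_simps)
      also have "\<dots> = of_int (k + k * b * c) + of_int (k' * c) * \<tau>"
        unfolding tM by (simp add: algebra_simps)
      also have "k + k * b * c = k' * d"
        using det by (simp add: k'_def) algebra
      finally show ?thesis
        by (simp add: j_def algebra_simps)
    qed
    then have z_eq: "z = of_int k' / of_nat l * j"
      using l0 by (simp add: field_simps)
    define y where "y = (of_int k' / of_nat l :: complex)"
    have zj: "z / j = y" "z = y * j"
      using j0 by (auto simp: z_eq y_def)
    \<comment> \<open>\<open>P\<close> belongs to the modular law and \<open>Q\<close> to the
      elliptic law. Since z = y j, one finds P = m u z and Q = m u (z + x), so v and t disappear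
      from P - Q.\<close>
    define P where "P = of_real m * of_int (int M * c) * z\<^sup>2 / j"
    define Q where "Q = of_real m * (of_int u ^ 2 * t + 2 * of_int u * x + of_int (u * v))"
    have mod: "\<omega> \<tau> powi (- w) * ee (- P) * \<phi> (mob B t) y = chi_tilde M chi g * \<phi> t z"
    proof -
      have "\<theta> t = \<omega> \<tau>"
        using B(5)[OF \<tau>] by (simp add: t_def \<omega>_def)
      from modular[OF B(1) dom, unfolded jB zj(1) chiB B(3) this] show ?thesis
        by (simp add: P_def)
    qed
    have ell: "ee Q * \<phi> t z = \<phi> t x"
      using elliptic[OF dom0, of u v 0] by (simp add: z_def Q_def)
    have "of_int (int M * c) * y = of_int u"
      using l0 by (simp add: y_def u_def c' field_simps)
    then have "of_int (int M * c) * z\<^sup>2 / j = of_int u * z"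
      using j0 by (simp add: zj(2) power2_eq_square mult.assoc [symmetric])
    then have "P = of_real m * (of_int u * z)"
      unfolding P_def by (simp only: mult.assoc times_divide_eq_right [symmetric])
    then have PQ: "P - Q = - of_real m * of_int u * x"
      by (simp add: Q_def z_def algebra_simps power2_eq_square)
    have "\<phi> (mob B t) y = (\<omega> \<tau> powi w * ee P) * (\<omega> \<tau> powi (- w) * ee (- P) * \<phi> (mob B t) y)"
    proof -
      have "\<omega> \<tau> powi w * \<omega> \<tau> powi (- w) = 1" "ee P * ee (- P) = 1"
        using \<omega>0 by (auto simp: power_int_minus simp flip: ee_add)
      then have "(\<omega> \<tau> powi w * \<omega> \<tau> powi (- w)) * (ee P * ee (- P)) * \<phi> (mob B t) y = \<phi> (mob B t) y"
        by simp
      then show ?thesis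
        by (simp only: mult_ac)
    qed
    also have "\<dots> = \<omega> \<tau> powi w * chi_tilde M chi g * (ee P * \<phi> t z)"
      unfolding mod by (simp add: mult_ac)
    also have "ee P * \<phi> t z = ee (P - Q) * (ee Q * \<phi> t z)"
      by (simp add: mult.assoc [symmetric] flip: ee_add)
    also have "\<dots> = ee (- of_real m * of_int u * x) * \<phi> t x"
      unfolding ell PQ ..
    finally have "\<phi> (mob B t) y = C * \<phi> t x"
      by (simp add: C_def mult_ac)
    then show ?thesis
      using B(6)[OF \<tau>] chi0 by (simp add: y_def t_def)
  qed
  have "C \<noteq> 0"
    using key[of 0] \<omega>0 by (simp add: C_def)
  then show ?thesis
    using that key unfolding k'_def x_def by blast
qed

text \<open>The section sum for \<beta> vanishes at g \<tau> and the torsion point a k/l. Reindexing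
  by h -> a^2 h and applying the torsion transformation turns it into a nonzero multiple of the sum
  for a^2 \<beta> at \<tau> and k/l.\<close>

lemma E_zero_transfer:
  fixes l M :: nat
  assumes l: "prime l" and M: "M > 0"
    and g: "g \<in> Gamma_Delta_chi \<Gamma> M chi" "has_entries g a b c d" and lc: "int l dvd c"
    and a\<beta>: "of_int (a\<^sup>2) * of_rat \<beta> - of_rat \<beta> \<in> (\<int> :: real set)"
    and zero: "\<And>n k. (n - of_rat \<beta>) / real M \<in> \<int> \<Longrightarrow> \<not> int l dvd k \<Longrightarrow> E n (of_int k / of_nat l) = 0"
    and n: "(n - of_int (a\<^sup>2) * of_rat \<beta>) / real M \<in> \<int>" and k: "\<not> int l dvd k"
  shows "E n (of_int k / of_nat l) = 0"
proof (rule E_eq_0_if_section_sum_eq_0[OF M _ _ a\<beta> _ n])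
  have l0: "l > 0"
    using l by (simp add: prime_gt_0_nat)
  show x: "Im (of_int k / of_nat l) = 0" "of_int k / of_nat l \<notin> (\<int> :: complex set)"
    using not_dvd_imp_not_Ints[OF l0 k] by auto
  note g\<Gamma> = Gamma_Delta_chiD(1)[OF g] and Mb = Gamma_Delta_chiD(4)[OF g]
  have det: "a * d - b * c = 1"
    using g\<Gamma> \<Gamma>_subset by (intro Mp1Z_det[OF _ g(2)]) auto
  \<comment> \<open>Since M divides b, a common divisor of a and M divides a d - b c = 1.\<close>
  have "coprime a (int M)"
  proof (rule coprimeI)
    fix q assume "q dvd a" "q dvd int M"
    then have "q dvd a * d - b * c"
      using Mb by (meson dvd_diff dvd_mult2 dvd_trans)
    then show "is_unit q"
      using det by simp
  qed
  then have cop: "coprime (a\<^sup>2) (int M)"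
    by simp
  \<comment> \<open>Since l divides c, the determinant makes a a unit modulo l, so a k stays prime
    to l.\<close>
  have "\<not> int l dvd a"
  proof
    assume "int l dvd a"
    then have "int l dvd a * d - b * c"
      using lc by (meson dvd_diff dvd_mult dvd_mult2)
    then show False
      using det l by (simp add: prime_nat_iff)
  qed
  then have ak: "\<not> int l dvd a * k"
    using k l by (simp add: prime_dvd_mult_iff)
  define y where "y = (of_int (a * k) / of_nat l :: complex)"
  have y: "Im y = 0" "y \<notin> \<int>"
    using not_dvd_imp_not_Ints[OF l0 ak] by (auto simp: y_def)
  fix \<tau> :: complex assume \<tau>: "Im \<tau> > 0"
  obtain C where C: "C \<noteq> 0"
    "\<And>h. \<phi> ((mob (fst g) \<tau> + of_int (a\<^sup>2 * h)) / of_nat M) y = C * \<phi> ((\<tau> + of_int h) / of_nat M) (of_int k / of_nat l)"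
    using torsion_transformation[OF l M g lc k, of \<tau>] \<tau> unfolding y_def upper_half_def by blast
  define \<tau>' where "\<tau>' = mob (fst g) \<tau>"
  have \<tau>': "Im \<tau>' > 0"
  proof -
    have "fst g \<in> {A. det A > 0}"
      using subgroup.subset[OF subgroup] g\<Gamma> carrier_GMp[of "fst g" "snd g"] by auto
    then show ?thesis
      using mob_in_upper_half[of "fst g" \<tau>] \<tau> by (simp add: \<tau>'_def upper_half_def)
  qed
  \<comment> \<open>The weight is chosen so that \<open>G\<close> has period M: the shift \<tau> ->
    \<tau> + 1 contributes e(\<beta>), which the weight cancels. The sum then runs over residues
    modulo M.\<close>
  define G where "G h = ee (- of_real (of_int h * of_rat \<beta> / real M)) * \<phi> ((\<tau>' + of_int h) / of_nat M) y" for h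
  have per: "G (h + int M) = G h" for h
  proof -
    define t where "t = (\<tau>' + of_int h) / of_nat M"
    have "(\<tau>' + of_int (h + int M)) / of_nat M = t + 1"
      using M by (simp add: t_def field_simps)
    moreover have "\<phi> (t + 1) y = ee (of_rat \<beta>) * \<phi> t y"
      using \<tau>' M y by (intro \<tau>_period jacobi_domI) (auto simp: t_def)
    moreover have "ee (- of_real (of_int (h + int M) * of_rat \<beta> / real M)) * ee (of_rat \<beta>)
        = ee (- of_real (of_int h * of_rat \<beta> / real M))"
      unfolding ee_add [symmetric] using M by (intro arg_cong[where f = ee]) (simp add: field_simps)
    ultimately show ?thesis
      by (simp add: G_def t_def mult.assoc [symmetric])
  qed
  have "0 = section_sum M (of_rat \<beta>) y \<tau>'"
    unfolding y_def
    by (intro section_sum_eq_0[OF M \<tau>' y[unfolded y_def], symmetric] zero[OF _ ak]) simp_all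
  also have "\<dots> = (\<Sum>h<M. G (int h))"
    by (simp add: section_sum_def G_def)
  also have "\<dots> = (\<Sum>h<M. G (a\<^sup>2 * int h))"
    by (rule sum_mult_coprime_residues[where G = G, OF M per cop, symmetric])
  \<comment> \<open>At index a^2 h the weight for \<beta> is the weight for a^2 \<beta> at h, and
    \<open>C\<close> connects the point over \<tau>' at index a^2 h with the one over \<tau> at
    index h.\<close>
  also have "\<dots> = (\<Sum>h<M. C * (ee (- of_real (real h * (of_int (a\<^sup>2) * of_rat \<beta>) / real M)) *
      \<phi> ((\<tau> + of_nat h) / of_nat M) (of_int k / of_nat l)))"
  proof (rule sum.cong)
    fix h
    have "of_int (a\<^sup>2 * int h) * of_rat \<beta> / real M = real h * (of_int (a\<^sup>2) * of_rat \<beta>) / real M"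
      by (simp add: mult_ac)
    then show "G (a\<^sup>2 * int h) = C * (ee (- of_real (real h * (of_int (a\<^sup>2) * of_rat \<beta>) / real M)) *
      \<phi> ((\<tau> + of_nat h) / of_nat M) (of_int k / of_nat l))"
      unfolding G_def \<tau>'_def C(2) by (simp only: of_int_of_nat_eq mult.left_commute[of C])
  qed simp
  also have "\<dots> = C * section_sum M (of_int (a\<^sup>2) * of_rat \<beta>) (of_int k / of_nat l) \<tau>"
    by (simp add: section_sum_def sum_distrib_left)
  finally show "section_sum M (of_int (a\<^sup>2) * of_rat \<beta>) (of_int k / of_nat l) \<tau> = 0"
    using C(1) by simp
qed

text \<open>The factorization holds for Im z > 0 and both sides are entire, so it can be evaluated
  at real torsion points.\<close>

lemma E_zero_if_cyclotomic_divides: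
  assumes l: "prime l" and div: "cyclotomic_divides l (fourier_coeff_tilde \<phi> n)" and k: "\<not> int l dvd k"
  shows "E n (of_int k / of_nat l) = 0"
proof -
  obtain p s where ps: "\<And>z. Im z > 0 \<Longrightarrow> fourier_coeff_tilde \<phi> n z =
      poly (cyclotomic_poly l) (ee z) * (ee (of_int s * z / 2) * poly p (ee (z / 2)))"
    using div unfolding cyclotomic_divides_def by blast
  have "E n z = poly (cyclotomic_poly l) (ee z) * (ee (of_int s * z / 2) * poly p (ee (z / 2)))" for z
  proof (rule E_eqI)
    have "(\<lambda>z. poly q (f z)) holomorphic_on UNIV" if "f holomorphic_on UNIV" for q :: "complex poly" and f
      using that by (induction q) (auto intro!: holomorphic_intros)
    then show "(\<lambda>z. poly (cyclotomic_poly l) (ee z) * (ee (of_int s * z / 2) * poly p (ee (z / 2)))) holomorphic_on UNIV"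
      by (intro holomorphic_intros) auto
  qed (simp add: E_eq_fourier_coeff_tilde ps)
  then show ?thesis
    by (simp add: poly_cyclotomic_poly_root[OF l k])
qed

lemma cyclotomic_divides_if_E_zero:
  assumes l: "prime l" and zero: "\<And>k. \<not> int l dvd k \<Longrightarrow> E n (of_int k / of_nat l) = 0"
  shows "cyclotomic_divides l (fourier_coeff_tilde \<phi> n)"
proof -
  obtain A p where "\<And>z. E n z = ee (- of_nat A * z / 2) * poly p (ee (z / 2))"
    using E_eq_laurent_polynomial[of n] by blast
  then have "cyclotomic_divides l (E n)"
    using zero by (rule cyclotomic_divides_laurent_polynomial[where F = "E n", OF l])
  then show ?thesis
    unfolding cyclotomic_divides_def by (simp add: E_eq_fourier_coeff_tilde)
qed

end

section \<open>Vanishing coefficients and the congruence on the new class\<close>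

lemma (in jacobi_form) fourier_coeff_eq_0:
  assumes "\<And>\<tau> z. (\<tau>, z) \<in> jacobi_dom \<Longrightarrow> \<phi> \<tau> z = 0"
  shows "fourier_coeff \<phi> n r = 0"
proof (rule jacobi_fourier_zero)
  fix \<tau> z :: complex assume *: "0 < Im z" "Im z < Im \<tau>"
  then have "(\<tau>, z) \<in> jacobi_dom"
    by (intro jacobi_domI) (auto elim!: Ints_cases)
  then show "((\<lambda>(n, r). fourier_coeff \<phi> n r * ee (of_real n * \<tau> + of_int r * z)) has_sum 0) UNIV"
    using fourier[unfolded jacobi_fourier_def, rule_format, of z \<tau>] * assms[of \<tau> z] by simp
qed

lemma cyclotomic_divides_if_fourier_coeff_eq_0:
  assumes "\<And>r. fourier_coeff \<phi> n r = 0"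
  shows "cyclotomic_divides l (fourier_coeff_tilde \<phi> n)"
  unfolding cyclotomic_divides_def fourier_coeff_tilde_def fourier_coeff_z_def
  by (rule exI[of _ 0]) (simp add: assms)

theorem theorem3p9:
  fixes \<Gamma> :: "mp set" and chi :: "mp \<Rightarrow> complex" and \<beta> :: rat
    and w :: int and m :: real and \<phi> :: "complex \<Rightarrow> complex \<Rightarrow> complex"
    and l M :: nat
  assumes "subgroup \<Gamma> GMp" and "\<Gamma> \<subseteq> Mp1Z"
    and "is_character \<Gamma> chi"
    and "mpT \<in> \<Gamma>" and "chi mpT = ee (of_rat \<beta>)"
    and "weakly_holomorphic_jacobi_form \<Gamma> chi w m \<phi>"
    and "prime l" and "M > 0"
    and "explains_congruence \<phi> l M \<beta>"
  shows "\<forall>a :: int. (\<exists>g b c d. g \<in> Gamma_Delta_chi \<Gamma> M chi \<inter> Gamma0_tilde l \<and> has_entries g a b c d)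
           \<longrightarrow> explains_congruence \<phi> l M (of_int (a\<^sup>2) * \<beta>)"
proof (intro allI impI)
  fix a :: int
  assume "\<exists>g b c d. g \<in> Gamma_Delta_chi \<Gamma> M chi \<inter> Gamma0_tilde l \<and> has_entries g a b c d"
  then obtain g b c d where g: "g \<in> Gamma_Delta_chi \<Gamma> M chi" "g \<in> Gamma0_tilde l" "has_entries g a b c d"
    by blast
  interpret jacobi_form \<Gamma> chi \<beta> w m \<phi>
    using assms by (intro jacobi_form.intro)
  have lc: "int l dvd c"
    using g(2) has_entries_unique(3)[OF g(3)] unfolding Gamma0_tilde_def by blast
  have hyp: "cyclotomic_divides l (fourier_coeff_tilde \<phi> (of_int (int M * j) + of_rat \<beta>))" for j
    using assms(9) by (simp add: explains_congruence_def)
  define \<gamma> :: real where "\<gamma> = of_int (a\<^sup>2) * of_rat \<beta>"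
  have \<gamma>: "of_rat (of_int (a\<^sup>2) * \<beta>) = \<gamma>"
    by (simp add: \<gamma>_def of_rat_mult of_rat_power)
  have "cyclotomic_divides l (fourier_coeff_tilde \<phi> (of_int (int M * j) + \<gamma>))" for j
  \<comment> \<open>If a^2 \<beta> is not congruent to \<beta> modulo 1, or if the form is zero, all
    coefficients on the new class vanish, and 0 is divisible. The remaining case provides what the
    analytic part requires.\<close>
  proof (cases "(\<exists>\<tau> z. (\<tau>, z) \<in> jacobi_dom \<and> \<phi> \<tau> z \<noteq> 0) \<and> \<gamma> - of_rat \<beta> \<in> \<int>")
    case False
    have "fourier_coeff \<phi> (of_int (int M * j) + \<gamma>) r = 0" for r
    proof (rule ccontr)
      assume nz: "fourier_coeff \<phi> (of_int (int M * j) + \<gamma>) r \<noteq> 0"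
      then have "of_int (int M * j) + \<gamma> - of_rat \<beta> \<in> \<int>"
        by (rule fourier_support)
      then have "(of_int (int M * j) + \<gamma> - of_rat \<beta>) - of_int (int M * j) \<in> \<int>"
        by (rule Ints_diff) (rule Ints_of_int)
      then have "\<gamma> - of_rat \<beta> \<in> \<int>"
        by simp
      moreover have "\<exists>\<tau> z. (\<tau>, z) \<in> jacobi_dom \<and> \<phi> \<tau> z \<noteq> 0"
        using fourier_coeff_eq_0 nz by blast
      ultimately show False
        using False by blast
    qed
    then show ?thesis
      by (rule cyclotomic_divides_if_fourier_coeff_eq_0)
  next
    case True
    then obtain \<tau>0 z0 where nz: "(\<tau>0, z0) \<in> jacobi_dom" "\<phi> \<tau>0 z0 \<noteq> 0"
      by blast
    interpret nonzero_jacobi_form \<Gamma> chi \<beta> w m \<phi> \<tau>0 z0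
      using nz by unfold_locales
    have zero: "E n (of_int k / of_nat l) = 0" if "(n - of_rat \<beta>) / real M \<in> \<int>" "\<not> int l dvd k" for n k
    proof -
      obtain j where "(n - of_rat \<beta>) / real M = of_int j"
        using \<open>(n - of_rat \<beta>) / real M \<in> \<int>\<close> by (auto elim: Ints_cases)
      then have "n = of_int (int M * j) + of_rat \<beta>"
        using \<open>M > 0\<close> by (simp add: field_simps)
      then show ?thesis
        using E_zero_if_cyclotomic_divides[OF \<open>prime l\<close> hyp[of j] that(2)] by simp
    qed
    show ?thesis
    proof (rule cyclotomic_divides_if_E_zero[OF \<open>prime l\<close>])
      fix k assume k: "\<not> int l dvd k"
      have "(of_int (int M * j) + \<gamma> - of_int (a\<^sup>2) * of_rat \<beta>) / real M \<in> \<int>"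
        using \<open>M > 0\<close> by (simp add: \<gamma>_def)
      then show "E (of_int (int M * j) + \<gamma>) (of_int k / of_nat l) = 0"
        using True k by (intro E_zero_transfer[OF \<open>prime l\<close> \<open>M > 0\<close> g(1,3) lc _ zero]) (auto simp: \<gamma>_def)
    qed
  qed
  \<comment> \<open>Integrality concerns all coefficients of \<open>\<phi>\<close>, irrespective of
    the class, and is inherited from the hypothesis.\<close>
  then show "explains_congruence \<phi> l M (of_int (a\<^sup>2) * \<beta>)"
    using assms(9) unfolding explains_congruence_def \<gamma> by blast
qed

end
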